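(* There is a data structure for the point location problem in the arrangement of $n$ congruent disks in the plane with $O(n^4\log n)$ preprocessing time and $O(\log n)$ query time.
   Context: The arrangement of a set of disks is the subdivision of the plane induced by their boundary circles. Point location problem: preprocess the $n$ disks so that, given a query point $q$ in the plane, the face of the arrangement that contains $q$ is returned. Congruent disks are disks of equal radius. Running times are measured in the real-RAM model. *)

theory Defs
  imports "HOL-Analysis.Analysis" "HOL-Library.Landau_Symbols"
begin

section \<open>Disks and their arrangement\<close>

datatype disk = Disk (center: "real \<times> real") (radius: real)

definition boundary_circle :: "disk \<Rightarrow> (real \<times> real) set" where
  "boundary_circle d = sphere (center d) (radius d)"

definition congruent_disks :: "disk set \<Rightarrow> bool" where
  "congruent_disks D \<longleftrightarrow> (\<forall>d\<in>D. \<forall>e\<in>D. radius d = radius e)"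

text \<open>The faces (of dimension 0, 1 and 2) of the subdivision induced by a family of curves:
  for each subfamily, the maximal connected sets of points that lie on all curves of the subfamily
  and on no other curve of the family.  They partition the plane, so that a point lying on a
  curve is in a face as well (in a vertex or in a relatively open edge); a point on no curve is in
  a connected component of the complement of the union of the curves.\<close>

definition curve_faces :: "(real \<times> real) set set \<Rightarrow> (real \<times> real) set set" where
  "curve_faces \<Gamma> = (\<Union>\<Sigma>\<in>Pow \<Gamma>. components {p. {\<gamma> \<in> \<Gamma>. p \<in> \<gamma>} = \<Sigma>})"

definition faces :: "disk set \<Rightarrow> (real \<times> real) set set" where
  "faces D = curve_faces (boundary_circle ` D)"

lemma faces_partition: "\<exists>!F. F \<in> faces D \<and> q \<in> F"
proof (rule ex_ex1I)
  define A where "A = (\<lambda>\<Sigma>. {p. {\<gamma> \<in> boundary_circle ` D. p \<in> \<gamma>} = \<Sigma>})"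
  define \<Sigma> where "\<Sigma> = {\<gamma> \<in> boundary_circle ` D. q \<in> \<gamma>}"
  have faces: "faces D = (\<Union>\<Sigma>\<in>Pow (boundary_circle ` D). components (A \<Sigma>))"
    unfolding faces_def curve_faces_def A_def ..
  have "q \<in> A \<Sigma>" by (simp add: A_def \<Sigma>_def)
  then have "q \<in> \<Union> (components (A \<Sigma>))" using Union_components by metis
  then obtain F where F: "F \<in> components (A \<Sigma>)" "q \<in> F" by (rule UnionE)
  have "\<Sigma> \<in> Pow (boundary_circle ` D)" by (auto simp: \<Sigma>_def)
  with F show "\<exists>F. F \<in> faces D \<and> q \<in> F" unfolding faces by (intro exI[of _ F]) (rule conjI, rule UN_I)
  have unique: "F \<in> components (A \<Sigma>)" if F': "F \<in> faces D" "q \<in> F" for F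
  proof -
    from F'(1) obtain \<Sigma>' where "F \<in> components (A \<Sigma>')" unfolding faces by (rule UN_E)
    moreover from this F'(2) have "q \<in> A \<Sigma>'" by (meson in_components_subset subsetD)
    then have "\<Sigma>' = \<Sigma>" by (simp add: A_def \<Sigma>_def)
    ultimately show ?thesis by simp
  qed
  fix F G assume FG: "F \<in> faces D \<and> q \<in> F" "G \<in> faces D \<and> q \<in> G"
  then have "F \<inter> G \<noteq> {}" by blast
  moreover have "F \<in> components (A \<Sigma>)" "G \<in> components (A \<Sigma>)"
    using unique FG by (iprover elim: conjE)+
  ultimately show "F = G" using components_nonoverlap by metis
qed

section \<open>The real RAM\<close>

text \<open>A real RAM in the sense of Preparata and Shamos, programmed in a structured language.  There
  are two disjoint kinds of memory cells, natural numbers and exact real numbers, organised in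
  arrays (a scalar variable is cell 0 of an array); a program mentions only finitely many arrays.
  Indirect addressing is by natural numbers only.  Real arithmetic comprises the four field
  operations and the square root; there is no rounding and no conversion from reals to integers.
  Natural numbers can be added, subtracted and compared but not multiplied, so that large integers
  cannot be exploited for hidden parallelism.  Program constants are natural numbers and integers,
  so that no real number can be used as an oracle.  The total HOL versions of division and square
  root are harmless, as their exceptional cases can be detected by a comparison.\<close>

datatype iexp =
    IConst nat
  | ICell string iexp
  | IAdd iexp iexp
  | ISub iexp iexp

datatype rexp =
    RConst int
  | RCell string iexp
  | RAdd rexp rexp
  | RSub rexp rexp
  | RMul rexp rexp
  | RDiv rexp rexp
  | RSqrt rexp

datatype bexp =
    ILess iexp iexp
  | RLess rexp rexp
  | BNot bexp
  | BAnd bexp bexp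

datatype com =
    Skip
  | IAssign string iexp iexp
  | RAssign string iexp rexp
  | Seq com com
  | Cond bexp com com
  | While bexp com

record state =
  ints :: "string \<Rightarrow> nat \<Rightarrow> nat"
  reals :: "string \<Rightarrow> nat \<Rightarrow> real"

primrec ival :: "iexp \<Rightarrow> state \<Rightarrow> nat" where
  "ival (IConst k) s = k"
| "ival (ICell a i) s = ints s a (ival i s)"
| "ival (IAdd e f) s = ival e s + ival f s"
| "ival (ISub e f) s = ival e s - ival f s"

primrec rval :: "rexp \<Rightarrow> state \<Rightarrow> real" where
  "rval (RConst k) s = real_of_int k"
| "rval (RCell a i) s = reals s a (ival i s)"
| "rval (RAdd e f) s = rval e s + rval f s"
| "rval (RSub e f) s = rval e s - rval f s"
| "rval (RMul e f) s = rval e s * rval f s"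
| "rval (RDiv e f) s = rval e s / rval f s"
| "rval (RSqrt e) s = sqrt (rval e s)"

primrec bval :: "bexp \<Rightarrow> state \<Rightarrow> bool" where
  "bval (ILess e f) s \<longleftrightarrow> ival e s < ival f s"
| "bval (RLess e f) s \<longleftrightarrow> rval e s < rval f s"
| "bval (BNot b) s \<longleftrightarrow> \<not> bval b s"
| "bval (BAnd b c) s \<longleftrightarrow> bval b s \<and> bval c s"

text \<open>Every constant, memory access, arithmetic operation, comparison, Boolean operation, store
  and branch takes one unit of time.\<close>

primrec icost :: "iexp \<Rightarrow> nat" where
  "icost (IConst k) = 1"
| "icost (ICell a i) = icost i + 1"
| "icost (IAdd e f) = icost e + icost f + 1"
| "icost (ISub e f) = icost e + icost f + 1"

primrec rcost :: "rexp \<Rightarrow> nat" where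
  "rcost (RConst k) = 1"
| "rcost (RCell a i) = icost i + 1"
| "rcost (RAdd e f) = rcost e + rcost f + 1"
| "rcost (RSub e f) = rcost e + rcost f + 1"
| "rcost (RMul e f) = rcost e + rcost f + 1"
| "rcost (RDiv e f) = rcost e + rcost f + 1"
| "rcost (RSqrt e) = rcost e + 1"

primrec bcost :: "bexp \<Rightarrow> nat" where
  "bcost (ILess e f) = icost e + icost f + 1"
| "bcost (RLess e f) = rcost e + rcost f + 1"
| "bcost (BNot b) = bcost b + 1"
| "bcost (BAnd b c) = bcost b + bcost c + 1"

definition istore :: "string \<Rightarrow> nat \<Rightarrow> nat \<Rightarrow> state \<Rightarrow> state" where
  "istore a i v s = s\<lparr>ints := (ints s)(a := (ints s a)(i := v))\<rparr>"

definition rstore :: "string \<Rightarrow> nat \<Rightarrow> real \<Rightarrow> state \<Rightarrow> state" where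
  "rstore a i v s = s\<lparr>reals := (reals s)(a := (reals s a)(i := v))\<rparr>"

text \<open>\<open>exec c s t s'\<close>: started in state \<open>s\<close>, the program \<open>c\<close> halts after \<open>t\<close> time units in
  state \<open>s'\<close>.\<close>

inductive exec :: "com \<Rightarrow> state \<Rightarrow> nat \<Rightarrow> state \<Rightarrow> bool" where
  Skip: "exec Skip s 1 s"
| IAssign: "exec (IAssign a i e) s (icost i + icost e + 1) (istore a (ival i s) (ival e s) s)"
| RAssign: "exec (RAssign a i e) s (icost i + rcost e + 1) (rstore a (ival i s) (rval e s) s)"
| Seq: "exec c s t s' \<Longrightarrow> exec d s' u s'' \<Longrightarrow> exec (Seq c d) s (t + u) s''"
| CondTrue: "bval b s \<Longrightarrow> exec c s t s' \<Longrightarrow> exec (Cond b c d) s (bcost b + 1 + t) s'"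
| CondFalse: "\<not> bval b s \<Longrightarrow> exec d s t s' \<Longrightarrow> exec (Cond b c d) s (bcost b + 1 + t) s'"
| WhileFalse: "\<not> bval b s \<Longrightarrow> exec (While b c) s (bcost b + 1) s"
| WhileTrue: "bval b s \<Longrightarrow> exec c s t s' \<Longrightarrow> exec (While b c) s' u s'' \<Longrightarrow>
    exec (While b c) s (bcost b + 1 + t + u) s''"

inductive_cases SkipE: "exec Skip s t s'"
inductive_cases IAssignE: "exec (IAssign a i e) s t s'"
inductive_cases RAssignE: "exec (RAssign a i e) s t s'"
inductive_cases SeqE: "exec (Seq c d) s t s'"
inductive_cases CondE: "exec (Cond b c d) s t s'"
inductive_cases WhileE: "exec (While b c) s t s'"

lemma exec_deterministic:
  "exec c s t s' \<Longrightarrow> exec c s u s'' \<Longrightarrow> u = t \<and> s'' = s'"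
proof (induction arbitrary: u s'' rule: exec.induct)
  case Skip
  then show ?case by (elim SkipE) simp
next
  case IAssign
  then show ?case by (elim IAssignE) simp
next
  case RAssign
  then show ?case by (elim RAssignE) simp
next
  case (Seq c s t s' d v s1)
  from Seq.prems show ?case by (rule SeqE) (auto dest: Seq.IH)
next
  case (CondTrue b s c t s' d)
  from CondTrue.prems show ?case by (rule CondE) (use CondTrue.hyps in \<open>auto dest: CondTrue.IH\<close>)
next
  case (CondFalse b s d t s' c)
  from CondFalse.prems show ?case by (rule CondE) (use CondFalse.hyps in \<open>auto dest: CondFalse.IH\<close>)
next
  case (WhileFalse b s c)
  from WhileFalse.prems show ?case by (rule WhileE) (use WhileFalse.hyps in simp_all)
next
  case (WhileTrue b s c t s' v s1)
  from WhileTrue.prems show ?case by (rule WhileE) (use WhileTrue.hyps in \<open>auto dest: WhileTrue.IH\<close>)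
qed

section \<open>Data structures for point location\<close>

definition input_state :: "disk list \<Rightarrow> state" where
  "input_state ds =
    \<lparr>ints = (\<lambda>a i. if a = ''n'' \<and> i = 0 then length ds else 0),
     reals = (\<lambda>a i. if i < length ds then
         (if a = ''x'' then fst (center (ds ! i))
          else if a = ''y'' then snd (center (ds ! i))
          else if a = ''r'' then radius (ds ! i)
          else 0)
       else 0)\<rparr>"

definition load_query :: "real \<times> real \<Rightarrow> state \<Rightarrow> state" where
  "load_query q s = rstore ''qx'' 0 (fst q) (rstore ''qy'' 0 (snd q) s)"

definition query_result :: "state \<Rightarrow> nat" where
  "query_result s = ints s ''out'' 0"

text \<open>In state \<open>s\<close> every query is answered by the query program \<open>Q\<close> in time at most \<open>T\<close> with the name
  (under \<open>lab\<close>) of the face containing the query point, and the state after the query is again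
  of this kind, so that arbitrary sequences of queries can be answered.\<close>

coinductive answers_queries ::
  "com \<Rightarrow> real \<Rightarrow> ((real \<times> real) set \<Rightarrow> nat) \<Rightarrow> disk set \<Rightarrow> state \<Rightarrow> bool"
  for Q T lab D where
  "(\<And>q. \<exists>t s' F. exec Q (load_query q s) t s' \<and> real t \<le> T \<and>
      F \<in> faces D \<and> q \<in> F \<and> query_result s' = lab F \<and> answers_queries Q T lab D s') \<Longrightarrow>
   answers_queries Q T lab D s"

text \<open>The preprocessing program \<open>P\<close> turns the input into a state in which queries can be answered.
  The names of the faces may depend on the input but are the same for all queries, and
  different faces have different names.\<close>

definition preprocesses ::
  "com \<Rightarrow> com \<Rightarrow> real \<Rightarrow> real \<Rightarrow> disk list \<Rightarrow> bool" where
  "preprocesses P Q Tp Tq ds \<longleftrightarrow>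
    (\<exists>t s lab. exec P (input_state ds) t s \<and> real t \<le> Tp \<and>
       inj_on lab (faces (set ds)) \<and> answers_queries Q Tq lab (set ds) s)"

end

theory Submission
  imports Defs "HOL-Real_Asymp.Real_Asymp"
begin

text \<open>Every circle is the union of a lower and an upper arc, each the graph of a function of the abscissa.
  The abscissas of all extreme points and of all pairwise intersections (the events, \<open>O(n\<^sup>2)\<close> many) cut the plane
  into vertical lines and open slabs; over each of these columns the vertical order of the arcs is constant,
  so the arcs cut a column into \<open>O(n)\<close> connected cells.  A point is located by a binary search for its
  column followed by one for its cell.

  The faces are the components of the graph on the \<open>O(n\<^sup>3)\<close> cells in which a cell \<open>C\<close> of a line and a cell
  \<open>S\<close> of a slab are joined iff \<open>C\<close> meets the closure of \<open>S\<close> and both lie on the same circles: a joined pair is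
  connected, and conversely the component of the cell of a point is locally constant on the set of points
  lying on a given set of circles.  Circles being closed, it suffices to compare the numbers of circles through \<open>C\<close>
  and \<open>S\<close>, and the cells \<open>S\<close> of a slab whose closures contain a given point form an interval that is found by counting.
  Union by rank then yields trees of logarithmic depth; the label of a face is the root of its cells.\<close>

section \<open>Cells of the arrangement\<close>

text \<open>Nothing is assumed about general position: circles may be tangent, many may pass through
  one point, and crossings may share an abscissa. Cells are therefore addressed by ranks among the
  distinct ordinates over an abscissa, and faces of all three dimensions are treated alike. Equal
  radii enter through the crossings: the radical axis of two circles is then the perpendicular
  bisector of their centers, and one square root gives the abscissa. Edges between a line and a slab
  suffice because neighbouring cells of one column never lie on the same circles, and different
  lines, or different slabs, do not touch. The bound \<open>n^4 log n\<close> comes from the graph: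
  \<open>O(n^2)\<close> lines, two slabs beside each, \<open>O(n) * O(n)\<close> pairs of cells, and
  \<open>O(log n)\<close> for a union. Quadratic sorting costs \<open>O(n^4)\<close> for the events
  and as much for the \<open>O(n)\<close> arcs of all \<open>O(n^2)\<close> columns, which stays
  below this. Paths are not compressed, so that a query leaves the forest as it found it and any
  sequence of queries can follow.\<close>

text \<open>Even values are the gaps of \<open>V\<close>, odd values its elements.\<close>

definition pos :: "real set \<Rightarrow> real \<Rightarrow> nat" where
  "pos V y = 2 * card {v\<in>V. v < y} + (if y \<in> V then 1 else 0)"

text \<open>Only the extra summand for \<open>y \<in> V\<close> could spoil monotonicity; but below
  a larger \<open>z\<close> the element \<open>y\<close> itself is counted, with weight two.\<close>

lemma pos_mono: "finite V \<Longrightarrow> y \<le> z \<Longrightarrow> pos V y \<le> pos V z"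
proof -
  assume V: "finite V" and "y \<le> z"
  show ?thesis
  proof (cases "y < z \<and> y \<in> V")
    case True
    then have "insert y {v\<in>V. v < y} \<subseteq> {v\<in>V. v < z}" by auto
    then have "card (insert y {v\<in>V. v < y}) \<le> card {v\<in>V. v < z}" using V by (intro card_mono) auto
    then show ?thesis using V by (simp add: pos_def)
  next
    case False
    have "card {v\<in>V. v < y} \<le> card {v\<in>V. v < z}" using V \<open>y \<le> z\<close> by (intro card_mono) auto
    then show ?thesis using False \<open>y \<le> z\<close> by (cases "y = z") (auto simp: pos_def)
  qed
qed

text \<open>Two points of one gap share their position, so one of the points has to belong to
  \<open>V\<close>: a lower one is counted below \<open>z\<close>, an upper one contributes the odd
  summand.\<close>

lemma pos_strict:
  assumes "finite V" "y < z" "y \<in> V \<or> z \<in> V"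
  shows "pos V y < pos V z"
proof (cases "y \<in> V")
  case True
  then have "insert y {v\<in>V. v < y} \<subseteq> {v\<in>V. v < z}" using assms by auto
  then have "card (insert y {v\<in>V. v < y}) \<le> card {v\<in>V. v < z}" using assms by (intro card_mono) auto
  then show ?thesis using assms(1) True by (simp add: pos_def)
next
  case False
  have "card {v\<in>V. v < y} \<le> card {v\<in>V. v < z}" using assms by (intro card_mono) auto
  then show ?thesis using False assms by (auto simp: pos_def)
qed

lemma pos_less_iff:
  assumes "finite V" "y \<in> V \<or> z \<in> V"
  shows "pos V y < pos V z \<longleftrightarrow> y < z"
proof
  assume "pos V y < pos V z"
  then show "y < z" using pos_mono[OF assms(1), of z y] by (meson leD not_le)
qed (use pos_strict assms in blast)

lemma pos_eq_iff:
  assumes "finite V" "y \<in> V \<or> z \<in> V"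
  shows "pos V y = pos V z \<longleftrightarrow> y = z"
  using pos_strict[OF assms(1), of y z] pos_strict[OF assms(1), of z y] assms(2)
  by (metis less_irrefl linorder_neqE)

lemma pos_le: "finite V \<Longrightarrow> pos V y \<le> 2 * card V"
proof -
  assume V: "finite V"
  show ?thesis
  proof (cases "y \<in> V")
    case True
    then have "{v\<in>V. v < y} \<subset> V" by auto
    then have "card {v\<in>V. v < y} < card V" using V by (simp add: psubset_card_mono)
    then show ?thesis by (simp add: pos_def)
  next
    case False
    have "card {v\<in>V. v < y} \<le> card V" using V by (intro card_mono) auto
    then show ?thesis using False by (simp add: pos_def)
  qed
qed

lemma odd_pos: "odd (pos V y) \<longleftrightarrow> y \<in> V"
  by (simp add: pos_def)

lemma pos_sorted:
  assumes "\<And>s t. s < t \<Longrightarrow> t < m \<Longrightarrow> f s < f t" "t < m"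
  shows "pos (f ` {..<m}) (f t) = 2 * t + 1"
proof -
  have inj: "inj_on f {..<m}"
    by (rule inj_onI) (metis assms(1) lessThan_iff less_irrefl linorder_neqE_nat)
  have "{v\<in>f ` {..<m}. v < f t} = f ` {..<t}"
  proof -
    have "f s < f t \<longleftrightarrow> s < t" if "s < m" for s
      using assms that by (metis less_asym less_irrefl linorder_neqE_nat)
    then show ?thesis using assms(2) by auto
  qed
  moreover have "card (f ` {..<t}) = t"
    using inj assms(2) by (subst card_image) (auto intro: inj_on_subset)
  ultimately show ?thesis using assms(2) by (simp add: pos_def)
qed

text \<open>Produces a point of a gap over a given abscissa. Empty sets must be covered since the
  lowest and the highest gap are unbounded.\<close>

lemma between_finite:
  fixes A B :: "real set"
  assumes "finite A" "finite B" "\<And>a b. a \<in> A \<Longrightarrow> b \<in> B \<Longrightarrow> a < b"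
  shows "\<exists>y. (\<forall>a\<in>A. a < y) \<and> (\<forall>b\<in>B. y < b)"
proof (cases "A = {} \<or> B = {}")
  case True
  then show ?thesis
  proof
    assume [simp]: "A = {}"
    show ?thesis
    proof (cases "B = {}")
      case False
      then have "\<forall>b\<in>B. Min B - 1 < b" using assms(2) Min_le by fastforce
      then show ?thesis by auto
    qed simp
  next
    assume [simp]: "B = {}"
    show ?thesis
    proof (cases "A = {}")
      case False
      then have "\<forall>b\<in>A. b < Max A + 1" using assms(1) Max_ge by fastforce
      then show ?thesis by auto
    qed simp
  qed
next
  case False
  then have "Max A < Min B" using assms by (simp add: Max_in Min_in)
  then obtain y where "Max A < y" "y < Min B" using dense by blast
  then show ?thesis using False assms(1,2) by (intro exI[of _ y]) (auto simp: Max_less_iff Min_gr_iff)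
qed

lemma closure_minimalD: "p \<in> closure S \<Longrightarrow> S \<subseteq> T \<Longrightarrow> closed T \<Longrightarrow> p \<in> T"
  using closure_minimal[of S T] by (rule subsetD)

text \<open>The size of an image depends only on which arguments are identified. Arcs have different
  ordinates over different abscissas of a column but coincide in the same cases.\<close>

lemma card_image_cong:
  assumes "\<And>a b. a \<in> A \<Longrightarrow> b \<in> A \<Longrightarrow> f a = f b \<longleftrightarrow> g a = g b"
  shows "card (f ` A) = card (g ` A)"
proof -
  let ?h = "\<lambda>u. g (inv_into A f u)"
  have h: "?h (f a) = g a" if "a \<in> A" for a
    using assms that by (metis f_inv_into_f image_eqI inv_into_into)
  have "inj_on ?h (f ` A)" using h assms by (intro inj_onI) auto
  moreover have "?h ` f ` A = g ` A" using h by (force simp: image_iff)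
  ultimately show ?thesis by (metis card_image)
qed

text \<open>The arcs are numbered \<open>0, \<dots>, N - 1\<close>; \<open>sg k\<close> is \<open>- 1\<close> for a lower and \<open>1\<close> for an upper arc.  The last assumption
  lists for every ordered pair of circles one of their two intersections: a common point of the circles around
  \<open>p\<close> and \<open>q\<close> is \<open>(p + q) / 2 + t (q - p)\<^sup>\<bottom>\<close> with \<open>\<bar>t\<bar> = sqrt (r\<^sup>2 / \<bar>q - p\<bar>\<^sup>2 - 1 / 4)\<close>.  If the circles
  do not meet or coincide, this is some irrelevant real number (a square root of a negative number or a division
  by zero), which merely refines the partition into columns.\<close>

locale arcs =
  fixes N :: nat and ax ay sg :: "nat \<Rightarrow> real" and r :: real and E :: "real set"
  assumes r_pos: "k < N \<Longrightarrow> 0 < r"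
    and sg: "k < N \<Longrightarrow> sg k = 1 \<or> sg k = -1"
    and twin: "k < N \<Longrightarrow> \<exists>l<N. ax l = ax k \<and> ay l = ay k \<and> sg l = - sg k"
    and finE: "finite E"
    and E_extreme: "k < N \<Longrightarrow> ax k + sg k * r \<in> E"
    and E_crossing: "k < N \<Longrightarrow> l < N \<Longrightarrow>
      (ax k + ax l) / 2 + (ay l - ay k) *
        sqrt (r * r / ((ax k - ax l) * (ax k - ax l) + (ay k - ay l) * (ay k - ay l)) - 1 / 4) \<in> E"
begin

text \<open>Outside the range of its circle \<open>val k\<close> is a meaningless branch of a hyperbola, since HOL has
  \<open>sqrt (- u) = - sqrt u\<close>; but it is continuous on the whole line.\<close>

definition val :: "nat \<Rightarrow> real \<Rightarrow> real" where
  "val k x = ay k + sg k * sqrt (r * r - (x - ax k) * (x - ax k))"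

definition pres :: "nat \<Rightarrow> real \<Rightarrow> bool" where
  "pres k x \<longleftrightarrow> (x - ax k) * (x - ax k) \<le> r * r"

definition on :: "nat \<Rightarrow> real \<times> real \<Rightarrow> bool" where
  "on k p \<longleftrightarrow> (fst p - ax k) * (fst p - ax k) + (snd p - ay k) * (snd p - ay k) = r * r"

text \<open>Membership refers to the whole circle, not to the arc: both arcs of a circle enter
  together, so two points have equal index sets iff they lie on the same circles.\<close>

definition Sg :: "real \<times> real \<Rightarrow> nat set" where
  "Sg p = {k. k < N \<and> on k p}"

definition Vals :: "real \<Rightarrow> real set" where
  "Vals x = (\<lambda>k. val k x) ` {k. k < N \<and> pres k x}"

definition cell :: "real \<times> real \<Rightarrow> nat \<times> nat" where
  "cell p = (pos E (fst p), pos (Vals (fst p)) (snd p))"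

lemma finite_Vals [simp]: "finite (Vals x)"
  by (simp add: Vals_def)

lemma card_Vals: "card (Vals x) \<le> N"
proof -
  have "card (Vals x) \<le> card {k. k < N \<and> pres k x}" unfolding Vals_def by (intro card_image_le) simp
  also have "\<dots> \<le> card {..<N}" by (intro card_mono) auto
  finally show ?thesis by simp
qed

lemma finite_Sg [simp]: "finite (Sg p)"
  by (simp add: Sg_def)

lemma val_cont: "continuous_on A (val k)"
  unfolding val_def by (intro continuous_intros)

lemma pres_iff: "k < N \<Longrightarrow> pres k x \<longleftrightarrow> ax k - r \<le> x \<and> x \<le> ax k + r"
proof -
  assume "k < N"
  then have "0 < r" by (rule r_pos)
  then have "pres k x \<longleftrightarrow> \<bar>x - ax k\<bar> \<le> r"
    using abs_le_square_iff[of "x - ax k" r] by (simp add: pres_def power2_eq_square)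
  then show ?thesis by (simp only: abs_le_iff) linarith
qed

lemma E_ends: "k < N \<Longrightarrow> ax k - r \<in> E \<and> ax k + r \<in> E"
proof -
  assume k: "k < N"
  then obtain l where l: "l < N" "ax l = ax k" "sg l = - sg k" using twin by blast
  show ?thesis using sg[OF k] E_extreme[OF k] E_extreme[OF l(1)] l by auto
qed

text \<open>Solving the equation of the circle for the ordinate leaves two signs;
  \<open>twin\<close> supplies the arc for the sign that \<open>k\<close> does not have.\<close>

lemma on_iff:
  assumes k: "k < N"
  shows "on k p \<longleftrightarrow> pres k (fst p) \<and> (\<exists>l<N. ax l = ax k \<and> ay l = ay k \<and> val l (fst p) = snd p)"
proof
  assume o: "on k p"
  let ?d = "(fst p - ax k) * (fst p - ax k)" and ?e = "(snd p - ay k)"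
  have e: "?e * ?e = r * r - ?d" using o by (simp add: on_def)
  have "0 \<le> ?e * ?e" by simp
  then have "pres k (fst p)" using e by (simp add: pres_def)
  moreover have s: "sqrt (r * r - ?d) = \<bar>?e\<bar>" by (subst e[symmetric]) (simp add: real_sqrt_mult)
  obtain m where m: "m < N" "ax m = ax k" "ay m = ay k" "sg m = - sg k" using twin[OF k] by blast
  have "val k (fst p) = snd p \<or> val m (fst p) = snd p"
    using sg[OF k] m s by (auto simp: val_def)
  ultimately show "pres k (fst p) \<and> (\<exists>l<N. ax l = ax k \<and> ay l = ay k \<and> val l (fst p) = snd p)" using m k by blast
next
  assume "pres k (fst p) \<and> (\<exists>l<N. ax l = ax k \<and> ay l = ay k \<and> val l (fst p) = snd p)"
  then obtain l where l: "pres k (fst p)" "l < N" "ax l = ax k" "ay l = ay k" "val l (fst p) = snd p" by blast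
  have "snd p - ay k = sg l * sqrt (r * r - (fst p - ax k) * (fst p - ax k))"
    using l by (auto simp: val_def)
  then have "(snd p - ay k) * (snd p - ay k) = r * r - (fst p - ax k) * (fst p - ax k)"
    using sg[OF l(2)] l(1) by (auto simp: pres_def)
  then show "on k p" by (simp add: on_def)
qed

lemma val_on: "k < N \<Longrightarrow> pres k x \<Longrightarrow> on k (x, val k x)"
  using on_iff by auto

section \<open>Abscissas at which arcs meet\<close>

lemma crossing_same_center:
  assumes k: "k < N" "l < N" and p: "pres k z" "val k z = val l z"
    and c: "ax l = ax k" "ay l = ay k" and s: "sg k \<noteq> sg l"
  shows "z \<in> E"
proof -
  \<comment> \<open>The ordinates are \<open>ay k\<close> plus and minus the same root, so the root
    vanishes: the arcs meet at the extreme points of the circle.\<close>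
  have "sqrt (r * r - (z - ax k) * (z - ax k)) = 0"
    using p(2) c s sg[OF k(1)] sg[OF k(2)] by (auto simp: val_def)
  then have "(z - ax k)^2 = r^2" by (simp add: power2_eq_square)
  then have "z - ax k = r \<or> z - ax k = - r" by (simp add: power2_eq_iff)
  then have "z = ax k + r \<or> z = ax k - r" by auto
  then show ?thesis using E_ends[OF k(1)] by auto
qed

text \<open>In coordinates \<open>(u, v)\<close> around the midpoint of the centers a common point
  is orthogonal to the difference \<open>(a, b)\<close> of the centers, hence equal to
  \<open>t (b, - a)\<close>; its length then determines \<open>t\<close> up to sign.\<close>

lemma crossing_other_center:
  assumes k: "k < N" "l < N" and p: "on k (z, y)" "on l (z, y)"
    and c: "ax l \<noteq> ax k \<or> ay l \<noteq> ay k"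
  shows "z \<in> E"
proof -
  define a b where "a = ax l - ax k" and "b = ay l - ay k"
  define u v where "u = z - (ax k + ax l) / 2" and "v = y - (ay k + ay l) / 2"
  define D where "D = a * a + b * b"
  have D: "D > 0" using c unfolding D_def a_def b_def
    by (metis diff_eq_diff_eq diff_self sum_squares_gt_zero_iff)
  have e1: "(u + a / 2)^2 + (v + b / 2)^2 = r^2"
    using p(1) by (simp add: on_def u_def v_def a_def b_def power2_eq_square field_simps)
  have e2: "(u - a / 2)^2 + (v - b / 2)^2 = r^2"
    using p(2) by (simp add: on_def u_def v_def a_def b_def power2_eq_square field_simps)
  \<comment> \<open>Subtracting the equations cancels the radius, as both circles have the same
    one.\<close>
  have perp: "u * a + v * b = 0" using e1 e2 by (simp add: power2_eq_square algebra_simps)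
  have "(u + a / 2)^2 + (v + b / 2)^2 = u^2 + v^2 + D / 4 + (u * a + v * b)"
    by (simp add: power2_eq_square field_simps D_def)
  then have len: "u^2 + v^2 = r^2 - D / 4" using e1 perp by simp
  \<comment> \<open>The coefficient of the orthogonal projection of \<open>(u, v)\<close> to
    \<open>(b, - a)\<close>.\<close>
  define t where "t = (u * b - v * a) / D"
  have tD: "t * D = u * b - v * a" using D by (simp add: t_def)
  have vb: "v * b = - (u * a)" using perp by linarith
  have "t * D * b = u * b * b - (v * b) * a" unfolding tD by (simp add: algebra_simps)
  also have "\<dots> = u * D" unfolding vb by (simp add: D_def algebra_simps)
  finally have u: "u = t * b" using D by simp
  have ua: "u * a = - (v * b)" using perp by linarith
  have "- t * a * D = - (t * D) * a" by simp
  also have "\<dots> = v * a * a - (u * a) * b" unfolding tD by (simp add: algebra_simps)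
  also have "\<dots> = v * D" unfolding ua by (simp add: D_def algebra_simps)
  finally have v: "v = - t * a" using D mult_right_cancel[of D "- t * a" v] by linarith
  have "t^2 * D = r^2 - D / 4" using len by (simp add: u v D_def power2_eq_square algebra_simps)
  then have "t^2 = r^2 / D - 1 / 4" using D by (simp add: field_simps)
  then have "\<bar>t\<bar> = sqrt (r * r / D - 1 / 4)" by (metis power2_eq_square real_sqrt_abs)
  moreover have "(ax k - ax l) * (ax k - ax l) + (ay k - ay l) * (ay k - ay l) = D"
    by (simp add: D_def a_def b_def algebra_simps)
  moreover have "(ax l - ax k) * (ax l - ax k) + (ay l - ay k) * (ay l - ay k) = D"
    by (simp add: D_def a_def b_def algebra_simps)
  \<comment> \<open>The ordered pairs \<open>(k, l)\<close> and \<open>(l, k)\<close> have opposite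
    \<open>b\<close>, so together they list the abscissas for both signs of
    \<open>t\<close>.\<close>
  ultimately have "(ax k + ax l) / 2 + b * \<bar>t\<bar> \<in> E" "(ax l + ax k) / 2 + (- b) * \<bar>t\<bar> \<in> E"
    using E_crossing[OF k] E_crossing[OF k(2) k(1)] by (simp_all add: b_def)
  moreover have "z = (ax k + ax l) / 2 + b * t" using u by (simp add: u_def field_simps)
  ultimately show ?thesis by (cases "t \<ge> 0") (simp_all add: add.commute)
qed

text \<open>Away from the events only arcs with the same center and the same sign can meet, and
  these are one and the same curve.\<close>

lemma crossing:
  assumes k: "k < N" "l < N" and p: "pres k z" "pres l z" "val k z = val l z" and z: "z \<notin> E"
  shows "val k x = val l x"
proof (cases "ax l = ax k \<and> ay l = ay k")
  case True
  then have "sg k = sg l" using crossing_same_center[OF k p(1,3)] z by blast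
  then show ?thesis using True by (simp add: val_def)
next
  case False
  moreover have "on k (z, val k z)" "on l (z, val k z)" using val_on k p by metis+
  ultimately show ?thesis using crossing_other_center[OF k] z by blast
qed

section \<open>Constancy of the arcs over a column\<close>

abbreviation "col x \<equiv> pos E x"

lemma col_pres: "col x = col z \<Longrightarrow> k < N \<Longrightarrow> pres k x \<longleftrightarrow> pres k z"
proof -
  assume c: "col x = col z" and k: "k < N"
  have "ax k + r < x \<longleftrightarrow> ax k + r < z" "x < ax k - r \<longleftrightarrow> z < ax k - r"
    using E_ends[OF k] pos_less_iff[OF finE, of "ax k + r"] pos_less_iff[OF finE, of _ "ax k - r"] c by metis+
  then show ?thesis using pres_iff[OF k] not_le by blast
qed

lemma col_between:
  assumes "col x = col z" "x \<le> w" "w \<le> z" "w \<in> E" shows "x = z"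
proof -
  have "col w = col x" using pos_mono[OF finE] assms by (metis le_antisym)
  then have "w = x" using pos_eq_iff[OF finE] assms by blast
  moreover have "w = z" using pos_eq_iff[OF finE] assms \<open>col w = col x\<close> by metis
  ultimately show ?thesis by simp
qed

text \<open>If the order changed, the intermediate value theorem would give an abscissa
  \<open>w\<close> between \<open>x\<close> and \<open>z\<close> where the arcs meet. They are
  present there because presence is an interval condition, and \<open>w\<close> is no event because
  a column that contains an event is a single abscissa; so the arcs would agree everywhere by
  \<open>crossing\<close>.\<close>

lemma col_order_aux:
  assumes c: "col x = col z" and k: "k < N" "l < N" and p: "pres k x" "pres l x" "val k x < val l x"
  shows "val k z < val l z"
proof (rule ccontr)
  assume "\<not> val k z < val l z"
  then have le: "val l z \<le> val k z" by simp
  let ?f = "\<lambda>w. val l w - val k w"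
  have "\<exists>w. min x z \<le> w \<and> w \<le> max x z \<and> ?f w = 0"
  proof (cases "x \<le> z")
    case True
    have "\<exists>w. x \<le> w \<and> w \<le> z \<and> ?f w = 0"
      by (rule IVT2') (use le p True in \<open>auto intro!: continuous_intros val_cont\<close>)
    then show ?thesis using True by auto
  next
    case False
    have "\<exists>w. z \<le> w \<and> w \<le> x \<and> ?f w = 0"
      by (rule IVT') (use le p False in \<open>auto intro!: continuous_intros val_cont\<close>)
    then show ?thesis using False by auto
  qed
  then obtain w where w: "min x z \<le> w" "w \<le> max x z" "val k w = val l w" by auto
  have pz: "pres k z" "pres l z" using col_pres[OF c] k p by auto
  have "pres k w" "pres l w" using p pz w k by (auto simp: pres_iff min_def max_def split: if_splits)
  moreover have "w \<notin> E"
  proof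
    assume "w \<in> E"
    then have "x = z" using col_between[of x z w] col_between[of z x w] c w by (auto simp: min_def max_def split: if_splits)
    then show False using p le by simp
  qed
  ultimately have "val k x = val l x" using crossing k w(3) by blast
  then show False using p by simp
qed

lemma col_order:
  assumes c: "col x = col z" and k: "k < N" "l < N" and p: "pres k x" "pres l x"
  shows "val k x < val l x \<longleftrightarrow> val k z < val l z" "val k x = val l x \<longleftrightarrow> val k z = val l z"
proof -
  have pz: "pres k z" "pres l z" using col_pres[OF c] k p by auto
  note o = col_order_aux[OF c k p] col_order_aux[OF c k(2,1) p(2,1)]
    col_order_aux[OF c[symmetric] k pz] col_order_aux[OF c[symmetric] k(2,1) pz(2,1)]
  show "val k x < val l x \<longleftrightarrow> val k z < val l z" "val k x = val l x \<longleftrightarrow> val k z = val l z"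
    using o by (auto, (metis less_irrefl linorder_neqE)+)
qed

lemma card_Vals_below: "{v\<in>Vals x. v < y} = (\<lambda>k. val k x) ` {k. k < N \<and> pres k x \<and> val k x < y}"
  by (auto simp: Vals_def)

text \<open>Several arcs may share an ordinate, so distinct values have to be counted; by
  \<open>col_order\<close> the coincidences are the same over both abscissas.\<close>

lemma pos_Vals_eqI:
  assumes c: "col x = col z"
    and "\<And>k. k < N \<Longrightarrow> pres k x \<Longrightarrow> val k x < y \<longleftrightarrow> val k z < w"
    and "\<And>k. k < N \<Longrightarrow> pres k x \<Longrightarrow> val k x = y \<longleftrightarrow> val k z = w"
  shows "pos (Vals x) y = pos (Vals z) w"
proof -
  have S: "{k. k < N \<and> pres k z \<and> val k z < w} = {k. k < N \<and> pres k x \<and> val k x < y}"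
    using assms(2) col_pres[OF c] by blast
  have "card ((\<lambda>k. val k x) ` {k. k < N \<and> pres k x \<and> val k x < y}) =
    card ((\<lambda>k. val k z) ` {k. k < N \<and> pres k x \<and> val k x < y})"
    by (rule card_image_cong) (use col_order[OF c] in auto)
  moreover have "y \<in> Vals x \<longleftrightarrow> w \<in> Vals z" using assms(3) col_pres[OF c] by (auto simp: Vals_def image_iff)
  ultimately show ?thesis by (simp add: pos_def card_Vals_below S)
qed

lemma cell_eqI:
  assumes "col (fst p) = col (fst q)"
    and "\<And>k. k < N \<Longrightarrow> pres k (fst p) \<Longrightarrow> val k (fst p) < snd p \<longleftrightarrow> val k (fst q) < snd q"
    and "\<And>k. k < N \<Longrightarrow> pres k (fst p) \<Longrightarrow> val k (fst p) = snd p \<longleftrightarrow> val k (fst q) = snd q"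
  shows "cell p = cell q"
  unfolding cell_def using pos_Vals_eqI[OF assms] assms(1) by (rule arg_cong2[where f = Pair, rotated])

text \<open>An arc has the same position over all abscissas of its column. Since its ordinate is one
  of the values, comparing it with a point amounts to comparing positions.\<close>

lemma cell_eqD:
  assumes c: "cell p = cell q" and k: "k < N" "pres k (fst p)"
  shows "val k (fst p) < snd p \<longleftrightarrow> val k (fst q) < snd q" "val k (fst p) = snd p \<longleftrightarrow> val k (fst q) = snd q"
proof -
  have col: "col (fst p) = col (fst q)" using c by (simp add: cell_def)
  have kq: "pres k (fst q)" using col_pres[OF col] k by simp
  have e: "pos (Vals (fst p)) (val k (fst p)) = pos (Vals (fst q)) (val k (fst q))"
    using col_order[OF col] k by (intro pos_Vals_eqI[OF col]) auto
  have v: "val k (fst p) \<in> Vals (fst p)" "val k (fst q) \<in> Vals (fst q)" using k kq by (auto simp: Vals_def)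
  have p: "pos (Vals (fst p)) (snd p) = pos (Vals (fst q)) (snd q)" using c by (simp add: cell_def)
  show "val k (fst p) < snd p \<longleftrightarrow> val k (fst q) < snd q"
    using pos_less_iff[of "Vals (fst p)" "val k (fst p)" "snd p"] pos_less_iff[of "Vals (fst q)" "val k (fst q)" "snd q"] v e p by simp
  show "val k (fst p) = snd p \<longleftrightarrow> val k (fst q) = snd q"
    using pos_eq_iff[of "Vals (fst p)" "val k (fst p)" "snd p"] pos_eq_iff[of "Vals (fst q)" "val k (fst q)" "snd q"] v e p by simp
qed

section \<open>Cells as point sets: connectedness and closure\<close>

lemma cell_col: "cell p = cell q \<Longrightarrow> col (fst p) = col (fst q)"
  by (simp add: cell_def)

definition cset :: "real \<times> real \<Rightarrow> (real \<times> real) set" where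
  "cset q = {p. cell p = cell q}"

definition colset :: "real \<Rightarrow> real set" where
  "colset x = {z. col z = col x}"

lemma colset_connected: "connected (colset x)"
proof -
  have "is_interval (colset x)"
    unfolding is_interval_1
  proof (intro ballI allI impI)
    fix a b z assume "a \<in> colset x" "b \<in> colset x" "a \<le> z \<and> z \<le> b"
    then show "z \<in> colset x"
      using pos_mono[OF finE, of a z] pos_mono[OF finE, of z b] by (simp add: colset_def)
  qed
  then show ?thesis by (simp add: is_interval_connected)
qed

lemma Sg_cell: "cell p = cell q \<Longrightarrow> Sg p = Sg q"
proof -
  assume c: "cell p = cell q"
  have "on k p \<longleftrightarrow> on k q" if k: "k < N" for k
  proof -
    have "pres k (fst p) \<longleftrightarrow> pres k (fst q)" using col_pres[OF cell_col[OF c] k] .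
    moreover have "val l (fst p) = snd p \<longleftrightarrow> val l (fst q) = snd q" if "l < N" "ax l = ax k" "pres k (fst p)" for l
      using cell_eqD(2)[OF c that(1)] that(2,3) by (simp add: pres_def)
    ultimately show ?thesis unfolding on_iff[OF k] by blast
  qed
  then show ?thesis by (auto simp: Sg_def)
qed

lemma cset_arc:
  assumes k: "k < N" "pres k (fst q)" "val k (fst q) = snd q"
  shows "cset q = (\<lambda>x. (x, val k x)) ` colset (fst q)"
proof (intro equalityI subsetI)
  fix p assume "p \<in> cset q"
  then have c: "cell q = cell p" by (simp add: cset_def)
  then have "val k (fst p) = snd p" using cell_eqD(2)[OF c k(1,2)] k by simp
  moreover have "fst p \<in> colset (fst q)" using c by (simp add: colset_def cell_def)
  ultimately show "p \<in> (\<lambda>x. (x, val k x)) ` colset (fst q)"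
    by (intro image_eqI[of _ _ "fst p"]) (auto simp: prod_eq_iff)
next
  fix p assume "p \<in> (\<lambda>x. (x, val k x)) ` colset (fst q)"
  then obtain x where x: "col (fst q) = col x" "p = (x, val k x)" by (auto simp: colset_def)
  then have "cell q = cell p"
    using col_order[OF x(1) _ k(1) _ k(2)] k(3) x by (intro cell_eqI) auto
  then show "p \<in> cset q" by (simp add: cset_def)
qed

lemma cset_gap:
  assumes nk: "\<And>k. k < N \<Longrightarrow> pres k (fst q) \<Longrightarrow> val k (fst q) \<noteq> snd q"
  shows "cset q = {p. fst p \<in> colset (fst q) \<and>
    (\<forall>k\<in>{k. k < N \<and> pres k (fst q) \<and> val k (fst q) < snd q}. val k (fst p) < snd p) \<and>
    (\<forall>k\<in>{k. k < N \<and> pres k (fst q) \<and> snd q < val k (fst q)}. snd p < val k (fst p))}" (is "_ = ?S")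
proof (intro equalityI subsetI)
  fix p assume "p \<in> cset q"
  then have c: "cell q = cell p" by (simp add: cset_def)
  note d = cell_eqD[OF c]
  have "fst p \<in> colset (fst q)" using c by (simp add: colset_def cell_def)
  moreover have "snd p < val k (fst p)" if k: "k < N" "pres k (fst q)" and lt: "snd q < val k (fst q)" for k
  proof (rule linorder_cases)
    assume "val k (fst p) < snd p"
    then have "val k (fst q) < snd q" by (rule d(1)[OF k, THEN iffD2])
    then show ?thesis using lt by simp
  next
    assume "val k (fst p) = snd p"
    then have "val k (fst q) = snd q" by (rule d(2)[OF k, THEN iffD2])
    then show ?thesis using lt by simp
  qed
  moreover have "val k (fst p) < snd p" if k: "k < N" "pres k (fst q)" and lt: "val k (fst q) < snd q" for k
    by (rule d(1)[OF k, THEN iffD1, OF lt])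
  ultimately show "p \<in> ?S" by simp
next
  fix p assume p: "p \<in> ?S"
  then have "col (fst q) = col (fst p)" by (simp add: colset_def)
  then have "cell q = cell p"
  proof (rule cell_eqI)
    fix k assume k: "k < N" "pres k (fst q)"
    have B: "val k (fst q) < snd q \<Longrightarrow> val k (fst p) < snd p" and U: "snd q < val k (fst q) \<Longrightarrow> snd p < val k (fst p)"
      using p k by simp_all
    show "(val k (fst q) < snd q) = (val k (fst p) < snd p)" "(val k (fst q) = snd q) = (val k (fst p) = snd p)"
    proof (atomize (full), rule linorder_cases[of "val k (fst q)" "snd q"])
      assume "val k (fst q) < snd q"
      with B[OF this] show "(val k (fst q) < snd q) = (val k (fst p) < snd p) \<and> (val k (fst q) = snd q) = (val k (fst p) = snd p)" by simp
    next
      assume "snd q < val k (fst q)"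
      with U[OF this] show "(val k (fst q) < snd q) = (val k (fst p) < snd p) \<and> (val k (fst q) = snd q) = (val k (fst p) = snd p)" by simp
    next
      assume "val k (fst q) = snd q"
      with nk[OF k] show "(val k (fst q) < snd q) = (val k (fst p) < snd p) \<and> (val k (fst q) = snd q) = (val k (fst p) = snd p)" by simp
    qed
  qed
  then show "p \<in> cset q" by (simp add: cset_def)
qed

text \<open>A cell on an arc is a continuous image of an interval. A gap cell projects onto its
  column by an open map with nonempty connected fibres over a connected base, which makes it
  connected.\<close>

lemma cset_connected: "connected (cset q)"
proof (cases "\<exists>k<N. pres k (fst q) \<and> val k (fst q) = snd q")
  case True
  then obtain k where k: "k < N" "pres k (fst q)" "val k (fst q) = snd q" by blast
  show ?thesis unfolding cset_arc[OF k]
    by (intro connected_continuous_image colset_connected continuous_intros val_cont)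
next
  case False
  define B where "B = {k. k < N \<and> pres k (fst q) \<and> val k (fst q) < snd q}"
  define U where "U = {k. k < N \<and> pres k (fst q) \<and> snd q < val k (fst q)}"
  define J where "J = colset (fst q)"
  define T where "T = {p::real \<times> real. (\<forall>k\<in>B. val k (fst p) < snd p) \<and> (\<forall>k\<in>U. snd p < val k (fst p))}"
  have fin: "finite B" "finite U" by (auto simp: B_def U_def)
  have S: "cset q = T \<inter> fst -` J"
    using False by (subst cset_gap) (auto simp: B_def U_def J_def T_def)
  have cf: "continuous_on UNIV (\<lambda>p::real\<times>real. val k (fst p))" for k
    by (rule continuous_on_compose2[OF val_cont[of UNIV]]) (auto intro: continuous_intros)
  have "T = (\<Inter>k\<in>B. {p. val k (fst p) < snd p}) \<inter> (\<Inter>k\<in>U. {p. snd p < val k (fst p)})"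
    by (auto simp: T_def)
  moreover have "open (\<Inter>k\<in>B. {p::real\<times>real. val k (fst p) < snd p})" using fin
    by (intro open_INT ballI open_Collect_less cf continuous_on_snd continuous_on_id) auto
  moreover have "open (\<Inter>k\<in>U. {p::real\<times>real. snd p < val k (fst p)})" using fin
    by (intro open_INT ballI open_Collect_less cf continuous_on_snd continuous_on_id) auto
  ultimately have oT: "open T" by auto
  have img: "fst ` (T \<inter> fst -` J) = J"
  proof (intro equalityI subsetI)
    fix x assume x: "x \<in> J"
    then have c: "col (fst q) = col x" by (simp add: J_def colset_def)
    \<comment> \<open>The fibre over \<open>x\<close> is nonempty: arcs below \<open>q\<close>
      remain below the arcs above \<open>q\<close> throughout the column.\<close>
    have "\<exists>y. (\<forall>a\<in>(\<lambda>k. val k x) ` B. a < y) \<and> (\<forall>b\<in>(\<lambda>k. val k x) ` U. y < b)"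
    proof (rule between_finite)
      fix a b assume "a \<in> (\<lambda>k. val k x) ` B" "b \<in> (\<lambda>k. val k x) ` U"
      then obtain k l where kl: "a = val k x" "b = val l x" "k \<in> B" "l \<in> U" by auto
      then have "val k (fst q) < val l (fst q)" by (auto simp: B_def U_def)
      then show "a < b" using kl col_order(1)[OF c, of k l] by (auto simp: B_def U_def)
    qed (use fin in auto)
    then obtain y where "(x, y) \<in> T" by (auto simp: T_def)
    then show "x \<in> fst ` (T \<inter> fst -` J)" using x by force
  qed auto
  have "connected ((T \<inter> fst -` J) \<inter> fst -` J)"
  proof (rule connected_open_monotone_preimage[where T = J])
    show "continuous_on (T \<inter> fst -` J) fst" by (intro continuous_intros)
    show "fst ` (T \<inter> fst -` J) = J" by (rule img)
    show "openin (top_of_set J) (fst ` C)" if "openin (top_of_set (T \<inter> fst -` J)) C" for C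
    proof -
      \<comment> \<open>A relatively open part of the cell is cut out by an open set of the plane,
        because \<open>T\<close> is open and the restriction to \<open>J\<close> concerns the
        abscissa only; so its projection is relatively open in \<open>J\<close>.\<close>
      obtain W where W: "open W" "C = (T \<inter> fst -` J) \<inter> W" using \<open>openin _ C\<close> by (auto simp: openin_open)
      then have "fst ` C = J \<inter> fst ` (T \<inter> W)" by (auto simp: image_iff)
      moreover have "open (fst ` (T \<inter> W))" using W oT by (intro open_image_fst open_Int)
      ultimately show ?thesis by (auto simp: openin_open)
    qed
    show "connected (T \<inter> fst -` J \<inter> fst -` {x})" if "x \<in> J" for x
    proof (rule convex_connected)
      have "T \<inter> fst -` J \<inter> fst -` {x} =
        {x} \<times> ((\<Inter>k\<in>B. {val k x <..}) \<inter> (\<Inter>k\<in>U. {..< val k x}))" using that by (auto simp: T_def)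
      moreover have "convex \<dots>" by (intro convex_Times convex_Int convex_INT convex_singleton) (auto intro: convex_real_interval)
      ultimately show "convex (T \<inter> fst -` J \<inter> fst -` {x})" by simp
    qed
    show "connected J" unfolding J_def by (rule colset_connected)
    show "J \<subseteq> J" by simp
  qed
  then show ?thesis by (simp add: S Int_assoc)
qed

text \<open>\<open>p\<close> is weakly on the same side of every arc as \<open>q\<close>; for \<open>p\<close> on the boundary of the column of \<open>q\<close> this
  characterises membership in the closure of the cell of \<open>q\<close>.\<close>

definition sides :: "real \<times> real \<Rightarrow> real \<times> real \<Rightarrow> bool" where
  "sides p q \<longleftrightarrow> (\<forall>k<N. pres k (fst q) \<longrightarrow>
     (val k (fst q) < snd q \<longrightarrow> val k (fst p) \<le> snd p) \<and>
     (snd q < val k (fst q) \<longrightarrow> snd p \<le> val k (fst p)) \<and>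
     (val k (fst q) = snd q \<longrightarrow> val k (fst p) = snd p))"

lemma val_fst_cont: "continuous_on A (\<lambda>p::real\<times>real. val k (fst p))"
  by (rule continuous_on_compose2[OF val_cont[of UNIV]]) (auto intro: continuous_intros)

text \<open>Arcs are continuous on the whole line, so each weak comparison with an arc defines a
  closed set; the cell is contained in it and so is its closure.\<close>

lemma closure_cset_imp:
  assumes p: "p \<in> closure (cset q)"
  shows "fst p \<in> closure (colset (fst q))" "sides p q"
proof -
  have "cset q \<subseteq> fst -` closure (colset (fst q))"
  proof
    fix p assume "p \<in> cset q"
    then have "fst p \<in> colset (fst q)" by (simp add: cset_def colset_def cell_def)
    then show "p \<in> fst -` closure (colset (fst q))" using closure_subset[of "colset (fst q)"] by auto
  qed
  moreover have "closed (fst -` closure (colset (fst q)) :: (real \<times> real) set)"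
    by (intro closed_vimage_fst closed_closure)
  ultimately show "fst p \<in> closure (colset (fst q))" using closure_minimalD[OF p] by blast
  show "sides p q"
    unfolding sides_def
  proof (intro allI impI conjI)
    fix k assume k: "k < N" "pres k (fst q)"
    have d: "val k (fst q) < snd q \<longleftrightarrow> val k (fst p') < snd p'" "val k (fst q) = snd q \<longleftrightarrow> val k (fst p') = snd p'"
      if "p' \<in> cset q" for p'
    proof -
      have "cell q = cell p'" using that by (simp add: cset_def)
      then show "val k (fst q) < snd q \<longleftrightarrow> val k (fst p') < snd p'" "val k (fst q) = snd q \<longleftrightarrow> val k (fst p') = snd p'"
        using cell_eqD[OF _ k] by blast+
    qed
    show "val k (fst p) \<le> snd p" if "val k (fst q) < snd q"
    proof -
      have "cset q \<subseteq> {p. val k (fst p) \<le> snd p}" using d(1) that less_imp_le by blast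
      moreover have "closed {p::real\<times>real. val k (fst p) \<le> snd p}"
        by (intro closed_Collect_le val_fst_cont continuous_intros)
      ultimately show ?thesis using closure_minimalD[OF p] by blast
    qed
    show "snd p \<le> val k (fst p)" if "snd q < val k (fst q)"
    proof -
      have "cset q \<subseteq> {p. snd p \<le> val k (fst p)}"
      proof
        fix p' assume "p' \<in> cset q"
        then have "\<not> val k (fst p') < snd p'" using d(1) that less_asym by blast
        then show "p' \<in> {p. snd p \<le> val k (fst p)}" by simp
      qed
      moreover have "closed {p::real\<times>real. snd p \<le> val k (fst p)}"
        by (intro closed_Collect_le val_fst_cont continuous_intros)
      ultimately show ?thesis using closure_minimalD[OF p] by blast
    qed
    show "val k (fst p) = snd p" if "val k (fst q) = snd q"
    proof -
      have "cset q \<subseteq> {p. val k (fst p) = snd p}" using d(2) that by blast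
      moreover have "closed {p::real\<times>real. val k (fst p) = snd p}"
        by (intro closed_Collect_eq val_fst_cont continuous_intros)
      ultimately show ?thesis using closure_minimalD[OF p] by blast
    qed
  qed
qed

text \<open>Over an abscissa \<open>z\<close> of the column close to \<open>fst p\<close> every arc
  is close to its height over \<open>fst p\<close>. Hence the weak comparisons at \<open>p\<close>
  leave room for a point of the cell over \<open>z\<close> at nearly the height of
  \<open>p\<close>.\<close>

lemma closure_csetI:
  assumes x: "fst p \<in> closure (colset (fst q))" and s: "sides p q"
  shows "p \<in> closure (cset q)"
  unfolding closure_approachable
proof (intro allI impI)
  fix e :: real assume e: "e > 0"
  \<comment> \<open>There are finitely many arcs, so one neighbourhood of \<open>fst p\<close>
    serves all of them.\<close>
  have "\<forall>\<^sub>F z in at (fst p). \<forall>k\<in>{..<N}. dist (val k z) (val k (fst p)) < e / 2"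
  proof (rule eventually_ball_finite)
    have "isCont (val k) (fst p)" for k using val_cont[of UNIV k] continuous_on_eq_continuous_at open_UNIV by blast
    then show "\<forall>k\<in>{..<N}. \<forall>\<^sub>F z in at (fst p). dist (val k z) (val k (fst p)) < e / 2"
      using e by (intro ballI tendstoD) (auto simp: isCont_def)
  qed simp
  then obtain d where d: "d > 0" "\<And>z k. dist z (fst p) < d \<Longrightarrow> k < N \<Longrightarrow> dist (val k z) (val k (fst p)) < e / 2"
    unfolding eventually_at using e by (metis dist_self half_gt_zero lessThan_iff UNIV_I)
  obtain z where z: "z \<in> colset (fst q)" "dist z (fst p) < min d (e / 2)"
    using x d(1) e unfolding closure_approachable by (metis half_gt_zero min_less_iff_conj)
  have c: "col (fst q) = col z" using z by (simp add: colset_def)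
  have dz: "\<bar>val k z - val k (fst p)\<bar> < e / 2" if "k < N" for k using d(2)[of z k] z that by (auto simp: dist_real_def)
  have "\<exists>y. (z, y) \<in> cset q \<and> \<bar>y - snd p\<bar> < e / 2"
  proof (cases "\<exists>k<N. pres k (fst q) \<and> val k (fst q) = snd q")
    case True
    then obtain k where k: "k < N" "pres k (fst q)" "val k (fst q) = snd q" by blast
    then have "(z, val k z) \<in> cset q" using cset_arc z by blast
    moreover have "val k (fst p) = snd p" using s k by (simp add: sides_def)
    ultimately show ?thesis using dz[OF k(1)] by metis
  next
    case False
    define B where "B = {k. k < N \<and> pres k (fst q) \<and> val k (fst q) < snd q}"
    define U where "U = {k. k < N \<and> pres k (fst q) \<and> snd q < val k (fst q)}"
    have fin: "finite B" "finite U" by (auto simp: B_def U_def)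
    \<comment> \<open>The two additional bounds force the chosen ordinate to be close to
      \<open>snd p\<close>.\<close>
    have "\<exists>y. (\<forall>a\<in>insert (snd p - e/2) ((\<lambda>k. val k z) ` B). a < y) \<and> (\<forall>b\<in>insert (snd p + e/2) ((\<lambda>k. val k z) ` U). y < b)"
    proof (rule between_finite)
      have BU: "val k z < val l z" if "k \<in> B" "l \<in> U" for k l
        using that col_order(1)[OF c, of k l] by (force simp: B_def U_def)
      have B: "val k z < snd p + e / 2" if "k \<in> B" for k
      proof -
        have "val k (fst p) \<le> snd p" "k < N" using that s by (auto simp: B_def sides_def)
        then show ?thesis using dz[of k] by linarith
      qed
      have U: "snd p - e / 2 < val k z" if "k \<in> U" for k
      proof -
        have "snd p \<le> val k (fst p)" "k < N" using that s by (auto simp: U_def sides_def)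
        then show ?thesis using dz[of k] by linarith
      qed
      fix a b assume "a \<in> insert (snd p - e/2) ((\<lambda>k. val k z) ` B)" "b \<in> insert (snd p + e/2) ((\<lambda>k. val k z) ` U)"
      then show "a < b" using BU B U e by auto
    qed (use fin in auto)
    then obtain y where y: "\<forall>k\<in>B. val k z < y" "\<forall>k\<in>U. y < val k z" "snd p - e/2 < y" "y < snd p + e/2" by auto
    have "(z, y) \<in> cset q" using y(1,2) z False by (subst cset_gap) (auto simp: B_def U_def)
    moreover have "\<bar>y - snd p\<bar> < e / 2" using y(3,4) by linarith
    ultimately show ?thesis by blast
  qed
  then obtain y where y: "(z, y) \<in> cset q" "\<bar>y - snd p\<bar> < e / 2" by blast
  have "dist (z, y) p \<le> \<bar>z - fst p\<bar> + \<bar>y - snd p\<bar>"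
    by (cases p) (simp add: dist_prod_def dist_real_def sqrt_sum_squares_le_sum_abs)
  then have "dist (z, y) p < e" using y z by (simp add: dist_real_def)
  then show "\<exists>y\<in>cset q. dist y p < e" using y by blast
qed

lemma Sg_closure: "p \<in> closure (cset q) \<Longrightarrow> Sg q \<subseteq> Sg p"
proof
  fix k assume p: "p \<in> closure (cset q)" and k: "k \<in> Sg q"
  have "cset q \<subseteq> {p. on k p}"
  proof
    fix p assume "p \<in> cset q"
    then have "Sg p = Sg q" by (intro Sg_cell) (simp add: cset_def)
    then show "p \<in> {p. on k p}" using k by (auto simp: Sg_def)
  qed
  moreover have "closed {p. on k p}" unfolding on_def by (intro closed_Collect_eq continuous_intros)
  ultimately have "closure (cset q) \<subseteq> {p. on k p}" by (rule closure_minimal)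
  then show "k \<in> Sg p" using p k by (auto simp: Sg_def)
qed

end

section \<open>Faces as components of the cell graph\<close>

context arcs begin

text \<open>Lying in a common face, phrased without the set of disks; \<open>faces_sameface\<close>
  makes the connection.\<close>

definition sameface :: "real \<times> real \<Rightarrow> real \<times> real \<Rightarrow> bool" where
  "sameface p q \<longleftrightarrow> (\<exists>T S. connected T \<and> p \<in> T \<and> q \<in> T \<and> (\<forall>t\<in>T. Sg t = S))"

lemma samefaceI: "connected T \<Longrightarrow> p \<in> T \<Longrightarrow> q \<in> T \<Longrightarrow> (\<And>t. t \<in> T \<Longrightarrow> Sg t = S) \<Longrightarrow> sameface p q"
  unfolding sameface_def by blast

lemma sameface_sym: "sameface p q \<Longrightarrow> sameface q p"
  unfolding sameface_def by blast

lemma sameface_refl: "sameface p p"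
  by (rule samefaceI[of "{p}"]) auto

lemma sameface_trans:
  assumes "sameface p q" "sameface q w" shows "sameface p w"
proof -
  obtain T S where T: "connected T" "p \<in> T" "q \<in> T" "\<And>t. t \<in> T \<Longrightarrow> Sg t = S"
    using assms(1) unfolding sameface_def by blast
  obtain U S' where U: "connected U" "q \<in> U" "w \<in> U" "\<And>t. t \<in> U \<Longrightarrow> Sg t = S'"
    using assms(2) unfolding sameface_def by blast
  have S: "S = S'" using T(4)[OF T(3)] U(4)[OF U(2)] by (rule subst)
  show ?thesis
  proof (rule samefaceI)
    show "connected (T \<union> U)" using T(1,3) U(1,2) by (intro connected_Un) blast+
    show "p \<in> T \<union> U" "w \<in> T \<union> U" using T(2) U(3) by blast+
    show "Sg t = S'" if "t \<in> T \<union> U" for t using that T(4) U(4) S by blast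
  qed
qed

lemma sameface_cell: "cell p = cell q \<Longrightarrow> sameface p q"
proof -
  assume c: "cell p = cell q"
  show ?thesis
  proof (rule samefaceI[OF cset_connected[of q]])
    show "p \<in> cset q" "q \<in> cset q" using c by (simp_all add: cset_def)
    show "Sg t = Sg q" if "t \<in> cset q" for t using that by (intro Sg_cell) (simp add: cset_def)
  qed
qed

text \<open>Circles are closed, so passing to a limit point can only add circles; equal numbers then
  give equal sets, and a connected set stays connected when a limit point is added.\<close>

lemma sameface_closure:
  assumes p: "p \<in> closure (cset q)" and c: "card (Sg p) = card (Sg q)"
  shows "sameface p q"
proof -
  have Sg: "Sg p = Sg q" using Sg_closure[OF p] c by (metis card_subset_eq finite_Sg)
  have "connected (insert p (cset q))"
    by (rule connected_intermediate_closure[OF cset_connected[of q]]) (use p closure_subset in auto)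
  then show ?thesis
  proof (rule samefaceI)
    show "Sg t = Sg q" if "t \<in> insert p (cset q)" for t
    proof (cases "t = p")
      case False
      then show ?thesis using that by (intro Sg_cell) (simp add: cset_def)
    qed (simp add: Sg)
  qed (simp_all add: cset_def)
qed

text \<open>The comparisons of \<open>q\<close> with the arcs hold weakly at \<open>p\<close>, and
  it remains to exclude new equalities. If \<open>p\<close> is on arc \<open>k\<close>, it is on
  that circle, hence so is \<open>q\<close>, on some arc \<open>l\<close> of the circle. Then
  \<open>p\<close> is on \<open>l\<close> as well, so \<open>k\<close> and \<open>l\<close> agree
  over \<open>fst p\<close> and, by constancy in the column, over \<open>fst q\<close>.\<close>

lemma closure_same_col:
  assumes p: "p \<in> closure (cset q)" and S: "Sg p = Sg q" and c: "col (fst q) = col (fst p)"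
  shows "cell p = cell q"
proof -
  have "cell q = cell p"
  proof (rule cell_eqI[OF c])
    fix k assume k: "k < N" "pres k (fst q)"
    have kp: "pres k (fst p)" using col_pres[OF c] k by simp
    have s: "val l (fst q) = snd q \<Longrightarrow> val l (fst p) = snd p" if "l < N" "pres l (fst q)" for l
      using closure_cset_imp(2)[OF p] that by (auto simp: sides_def)
    have e: "val k (fst q) = snd q" if v: "val k (fst p) = snd p"
    proof -
      have "k \<in> Sg p" using k kp v on_iff by (auto simp: Sg_def)
      then have "k \<in> Sg q" using S by simp
      then have "on k q" by (simp add: Sg_def)
      then obtain l where l: "l < N" "ax l = ax k" "val l (fst q) = snd q" using on_iff[OF k(1)] by blast
      have lq: "pres l (fst q)" using k l by (simp add: pres_def)
      then have "val l (fst p) = val k (fst p)" using s l v by simp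
      then show ?thesis using col_order(2)[OF c l(1) k(1) lq k(2)] l by simp
    qed
    show "(val k (fst q) = snd q) = (val k (fst p) = snd p)" using e s[OF k] by blast
    show "(val k (fst q) < snd q) = (val k (fst p) < snd p)"
    proof (rule linorder_cases[of "val k (fst q)" "snd q"])
      assume a: "val k (fst q) < snd q"
      then have "val k (fst p) \<le> snd p" using closure_cset_imp(2)[OF p] k by (simp add: sides_def)
      moreover have "val k (fst p) \<noteq> snd p" using a e by auto
      ultimately show ?thesis using a by simp
    next
      assume a: "snd q < val k (fst q)"
      then have "snd p \<le> val k (fst p)" using closure_cset_imp(2)[OF p] k by (simp add: sides_def)
      then show ?thesis using a by simp
    next
      assume a: "val k (fst q) = snd q"
      then show ?thesis using s[OF k a] by simp
    qed
  qed
  then show ?thesis by simp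
qed

lemma colset_open:
  assumes x: "x \<notin> E" shows "open (colset x)"
  unfolding open_dist
proof
  fix z assume z: "z \<in> colset x"
  have "z \<notin> E" using z x odd_pos[of E z] odd_pos[of E x] by (simp add: colset_def)
  then obtain d where d: "d > 0" "\<forall>e\<in>E. e \<noteq> z \<longrightarrow> d \<le> dist z e" using finite_set_avoid[OF finE] by metis
  have "w \<in> colset x" if "dist w z < d" for w
  proof -
    have a: "(e < w \<longleftrightarrow> e < z) \<and> e \<noteq> w" if e: "e \<in> E" for e
    proof -
      have "e \<noteq> z" using e \<open>z \<notin> E\<close> by blast
      then have "d \<le> \<bar>z - e\<bar>" using d(2) e by (auto simp: dist_real_def)
      then show ?thesis using \<open>dist w z < d\<close> by (auto simp: dist_real_def)
    qed
    have "{v\<in>E. v < w} = {v\<in>E. v < z}" "w \<notin> E" using a by auto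
    then have "col w = col z" using \<open>z \<notin> E\<close> by (simp add: pos_def)
    then show ?thesis using z by (simp add: colset_def)
  qed
  then show "\<exists>e>0. \<forall>y. dist y z < e \<longrightarrow> y \<in> colset x" using d(1) by blast
qed

text \<open>A slab is open, so a limit point in it comes from the same slab; a line is closed, so
  cells of a line have limits only on it. Apart from equal cells this leaves a limit on a line of a
  cell in a slab.\<close>

lemma closure_cset_cases:
  assumes p: "p \<in> closure (cset q)" and S: "Sg p = Sg q"
  shows "cell p = cell q \<or> fst p \<in> E \<and> fst q \<notin> E"
proof (rule ccontr)
  assume n: "\<not> (cell p = cell q \<or> fst p \<in> E \<and> fst q \<notin> E)"
  have x: "fst p \<in> closure (colset (fst q))" using closure_cset_imp(1)[OF p] .
  have "col (fst q) = col (fst p)"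
  proof (cases "fst p \<in> E")
    case True
    then have "fst q \<in> E" using n by simp
    then have "colset (fst q) = {fst q}" using pos_eq_iff[OF finE] by (auto simp: colset_def)
    then show ?thesis using x by simp
  next
    case False
    have "fst p \<in> colset (fst p)" by (simp add: colset_def)
    then have "colset (fst p) \<inter> colset (fst q) \<noteq> {}" using open_Int_closure_eq_empty[OF colset_open[OF False]] x by blast
    then show ?thesis by (auto simp: colset_def)
  qed
  then show False using closure_same_col p S n by blast
qed

lemma cell_le: "fst (cell p) \<le> 2 * card E" "snd (cell p) \<le> 2 * N"
  using pos_le[OF finE] pos_le[OF finite_Vals, of "fst p" "snd p"] card_Vals[of "fst p"] by (auto simp: cell_def)

lemma finite_cells: "finite (range cell)"
proof (rule finite_subset)
  show "range cell \<subseteq> {..2 * card E} \<times> {..2 * N}"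
  proof (rule image_subsetI)
    fix p show "cell p \<in> {..2 * card E} \<times> {..2 * N}" using cell_le[of p] by (simp add: mem_Times_iff)
  qed
qed simp

text \<open>The label is locally constant on a connected set of constant incidence, hence constant:
  every point near \<open>a\<close> lies in a cell with \<open>a\<close> in its closure, and this
  cell is that of \<open>a\<close> or joined to it.\<close>

theorem labelling_complete:
  assumes g: "\<And>p q. fst p \<in> E \<Longrightarrow> fst q \<notin> E \<Longrightarrow> p \<in> closure (cset q) \<Longrightarrow> Sg p = Sg q \<Longrightarrow> g (cell p) = g (cell q)"
    and s: "sameface p q"
  shows "g (cell p) = g (cell q)"
proof -
  obtain T S where T: "connected T" "p \<in> T" "q \<in> T" "\<And>t. t\<in>T \<Longrightarrow> Sg t = S" using s unfolding sameface_def by blast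
  show ?thesis
  proof (rule connected_local_const[OF T(1-3)], intro ballI)
    fix a assume a: "a \<in> T"
    \<comment> \<open>The cells that do not approach \<open>a\<close>. They are finitely many, so
      the union of their closures is closed and misses a neighbourhood of \<open>a\<close>.\<close>
    define C where "C = {cset q | q. a \<notin> closure (cset q)}"
    have "C \<subseteq> (\<lambda>c. {p. cell p = c}) ` range cell" by (auto simp: C_def cset_def)
    then have "finite C" using finite_cells finite_surj by blast
    then have "open (- (\<Union>S\<in>C. closure S))" by (intro open_Compl closed_UN) auto
    moreover have "a \<in> - (\<Union>S\<in>C. closure S)" by (auto simp: C_def)
    ultimately have "\<forall>\<^sub>F b in at a within T. b \<in> - (\<Union>S\<in>C. closure S)"
      by (meson eventually_at_topological)
    moreover have "\<forall>\<^sub>F b in at a within T. b \<in> T" by (auto simp: eventually_at_filter)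
    ultimately show "\<forall>\<^sub>F b in at a within T. g (cell a) = g (cell b)"
    proof eventually_elim
      case (elim b)
      have "b \<in> closure (cset b)" using closure_subset by (force simp: cset_def)
      then have "cset b \<notin> C" using elim by blast
      then have "a \<in> closure (cset b)" unfolding C_def by blast
      moreover have "Sg a = Sg b" using T a elim by simp
      ultimately show ?case using closure_cset_cases g by metis
    qed
  qed
qed

section \<open>Slab cells touching a line, found by counting\<close>

lemma closure_colset_iff:
  assumes X: "X \<in> E" and x: "x \<notin> E"
  shows "X \<in> closure (colset x) \<longleftrightarrow> col x = col X + 1 \<or> col X = col x + 1"
proof
  assume cl: "X \<in> closure (colset x)"
  \<comment> \<open>Between \<open>X\<close> and a point of the slab closer than \<open>d\<close> no
    other event lies, so the two positions differ by exactly one.\<close>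
  obtain d where d: "d > 0" "\<forall>e\<in>E. e \<noteq> X \<longrightarrow> d \<le> dist X e" using finite_set_avoid[OF finE] by metis
  obtain z where z: "z \<in> colset x" "dist z X < d" using cl d(1) unfolding closure_approachable by blast
  have cz: "col z = col x" using z by (simp add: colset_def)
  have zE: "z \<notin> E" using x cz odd_pos[of E z] odd_pos[of E x] by simp
  then have "z \<noteq> X" using X by auto
  show "col x = col X + 1 \<or> col X = col x + 1"
  proof (cases "X < z")
    case True
    have "e < z \<longleftrightarrow> e < X \<or> e = X" if "e \<in> E" for e
    proof (cases "e = X")
      case False
      then have "d \<le> dist X e" using d that by blast
      then show ?thesis using True z False by (auto simp: dist_real_def)
    qed (use True in simp)
    then have "{v\<in>E. v < z} = insert X {v\<in>E. v < X}" using X by auto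
    then have "col z = col X + 1" using zE X finE by (simp add: pos_def)
    then show ?thesis using cz by simp
  next
    case False
    have "e < z \<longleftrightarrow> e < X" if "e \<in> E" for e
    proof (cases "e = X")
      case False
      then have "d \<le> dist X e" using d that by blast
      then show ?thesis using \<open>\<not> X < z\<close> z False by (auto simp: dist_real_def)
    qed (use False in simp)
    then have "{v\<in>E. v < z} = {v\<in>E. v < X}" by auto
    then have "col X = col z + 1" using zE X finE by (simp add: pos_def)
    then show ?thesis using cz by simp
  qed
next
  assume "col x = col X + 1 \<or> col X = col x + 1"
  then show "X \<in> closure (colset x)"
  proof
    assume c: "col x = col X + 1"
    then have Xx: "X < x" using pos_less_iff[OF finE] X by (metis less_add_one)
    have "{X<..<x} \<subseteq> colset x"
    proof
      fix z assume z: "z \<in> {X<..<x}"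
      then have "col X < col z" "col z \<le> col x" using pos_strict[OF finE] pos_mono[OF finE] X by auto
      then show "z \<in> colset x" using c by (simp add: colset_def)
    qed
    then have "closure {X<..<x} \<subseteq> closure (colset x)" by (rule closure_mono)
    then show ?thesis using Xx by auto
  next
    assume c: "col X = col x + 1"
    then have Xx: "x < X" using pos_less_iff[OF finE] X by (metis less_add_one)
    have "{x<..<X} \<subseteq> colset x"
    proof
      fix z assume z: "z \<in> {x<..<X}"
      then have "col z < col X" "col x \<le> col z" using pos_strict[OF finE] pos_mono[OF finE] X by auto
      then show "z \<in> colset x" using c by (simp add: colset_def)
    qed
    then have "closure {x<..<X} \<subseteq> closure (colset x)" by (rule closure_mono)
    then show ?thesis using Xx by auto
  qed
qed

text \<open>Required over every abscissa of the column, whereas the program inspects only one;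
  \<open>orderI\<close> bridges the difference.\<close>

definition order :: "(nat \<Rightarrow> nat) \<Rightarrow> nat \<Rightarrow> nat \<Rightarrow> bool" where
  "order A K c \<longleftrightarrow> (\<forall>x. col x = c \<longrightarrow> (\<forall>t<K. A t < N \<and> pres (A t) x) \<and>
     (\<forall>s t. s < t \<longrightarrow> t < K \<longrightarrow> val (A s) x < val (A t) x) \<and> (\<lambda>t. val (A t) x) ` {..<K} = Vals x)"

lemma orderI:
  assumes A: "\<forall>t<K. A t < N \<and> pres (A t) x"
    "\<forall>s t. s < t \<longrightarrow> t < K \<longrightarrow> val (A s) x < val (A t) x" "(\<lambda>t. val (A t) x) ` {..<K} = Vals x"
  shows "order A K (col x)"
  unfolding order_def
proof (intro allI impI conjI)
  fix z assume "col z = col x"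
  then have c: "col x = col z" by simp
  show 1: "A t < N" "pres (A t) z" if "t < K" for t using A col_pres[OF c] that by auto
  show "val (A s) z < val (A t) z" if "s < t" "t < K" for s t
    using A(1,2) that col_order(1)[OF c, of "A s" "A t"] by simp
  show "(\<lambda>t. val (A t) z) ` {..<K} = Vals z"
  proof (intro equalityI subsetI)
    fix v assume "v \<in> Vals z"
    then obtain k where k: "k < N" "pres k z" "v = val k z" by (auto simp: Vals_def)
    then have "pres k x" using col_pres[OF c] by simp
    then have "val k x \<in> (\<lambda>t. val (A t) x) ` {..<K}" using A(3) k by (auto simp: Vals_def)
    then obtain t where t: "t < K" "val k x = val (A t) x" by auto
    then have "val k z = val (A t) z" using col_order(2)[OF c, of k "A t"] A(1) k \<open>pres k x\<close> by blast
    then show "v \<in> (\<lambda>t. val (A t) z) ` {..<K}" using k t by auto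
  qed (use 1 in \<open>auto simp: Vals_def\<close>)
qed

lemma order_pos:
  assumes "order A K c" "col x = c" "t < K"
  shows "pos (Vals x) (val (A t) x) = 2 * t + 1"
  using pos_sorted[of K "\<lambda>t. val (A t) x" t] assms by (auto simp: order_def)

text \<open>The reason why counting arcs replaces comparing them one by one.\<close>

lemma down_closed_card:
  fixes S :: "nat set"
  assumes "S \<subseteq> {..<K}" "\<And>s t. s < t \<Longrightarrow> t \<in> S \<Longrightarrow> s \<in> S"
  shows "S = {..<card S}"
proof -
  have f: "finite S" using assms(1) finite_subset by blast
  show ?thesis
  proof (cases "S = {}")
    case False
    have "S = {..Max S}"
    proof (intro equalityI subsetI)
      fix s assume "s \<in> {..Max S}"
      then show "s \<in> S" using Max_in[OF f False] assms(2)[of s "Max S"] by (cases "s = Max S") auto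
    qed (use f in auto)
    then show ?thesis by (metis card_atMost lessThan_Suc_atMost)
  qed simp
qed

text \<open>Over the boundary the arcs of the slab still increase weakly, so the arcs strictly below
  \<open>p\<close> and those weakly below \<open>p\<close> are the first \<open>a\<close> and the
  first \<open>b\<close>. Arc \<open>t\<close> has position \<open>2 * t + 1\<close> in the slab,
  and the condition on all arcs shrinks to one on \<open>j\<close>, the position of
  \<open>q\<close>.\<close>

lemma sides_iff:
  assumes o: "order A K (col (fst q))" and cl: "fst p \<in> closure (colset (fst q))"
  shows "sides p q \<longleftrightarrow> 2 * card {t. t < K \<and> val (A t) (fst p) < snd p} \<le> snd (cell q) \<and>
    snd (cell q) \<le> 2 * card {t. t < K \<and> val (A t) (fst p) \<le> snd p}"
proof -
  define j where "j = snd (cell q)"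
  define SA where "SA = {t. t < K \<and> val (A t) (fst p) < snd p}"
  define SB where "SB = {t. t < K \<and> val (A t) (fst p) \<le> snd p}"
  define a b where "a = card SA" and "b = card SB"
  have A: "A t < N" "pres (A t) (fst q)" if "t < K" for t using o that by (auto simp: order_def)
  \<comment> \<open>Only weakly: several arcs of the slab may meet on its boundary, which is why
    \<open>a\<close> and \<open>b\<close> may be far apart.\<close>
  have mono: "val (A s) (fst p) \<le> val (A t) (fst p)" if "s < t" "t < K" for s t
  proof -
    have "colset (fst q) \<subseteq> {x. val (A s) x \<le> val (A t) x}"
      using o that by (auto simp: colset_def order_def less_imp_le)
    moreover have "closed {x. val (A s) x \<le> val (A t) x}" by (intro closed_Collect_le val_cont)
    ultimately show ?thesis using closure_minimalD[OF cl] by blast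
  qed
  have "SA = {..<card SA}" by (rule down_closed_card[of _ K]) (use mono in \<open>force simp: SA_def\<close>)+
  then have a: "t < a \<longleftrightarrow> t < K \<and> val (A t) (fst p) < snd p" for t unfolding a_def using SA_def by blast
  have "SB = {..<card SB}" by (rule down_closed_card[of _ K]) (use mono in \<open>force simp: SB_def\<close>)+
  then have b: "t < b \<longleftrightarrow> t < K \<and> val (A t) (fst p) \<le> snd p" for t unfolding b_def using SB_def by blast
  have vq: "val (A t) (fst q) \<in> Vals (fst q)" if "t < K" for t using A[OF that] by (auto simp: Vals_def)
  have j1: "val (A t) (fst q) < snd q \<longleftrightarrow> 2 * t + 1 < j" if "t < K" for t
    using order_pos[OF o refl that] pos_less_iff[OF finite_Vals disjI1[OF vq[OF that]], of "snd q"] by (simp add: j_def cell_def)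
  have j2: "snd q < val (A t) (fst q) \<longleftrightarrow> j < 2 * t + 1" if "t < K" for t
    using order_pos[OF o refl that] pos_less_iff[OF finite_Vals disjI2[OF vq[OF that]], of "snd q"] by (simp add: j_def cell_def)
  have j3: "val (A t) (fst q) = snd q \<longleftrightarrow> 2 * t + 1 = j" if "t < K" for t
    using order_pos[OF o refl that] pos_eq_iff[OF finite_Vals disjI1[OF vq[OF that]], of "snd q"] by (simp add: j_def cell_def)
  \<comment> \<open>\<open>A\<close> contains one arc for each set of coinciding arcs; the
    coincidence persists over the column and over its closure.\<close>
  have rep: "\<exists>t<K. val k (fst q) = val (A t) (fst q) \<and> val k (fst p) = val (A t) (fst p)" if k: "k < N" "pres k (fst q)" for k
  proof -
    have "val k (fst q) \<in> (\<lambda>t. val (A t) (fst q)) ` {..<K}" using o k by (auto simp: order_def Vals_def)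
    then obtain t where t: "t < K" "val k (fst q) = val (A t) (fst q)" by auto
    have "colset (fst q) \<subseteq> {x. val k x = val (A t) x}"
      using col_order(2)[OF _ k(1) A(1)[OF t(1)] k(2) A(2)[OF t(1)]] t by (auto simp: colset_def)
    moreover have "closed {x. val k x = val (A t) x}" by (intro closed_Collect_eq val_cont)
    ultimately show ?thesis using closure_minimalD[OF cl] t by blast
  qed
  have "sides p q \<longleftrightarrow> (\<forall>t<K. (2 * t + 1 < j \<longrightarrow> t < b) \<and> (j < 2 * t + 1 \<longrightarrow> \<not> t < a) \<and> (2 * t + 1 = j \<longrightarrow> t < b \<and> \<not> t < a))"
    (is "_ \<longleftrightarrow> ?R")
  proof
    assume s: "sides p q"
    show ?R
    proof (intro allI impI)
      fix t assume t: "t < K"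
      show "(2 * t + 1 < j \<longrightarrow> t < b) \<and> (j < 2 * t + 1 \<longrightarrow> \<not> t < a) \<and> (2 * t + 1 = j \<longrightarrow> t < b \<and> \<not> t < a)"
        using s[unfolded sides_def, rule_format, OF A[OF t]] t unfolding j1[OF t] j2[OF t] j3[OF t] a b by auto
    qed
  next
    assume R: ?R
    show "sides p q"
      unfolding sides_def
    proof (intro allI impI)
      fix k assume "k < N" "pres k (fst q)"
      then obtain t where t: "t < K" "val k (fst q) = val (A t) (fst q)" "val k (fst p) = val (A t) (fst p)" using rep by blast
      show "(val k (fst q) < snd q \<longrightarrow> val k (fst p) \<le> snd p) \<and> (snd q < val k (fst q) \<longrightarrow> snd p \<le> val k (fst p)) \<and>
        (val k (fst q) = snd q \<longrightarrow> val k (fst p) = snd p)"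
        using R[rule_format, OF t(1)] t(1) unfolding t(2,3) j1[OF t(1)] j2[OF t(1)] j3[OF t(1)] a b by auto
    qed
  qed
  also have "\<dots> \<longleftrightarrow> 2 * a \<le> j \<and> j \<le> 2 * b"
  proof
    assume R: ?R
    have "card (Vals (fst q)) \<le> K"
      using o by (metis card_image_le card_lessThan finite_lessThan order_def)
    then have jK: "j \<le> 2 * K" using pos_le[OF finite_Vals, of "fst q" "snd q"] by (simp add: j_def cell_def)
    \<comment> \<open>Otherwise arc \<open>b\<close>, the first that is not weakly below
      \<open>p\<close>, would be on or below \<open>q\<close>. For the other bound arc
      \<open>a - 1\<close>, the last one strictly below \<open>p\<close>, plays this part.\<close>
    have "j \<le> 2 * b"
    proof (rule ccontr)
      assume "\<not> j \<le> 2 * b"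
      then have "b < K" "2 * b + 1 \<le> j" using jK by auto
      then show False using R by (metis le_neq_implies_less less_irrefl)
    qed
    moreover have "2 * a \<le> j"
    proof (rule ccontr)
      assume "\<not> 2 * a \<le> j"
      then have "a - 1 < a" "j \<le> 2 * (a - 1) + 1" by auto
      moreover from this have "a - 1 < K" using a by blast
      ultimately show False using R by (metis le_neq_implies_less)
    qed
    ultimately show "2 * a \<le> j \<and> j \<le> 2 * b" by simp
  qed auto
  finally show ?thesis by (simp add: a_def b_def SA_def SB_def j_def)
qed

end

section \<open>Reasoning about programs\<close>

text \<open>Total correctness, with the elapsed time as an argument of the postcondition so that
  time bounds are proved along with the rest. Determinism of \<open>exec\<close> turns the rules for
  the constructs into equations.\<close>

definition wp :: "com \<Rightarrow> (nat \<Rightarrow> state \<Rightarrow> bool) \<Rightarrow> state \<Rightarrow> bool" where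
  "wp c Q s \<longleftrightarrow> (\<exists>t s'. exec c s t s' \<and> Q t s')"

lemma wp_exec: "exec c s t s' \<Longrightarrow> wp c Q s \<longleftrightarrow> Q t s'"
  unfolding wp_def using exec_deterministic by blast

lemma wp_Skip [simp]: "wp Skip Q = Q 1"
  by (rule ext) (rule wp_exec[OF exec.Skip])

lemma wp_IAssign [simp]: "wp (IAssign a i e) Q = (\<lambda>s. Q (icost i + icost e + 1) (istore a (ival i s) (ival e s) s))"
  by (rule ext) (rule wp_exec[OF exec.IAssign])

lemma wp_RAssign [simp]: "wp (RAssign a i e) Q = (\<lambda>s. Q (icost i + rcost e + 1) (rstore a (ival i s) (rval e s) s))"
  by (rule ext) (rule wp_exec[OF exec.RAssign])

lemma wp_Seq [simp]: "wp (Seq c d) Q = wp c (\<lambda>t. wp d (\<lambda>u. Q (t + u)))"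
  unfolding wp_def fun_eq_iff by (blast intro: exec.Seq elim: SeqE)

lemma wp_Cond [simp]: "wp (Cond b c d) Q = (\<lambda>s.
    if bval b s then wp c (\<lambda>t. Q (bcost b + 1 + t)) s else wp d (\<lambda>t. Q (bcost b + 1 + t)) s)"
proof (intro ext iffI)
  fix s assume "wp (Cond b c d) Q s"
  then obtain t s' where e: "exec (Cond b c d) s t s'" "Q t s'" unfolding wp_def by blast
  from e(1) show "if bval b s then wp c (\<lambda>t. Q (bcost b + 1 + t)) s else wp d (\<lambda>t. Q (bcost b + 1 + t)) s"
    by (rule CondE) (use e(2) in \<open>auto simp: wp_def\<close>)
next
  fix s assume "if bval b s then wp c (\<lambda>t. Q (bcost b + 1 + t)) s else wp d (\<lambda>t. Q (bcost b + 1 + t)) s"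
  then show "wp (Cond b c d) Q s"
    unfolding wp_def by (cases "bval b s") (simp_all only: if_True if_False, (blast intro: exec.CondTrue exec.CondFalse)+)
qed

lemma wp_While: "wp (While b c) Q s \<longleftrightarrow>
    (if bval b s then wp c (\<lambda>t. wp (While b c) (\<lambda>u. Q (bcost b + 1 + t + u))) s else Q (bcost b + 1) s)"
proof
  assume "wp (While b c) Q s"
  then obtain t s' where e: "exec (While b c) s t s'" "Q t s'" unfolding wp_def by blast
  from e(1) show "if bval b s then wp c (\<lambda>t. wp (While b c) (\<lambda>u. Q (bcost b + 1 + t + u))) s else Q (bcost b + 1) s"
    by (rule WhileE) (use e(2) in \<open>auto simp: wp_def\<close>)
next
  assume "if bval b s then wp c (\<lambda>t. wp (While b c) (\<lambda>u. Q (bcost b + 1 + t + u))) s else Q (bcost b + 1) s"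
  then show "wp (While b c) Q s"
    unfolding wp_def by (cases "bval b s") (simp_all only: if_True if_False, (blast intro: exec.WhileTrue exec.WhileFalse)+)
qed

lemma wp_mono: "wp c Q s \<Longrightarrow> (\<And>t s'. Q t s' \<Longrightarrow> Q' t s') \<Longrightarrow> wp c Q' s"
  unfolding wp_def by blast

lemma store_simps [simp]:
  "ints (istore a i v s) = (ints s)(a := (ints s a)(i := v))"
  "reals (istore a i v s) = reals s"
  "reals (rstore a i w s) = (reals s)(a := (reals s a)(i := w))"
  "ints (rstore a i w s) = ints s"
  by (simp_all add: istore_def rstore_def)

primrec writes :: "com \<Rightarrow> string set" where
  "writes Skip = {}"
| "writes (IAssign a i e) = {a}"
| "writes (RAssign a i e) = {a}"
| "writes (Seq c d) = writes c \<union> writes d"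
| "writes (Cond b c d) = writes c \<union> writes d"
| "writes (While b c) = writes c"

text \<open>A name stands for its integer and its real array at once. With \<open>writes\<close>
  this yields frame conditions from the text of a program alone.\<close>

definition same :: "string set \<Rightarrow> state \<Rightarrow> state \<Rightarrow> bool" where
  "same W s s' \<longleftrightarrow> (\<forall>a. a \<notin> W \<longrightarrow> ints s' a = ints s a \<and> reals s' a = reals s a)"

lemma sameD: "same W s s' \<Longrightarrow> a \<notin> W \<Longrightarrow> ints s' a = ints s a" "same W s s' \<Longrightarrow> a \<notin> W \<Longrightarrow> reals s' a = reals s a"
  by (simp_all add: same_def)

lemma same_trans: "same W s s' \<Longrightarrow> same W s' s'' \<Longrightarrow> same W s s''"
  by (simp add: same_def)

lemma same_mono: "same W s s' \<Longrightarrow> W \<subseteq> W' \<Longrightarrow> same W' s s'"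
  unfolding same_def by blast

lemma exec_same: "exec c s t s' \<Longrightarrow> same (writes c) s s'"
  by (induction rule: exec.induct) (auto simp: same_def)

lemma wp_same: "wp c Q s \<Longrightarrow> (\<And>t s'. Q t s' \<Longrightarrow> same (writes c) s s' \<Longrightarrow> Q' t s') \<Longrightarrow> wp c Q' s"
  unfolding wp_def using exec_same by blast

abbreviation "V a \<equiv> ICell a (IConst 0)"
abbreviation "RV a \<equiv> RCell a (IConst 0)"
abbreviation assign (infix "::=" 62) where "a ::= e \<equiv> IAssign a (IConst 0) e"
abbreviation rassign (infix "::=r" 62) where "a ::=r e \<equiv> RAssign a (IConst 0) e"
abbreviation seq (infixr ";;" 61) where "c ;; d \<equiv> Seq c d"
abbreviation "incr v \<equiv> v ::= IAdd (V v) (IConst 1)"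

definition For :: "string \<Rightarrow> iexp \<Rightarrow> com \<Rightarrow> com" where
  "For v e c = v ::= IConst 0 ;; While (ILess (V v) e) (c ;; incr v)"

lemma writes_For [simp]: "writes (For v e c) = insert v (writes c)"
  by (auto simp: For_def)

text \<open>The bound is evaluated anew in each round and must keep the value \<open>N\<close>. Test
  and increment cost \<open>icost e + 10\<close> per round; initialisation and the last, failing
  test cost \<open>icost e + 7\<close>.\<close>

lemma wp_For:
  assumes v: "v \<notin> writes c"
    and init: "I 0 (istore v 0 0 s)"
    and bound: "\<And>k s'. k \<le> N \<Longrightarrow> same (insert v (writes c)) s s' \<Longrightarrow> ints s' v 0 = k \<Longrightarrow> I k s' \<Longrightarrow> ival e s' = N"
    and step: "\<And>k s'. k < N \<Longrightarrow> same (insert v (writes c)) s s' \<Longrightarrow> ints s' v 0 = k \<Longrightarrow> I k s' \<Longrightarrow>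
      wp c (\<lambda>t s''. t \<le> B \<and> I (Suc k) (istore v 0 (Suc k) s'')) s'"
    and fin: "\<And>t s'. t \<le> N * (B + icost e + 10) + icost e + 7 \<Longrightarrow> same (insert v (writes c)) s s' \<Longrightarrow>
      I N s' \<Longrightarrow> ints s' v 0 = N \<Longrightarrow> Q t s'"
  shows "wp (For v e c) Q s"
proof -
  let ?W = "While (ILess (V v) e) (c ;; incr v)"
  have loop: "wp ?W (\<lambda>t s''. t \<le> j * (B + icost e + 10) + icost e + 4 \<and> same (insert v (writes c)) s s'' \<and>
      I N s'' \<and> ints s'' v 0 = N) s'"
    if "j = N - k" "k \<le> N" "same (insert v (writes c)) s s'" "ints s' v 0 = k" "I k s'" for j k s'
    using that
  proof (induction j arbitrary: k s')
    case 0
    then have "k = N" by simp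
    with 0 bound[of k s'] show ?case by (subst wp_While) simp
  next
    case (Suc j)
    then have k: "k < N" by simp
    have "wp c (\<lambda>t s''. wp (incr v ;; ?W) (\<lambda>u s''. bcost (ILess (V v) e) + 1 + (t + u) \<le> Suc j * (B + icost e + 10) + icost e + 4 \<and>
        same (insert v (writes c)) s s'' \<and> I N s'' \<and> ints s'' v 0 = N) s'') s'"
    proof (rule wp_same[OF step[OF k Suc.prems(3,4,5)]])
      fix t s1 assume a: "t \<le> B \<and> I (Suc k) (istore v 0 (Suc k) s1)" and sm: "same (writes c) s' s1"
      let ?s2 = "istore v 0 (Suc k) s1"
      have v1: "ints s1 v 0 = k" using sm v Suc.prems(4) by (simp add: same_def)
      have "same (insert v (writes c)) s' ?s2" using sm by (auto simp: same_def)
      then have sm2: "same (insert v (writes c)) s ?s2" using Suc.prems(3) same_trans by blast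
      have "wp ?W (\<lambda>t s''. t \<le> j * (B + icost e + 10) + icost e + 4 \<and> same (insert v (writes c)) s s'' \<and> I N s'' \<and> ints s'' v 0 = N) ?s2"
        by (rule Suc.IH[of "Suc k"]) (use Suc.prems k sm2 a in auto)
      then have "wp ?W (\<lambda>u s''. bcost (ILess (V v) e) + 1 + (t + (6 + u)) \<le> Suc j * (B + icost e + 10) + icost e + 4 \<and>
        same (insert v (writes c)) s s'' \<and> I N s'' \<and> ints s'' v 0 = N) ?s2"
        by (rule wp_mono) (use a in auto)
      then show "wp (incr v ;; ?W) (\<lambda>u s''. bcost (ILess (V v) e) + 1 + (t + u) \<le> Suc j * (B + icost e + 10) + icost e + 4 \<and>
        same (insert v (writes c)) s s'' \<and> I N s'' \<and> ints s'' v 0 = N) s1"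
        using v1 by (simp add: add_ac)
    qed
    moreover have "bval (ILess (V v) e) s'" using k Suc.prems bound[of k s'] by simp
    ultimately show ?case by (subst wp_While) (simp add: add_ac)
  qed
  have "same (insert v (writes c)) s (istore v 0 0 s)" by (simp add: same_def)
  then have "wp ?W (\<lambda>t s''. t \<le> N * (B + icost e + 10) + icost e + 4 \<and> same (insert v (writes c)) s s'' \<and>
      I N s'' \<and> ints s'' v 0 = N) (istore v 0 0 s)"
    using loop[of N 0] init by simp
  then have "wp ?W (\<lambda>t. Q (3 + t)) (istore v 0 0 s)"
    by (rule wp_mono) (use fin in auto)
  then show ?thesis by (simp add: For_def numeral_3_eq_3)
qed

section \<open>Listing arcs and events\<close>

definition duplicate_arcs :: com where
  "duplicate_arcs = ''nn'' ::= IAdd (V ''n'') (V ''n'') ;;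
    For ''i'' (V ''n'')
     (RAssign ''x'' (IAdd (V ''n'') (V ''i'')) (RCell ''x'' (V ''i'')) ;;
      RAssign ''y'' (IAdd (V ''n'') (V ''i'')) (RCell ''y'' (V ''i'')) ;;
      RAssign ''sg'' (V ''i'') (RConst (- 1)) ;;
      RAssign ''sg'' (IAdd (V ''n'') (V ''i'')) (RConst 1))"

lemma wp_duplicate_arcs:
  assumes n: "ints s ''n'' 0 = n"
    and Q: "\<And>t s'. t \<le> 60 * n + 20 \<Longrightarrow> same (writes duplicate_arcs) s s' \<Longrightarrow> ints s' ''nn'' 0 = 2 * n \<Longrightarrow>
      (\<And>k. k < n \<Longrightarrow> reals s' ''x'' k = reals s ''x'' k \<and> reals s' ''y'' k = reals s ''y'' k \<and> reals s' ''sg'' k = -1 \<and>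
        reals s' ''x'' (n + k) = reals s ''x'' k \<and> reals s' ''y'' (n + k) = reals s ''y'' k \<and> reals s' ''sg'' (n + k) = 1) \<Longrightarrow> Q t s'"
  shows "wp duplicate_arcs Q s"
proof -
  define I where "I = (\<lambda>k (s'::state). ints s' ''nn'' 0 = 2 * n \<and> (\<forall>j<n. reals s' ''x'' j = reals s ''x'' j \<and> reals s' ''y'' j = reals s ''y'' j) \<and>
    (\<forall>j<k. reals s' ''sg'' j = -1 \<and>
        reals s' ''x'' (n + j) = reals s ''x'' j \<and> reals s' ''y'' (n + j) = reals s ''y'' j \<and> reals s' ''sg'' (n + j) = 1))"
  have "wp duplicate_arcs (\<lambda>t s'. t \<le> 60 * n + 20 \<and> I n s') s"
    unfolding duplicate_arcs_def
    apply (simp only: wp_Seq wp_IAssign)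
    apply (rule wp_For[where I = I and N = n and B = 30])
        apply (simp add: I_def n)
       apply (simp add: I_def n)
      apply (simp add: sameD n)
     apply (auto simp: I_def sameD n less_Suc_eq)[1]
    apply (simp add: I_def n)
    done
  then show ?thesis by (rule wp_same) (rule Q, auto simp: I_def)
qed

definition crossx :: "iexp \<Rightarrow> iexp \<Rightarrow> rexp" where
  "crossx i j = RAdd (RDiv (RAdd (RCell ''x'' i) (RCell ''x'' j)) (RConst 2))
     (RMul (RSub (RCell ''y'' j) (RCell ''y'' i))
       (RSqrt (RSub (RDiv (RMul (RV ''r'') (RV ''r''))
           (RAdd (RMul (RSub (RCell ''x'' i) (RCell ''x'' j)) (RSub (RCell ''x'' i) (RCell ''x'' j)))
                 (RMul (RSub (RCell ''y'' i) (RCell ''y'' j)) (RSub (RCell ''y'' i) (RCell ''y'' j)))))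
         (RDiv (RConst 1) (RConst 4)))))"

text \<open>The extreme abscissa of arc \<open>i\<close> is repeated for each \<open>j\<close>, so
  that the number of entries is simply \<open>2 * (N * N)\<close>; the sort drops the
  repetitions.\<close>

definition list_events :: com where
  "list_events = ''M'' ::= IConst 0 ;;
    For ''i'' (V ''nn'') (For ''j'' (V ''nn'')
     (RAssign ''Z'' (V ''M'') (RAdd (RCell ''x'' (V ''i'')) (RMul (RCell ''sg'' (V ''i'')) (RV ''r''))) ;; incr ''M'' ;;
      RAssign ''Z'' (V ''M'') (crossx (V ''i'') (V ''j'')) ;; incr ''M''))"

lemma wp_list_events:
  assumes N: "ints s ''nn'' 0 = N"
    and Q: "\<And>t s'. t \<le> N * (N * 150 + 30) + 20 \<Longrightarrow> same (writes list_events) s s' \<Longrightarrow> ints s' ''M'' 0 = 2 * (N * N) \<Longrightarrow>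
      (\<And>k. k < N \<Longrightarrow> reals s ''x'' k + reals s ''sg'' k * reals s ''r'' 0 \<in> reals s' ''Z'' ` {..<2 * (N * N)}) \<Longrightarrow>
      (\<And>k l. k < N \<Longrightarrow> l < N \<Longrightarrow> rval (crossx (IConst k) (IConst l)) s \<in> reals s' ''Z'' ` {..<2 * (N * N)}) \<Longrightarrow> Q t s'"
  shows "wp list_events Q s"
proof -
  define a where "a = (\<lambda>k. reals s ''x'' k + reals s ''sg'' k * reals s ''r'' 0)"
  define b where "b = (\<lambda>k l. rval (crossx (IConst k) (IConst l)) s)"
  \<comment> \<open>The pair \<open>(i, j)\<close> measures the progress of the double loop
    lexicographically.\<close>
  define I where "I = (\<lambda>i j (s'::state). ints s' ''M'' 0 = 2 * (i * N + j) \<and>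
    (\<forall>k l. k < N \<longrightarrow> l < N \<longrightarrow> k < i \<or> k = i \<and> l < j \<longrightarrow>
      (\<exists>m<2 * (i * N + j). reals s' ''Z'' m = a k) \<and> (\<exists>m<2 * (i * N + j). reals s' ''Z'' m = b k l)))"
  have stepI: "I i (Suc j) s''" if I: "I i j s'" and i: "i < N" "j < N"
    and "ints s'' ''M'' 0 = Suc (Suc (ints s' ''M'' 0))"
    and "reals s'' ''Z'' = (reals s' ''Z'')(ints s' ''M'' 0 := a i, Suc (ints s' ''M'' 0) := b i j)" for i j s' s''
  proof -
    let ?m = "2 * (i * N + j)"
    have m: "ints s' ''M'' 0 = ?m" using I by (simp add: I_def)
    have Z: "reals s'' ''Z'' = (reals s' ''Z'')(?m := a i, Suc ?m := b i j)" using that(5) m by simp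
    have ms: "2 * (i * N + Suc j) = Suc (Suc ?m)" by simp
    have "(\<exists>m<Suc (Suc ?m). reals s'' ''Z'' m = a k) \<and> (\<exists>m<Suc (Suc ?m). reals s'' ''Z'' m = b k l)"
      if kl: "k < N" "l < N" "k < i \<or> k = i \<and> l < Suc j" for k l
    proof (cases "k = i \<and> l = j")
      case True
      then have "reals s'' ''Z'' ?m = a k" "reals s'' ''Z'' (Suc ?m) = b k l" by (simp_all add: Z)
      then show ?thesis by (intro conjI exI[of _ ?m, OF conjI] exI[of _ "Suc ?m", OF conjI]) simp_all
    next
      case False
      then have "k < i \<or> k = i \<and> l < j" using kl by auto
      then have e: "(\<exists>m<?m. reals s' ''Z'' m = a k) \<and> (\<exists>m<?m. reals s' ''Z'' m = b k l)"
        by (rule I[unfolded I_def, THEN conjunct2, rule_format, OF kl(1,2)])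
      obtain m where "m < ?m" "reals s' ''Z'' m = a k" using e by blast
      moreover obtain m' where "m' < ?m" "reals s' ''Z'' m' = b k l" using e by blast
      ultimately have "m < Suc (Suc ?m)" "m' < Suc (Suc ?m)" "reals s'' ''Z'' m = a k" "reals s'' ''Z'' m' = b k l" by (simp_all add: Z)
      then show ?thesis by (intro conjI exI[of _ m, OF conjI] exI[of _ m', OF conjI])
    qed
    then show ?thesis unfolding I_def ms using that(4) m by simp
  qed
  have "wp list_events (\<lambda>t s'. t \<le> N * (N * 150 + 30) + 20 \<and> I N 0 s') s"
    unfolding list_events_def
    apply (simp only: wp_Seq wp_IAssign)
    apply (rule wp_For[where I = "\<lambda>i. I i 0" and N = N and B = "N * 150 + 15"])
        apply simp
       apply (simp add: I_def)
      apply (simp add: sameD N)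
    subgoal for i s1
      apply (rule wp_For[where I = "I i" and N = N and B = 130])
          apply simp
         apply (simp add: I_def)
        apply (simp add: sameD N)
      subgoal for j s2
        apply (simp add: crossx_def)
        apply (rule stepI[of i j s2])
            apply assumption+
         apply (simp)
        apply (simp add: a_def b_def crossx_def sameD)
        done
      subgoal for t s2
        by (simp add: I_def less_Suc_eq add_ac)
      done
    subgoal for t s1
      by (simp add: algebra_simps)
    done
  then show ?thesis
  proof (rule wp_same)
    fix t s' assume a: "t \<le> N * (N * 150 + 30) + 20 \<and> I N 0 s'" and sm: "same (writes list_events) s s'"
    have I: "(\<exists>m<2 * (N * N). reals s' ''Z'' m = a k) \<and> (\<exists>m<2 * (N * N). reals s' ''Z'' m = b k l)" if "k < N" "l < N" for k l
      using a that unfolding I_def by (metis add_0_right)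
    show "Q t s'"
    proof (rule Q)
      show "t \<le> N * (N * 150 + 30) + 20" "ints s' ''M'' 0 = 2 * (N * N)" using a by (auto simp: I_def)
      show "reals s ''x'' k + reals s ''sg'' k * reals s ''r'' 0 \<in> reals s' ''Z'' ` {..<2 * (N * N)}" if "k < N" for k
        using I[OF that that] by (auto simp: a_def image_iff Bex_def)
      show "rval (crossx (IConst k) (IConst l)) s \<in> reals s' ''Z'' ` {..<2 * (N * N)}" if "k < N" "l < N" for k l
        using I[OF that] by (auto simp: b_def image_iff Bex_def)
    qed (rule sm)
  qed
qed

text \<open>The machine cannot halve a natural number, so the binary searches use a table.\<close>

definition halve :: com where
  "halve = For ''i'' (V ''M'') (IAssign ''half'' (IAdd (V ''i'') (V ''i'')) (V ''i'') ;;
     IAssign ''half'' (IAdd (IAdd (V ''i'') (V ''i'')) (IConst 1)) (V ''i''))"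

lemma wp_halve:
  assumes M: "ints s ''M'' 0 = M"
    and Q: "\<And>t s'. t \<le> 40 * M + 10 \<Longrightarrow> same (writes halve) s s' \<Longrightarrow> (\<And>h. h < 2 * M \<Longrightarrow> ints s' ''half'' h = h div 2) \<Longrightarrow> Q t s'"
  shows "wp halve Q s"
  unfolding halve_def
  apply (rule wp_For[where I = "\<lambda>k s'. \<forall>h<2 * k. ints s' ''half'' h = h div 2" and N = M and B = 25])
      apply simp
     apply simp
    apply (simp add: sameD M)
  subgoal for k s'
    apply (simp add: mult_2[symmetric])
    done
  by (rule Q) (simp_all add: halve_def)

text \<open>Selection sort that drops duplicates; \<open>R\<close> receives one representative for each position relative to the
  sorted values \<open>W\<close>.  The assignment to \<open>W\<close> beyond its end makes the last gap an ordinary one.\<close>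

definition sort_values :: com where
  "sort_values = ''m'' ::= IConst 0 ;;
    For ''i'' (V ''z'')
     (''b'' ::= V ''z'' ;;
      For ''k'' (V ''z'')
       (Cond (BAnd (BNot (BAnd (ILess (IConst 0) (V ''m''))
                               (BNot (RLess (RCell ''W'' (ISub (V ''m'') (IConst 1))) (RCell ''Z'' (V ''k''))))))
                   (BNot (BAnd (ILess (V ''b'') (V ''z'')) (BNot (RLess (RCell ''Z'' (V ''k'')) (RCell ''Z'' (V ''b'')))))))
          (''b'' ::= V ''k'') Skip) ;;
      Cond (ILess (V ''b'') (V ''z''))
        (RAssign ''W'' (V ''m'') (RCell ''Z'' (V ''b'')) ;; IAssign ''ord'' (V ''m'') (V ''b'') ;; incr ''m'') Skip) ;;
    RAssign ''W'' (V ''m'') (RAdd (RCell ''W'' (ISub (V ''m'') (IConst 1))) (RConst 2)) ;;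
    ''R'' ::=r RSub (RV ''W'') (RConst 1) ;;
    For ''i'' (V ''m'')
     (RAssign ''R'' (IAdd (IAdd (V ''i'') (V ''i'')) (IConst 1)) (RCell ''W'' (V ''i'')) ;;
      RAssign ''R'' (IAdd (IAdd (V ''i'') (V ''i'')) (IConst 2))
        (RDiv (RAdd (RCell ''W'' (V ''i'')) (RCell ''W'' (IAdd (V ''i'') (IConst 1)))) (RConst 2)))"

text \<open>Gaps are represented by midpoints; the artificial last entry puts the top one at
  \<open>W (m - 1) + 1\<close>. Without values the line is a single gap, and any real represents
  position \<open>0\<close>.\<close>

lemma representatives_pos:
  fixes W R :: "nat \<Rightarrow> real"
  assumes inc: "\<And>s t. s < t \<Longrightarrow> t < m \<Longrightarrow> W s < W t" and last: "0 < m \<Longrightarrow> W m = W (m - 1) + 2"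
    and R: "0 < m \<Longrightarrow> R 0 = W 0 - 1" "\<And>t. t < m \<Longrightarrow> R (2 * t + 1) = W t" "\<And>t. t < m \<Longrightarrow> R (2 * t + 2) = (W t + W (t + 1)) / 2"
    and j: "j \<le> 2 * m"
  shows "pos (W ` {..<m}) (R j) = j"
proof (cases "m = 0")
  case True
  then show ?thesis using j by (simp add: pos_def)
next
  case False
  have inj: "inj_on W {..<m}"
    by (rule inj_onI) (metis inc lessThan_iff less_irrefl linorder_neqE_nat)
  consider "j = 0" | t where "t < m" "j = 2 * t + 1" | t where "t < m" "j = 2 * t + 2"
  proof -
    have "j = 0 \<or> j = 2 * ((j - 1) div 2) + 1 \<or> j = 2 * ((j - 2) div 2) + 2" by presburger
    moreover have "(j - 1) div 2 < m" "(j - 2) div 2 < m" using j False by auto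
    ultimately show ?thesis using that by blast
  qed
  then show ?thesis
  proof cases
    case 1
    have "R 0 < W t" if "t < m" for t
      using inc[of 0 t] that R(1) False by (cases "t = 0") auto
    then have "{v \<in> W ` {..<m}. v < R 0} = {}" "R 0 \<notin> W ` {..<m}" by (force simp: not_less)+
    then show ?thesis using 1 by (simp add: pos_def)
  next
    case (2 t)
    then show ?thesis using pos_sorted[of m W t] inc R(2) by simp
  next
    case (3 t)
    have tt: "W t < W (t + 1)"
    proof (cases "t + 1 < m")
      case True
      then show ?thesis using inc[of t "t + 1"] by simp
    next
      case False
      then have "t + 1 = m" using 3 by simp
      then have "W (t + 1) = W t + 2" using last by auto
      then show ?thesis by simp
    qed
    have low: "W s < R j" if "s \<le> t" for s
      using inc[of s t] that 3 tt R(3)[of t] by (cases "s = t") auto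
    have high: "R j < W s" if "t < s" "s < m" for s
      using inc[of "t + 1" s] that 3 tt R(3)[of t] by (cases "s = t + 1") auto
    have "{v \<in> W ` {..<m}. v < R j} = W ` {..t}"
      using low high 3 by (force simp: not_less not_le)
    moreover have "R j \<notin> W ` {..<m}" using low high by (force simp: not_less)
    moreover have "card (W ` {..t}) = t + 1" using inj 3 by (subst card_image) (auto intro: inj_on_subset)
    ultimately show ?thesis using 3 by (simp add: pos_def)
  qed
qed

text \<open>After \<open>i\<close> rounds: every input is selected already or exceeds all selected
  values. The final disjunction says that either each round found a new value or the input is
  exhausted.\<close>

definition selected :: "nat \<Rightarrow> (nat \<Rightarrow> real) \<Rightarrow> nat \<Rightarrow> nat \<Rightarrow> (nat \<Rightarrow> real) \<Rightarrow> (nat \<Rightarrow> nat) \<Rightarrow> bool" where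
  "selected z Z i m W ord \<longleftrightarrow> m \<le> i \<and> (\<forall>s t. s < t \<longrightarrow> t < m \<longrightarrow> W s < W t) \<and> (\<forall>t<m. ord t < z \<and> Z (ord t) = W t) \<and>
     (\<forall>l<z. (\<exists>t<m. W t = Z l) \<or> (\<forall>t<m. W t < Z l)) \<and> (m = i \<or> (\<forall>l<z. \<exists>t<m. W t = Z l))"

lemma last_is_max:
  fixes W :: "nat \<Rightarrow> real"
  assumes "\<forall>s t. s < t \<longrightarrow> t < m \<longrightarrow> W s < W t" "m = 0 \<or> W (m - 1) < y" "t < m"
  shows "W t < y"
proof (cases "t = m - 1")
  case False
  then have "t < m - 1" using assms(3) by simp
  then have "W t < W (m - 1)" using assms(1,3) by simp
  then show ?thesis using assms(2,3) by auto
qed (use assms in auto)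

text \<open>The new value is the least one not yet selected. Its existence shows that the input was
  not exhausted, so that \<open>m = i\<close>.\<close>

lemma selected_add:
  assumes S: "selected z Z i m W ord" and b: "b < z" "m = 0 \<or> W (m - 1) < Z b"
    and min: "\<And>l. l < z \<Longrightarrow> m = 0 \<or> W (m - 1) < Z l \<Longrightarrow> Z b \<le> Z l"
  shows "selected z Z (Suc i) (Suc m) (W(m := Z b)) (ord(m := b))"
proof -
  have inc: "\<forall>s t. s < t \<longrightarrow> t < m \<longrightarrow> W s < W t" using S by (simp add: selected_def)
  have below: "W t < Z b" if "t < m" for t using last_is_max[OF inc b(2) that] .
  have "\<not> (\<exists>t<m. W t = Z b)" using below less_irrefl by metis
  then have "m = i" using S b(1) unfolding selected_def by blast
  moreover have "(\<exists>t<Suc m. (W(m := Z b)) t = Z l) \<or> (\<forall>t<Suc m. (W(m := Z b)) t < Z l)" if l: "l < z" for l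
  proof -
    have "(\<exists>t<m. W t = Z l) \<or> (\<forall>t<m. W t < Z l)" using S l unfolding selected_def by blast
    then show ?thesis
    proof
      assume "\<exists>t<m. W t = Z l"
      then show ?thesis by (metis fun_upd_other less_SucI less_irrefl)
    next
      assume lt: "\<forall>t<m. W t < Z l"
      then have "Z b \<le> Z l" by (intro min[OF l]) (cases m; simp)
      then show ?thesis
      proof (cases "Z b = Z l")
        case True
        then show ?thesis by (intro disjI1 exI[of _ m]) simp
      next
        case False
        then show ?thesis using lt \<open>Z b \<le> Z l\<close> by (simp add: less_Suc_eq)
      qed
    qed
  qed
  ultimately show ?thesis using S below b(1) unfolding selected_def by (simp add: less_Suc_eq)
qed

lemma selected_skip:
  assumes S: "selected z Z i m W ord" and n: "\<And>l. l < z \<Longrightarrow> \<not> (m = 0 \<or> W (m - 1) < Z l)"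
  shows "selected z Z (Suc i) m W ord"
proof -
  have "\<exists>t<m. W t = Z l" if l: "l < z" for l
  proof (rule ccontr)
    assume "\<not> (\<exists>t<m. W t = Z l)"
    then have "\<forall>t<m. W t < Z l" using S l unfolding selected_def by blast
    then show False using n[OF l] by auto
  qed
  then show ?thesis using S unfolding selected_def by simp
qed

text \<open>If the input were not exhausted after \<open>z\<close> rounds, each round would have
  added a new value; \<open>z\<close> distinct values out of at most \<open>z\<close> leave none
  out.\<close>

lemma selected_image:
  assumes S: "selected z Z z m W ord"
  shows "W ` {..<m} = Z ` {..<z}"
proof -
  have sub: "W ` {..<m} \<subseteq> Z ` {..<z}" using S unfolding selected_def by (metis image_subsetI lessThan_iff imageI)
  show ?thesis
  proof (cases "\<forall>l<z. \<exists>t<m. W t = Z l")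
    case True
    then have "Z ` {..<z} \<subseteq> W ` {..<m}" by (metis image_subsetI lessThan_iff imageI)
    then show ?thesis using sub by (rule equalityI[rotated])
  next
    case False
    then have m: "m = z" using S unfolding selected_def by blast
    have "inj_on W {..<m}"
      using S unfolding selected_def by (intro inj_onI) (metis lessThan_iff less_irrefl linorder_neqE_nat)
    then have "card (W ` {..<m}) = z" using m by (simp add: card_image)
    then have "card (Z ` {..<z}) \<le> card (W ` {..<m})" using card_image_le[of "{..<z}" Z] by simp
    then show ?thesis using sub card_seteq[of "Z ` {..<z}"] by simp
  qed
qed

lemma selected_0: "selected z Z 0 0 W ord"
  by (simp add: selected_def)

lemma wp_sort_values:
  assumes z: "ints s ''z'' 0 = z"
    and Q: "\<And>t s' m. t \<le> z * (z * 80 + 150) + 80 \<Longrightarrow> same (writes sort_values) s s' \<Longrightarrow> ints s' ''m'' 0 = m \<Longrightarrow> m \<le> z \<Longrightarrow>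
      (\<And>s t. s < t \<Longrightarrow> t < m \<Longrightarrow> reals s' ''W'' s < reals s' ''W'' t) \<Longrightarrow>
      reals s' ''W'' ` {..<m} = reals s ''Z'' ` {..<z} \<Longrightarrow>
      (\<And>t. t < m \<Longrightarrow> ints s' ''ord'' t < z \<and> reals s ''Z'' (ints s' ''ord'' t) = reals s' ''W'' t) \<Longrightarrow>
      (\<And>j. j \<le> 2 * m \<Longrightarrow> pos (reals s' ''W'' ` {..<m}) (reals s' ''R'' j) = j) \<Longrightarrow> Q t s'"
  shows "wp sort_values Q s"
proof -
  define Z where "Z = reals s ''Z''"
  define I where "I = (\<lambda>i (s'::state). selected z Z i (ints s' ''m'' 0) (reals s' ''W'') (ints s' ''ord''))"
  define ok where "ok = (\<lambda>(s'::state) l. ints s' ''m'' 0 = 0 \<or> reals s' ''W'' (ints s' ''m'' 0 - 1) < Z l)"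
  \<comment> \<open>The index \<open>z\<close>, beyond the input, signals that no candidate has been
    found.\<close>
  define J where "J = (\<lambda>s1 k (s'::state). ints s' ''b'' 0 = z \<and> (\<forall>l<k. \<not> ok s1 l) \<or>
     ints s' ''b'' 0 < z \<and> ok s1 (ints s' ''b'' 0) \<and> (\<forall>l<k. ok s1 l \<longrightarrow> Z (ints s' ''b'' 0) \<le> Z l))"
  define U where "U = (\<lambda>W ord m k (s'::state). ints s' ''m'' 0 = m \<and> reals s' ''W'' = W \<and> ints s' ''ord'' = ord \<and>
    (0 < m \<longrightarrow> reals s' ''R'' 0 = W 0 - 1) \<and> (\<forall>t<k. reals s' ''R'' (2 * t + 1) = W t \<and>
      reals s' ''R'' (2 * t + 2) = (W t + W (t + 1)) / 2))"
  have "wp sort_values (\<lambda>t s'. t \<le> z * (z * 80 + 150) + 80 \<and> (\<exists>m. ints s' ''m'' 0 = m \<and>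
      selected z Z z m (reals s' ''W'') (ints s' ''ord'') \<and>
      (0 < m \<longrightarrow> reals s' ''W'' m = reals s' ''W'' (m - 1) + 2) \<and> (0 < m \<longrightarrow> reals s' ''R'' 0 = reals s' ''W'' 0 - 1) \<and>
      (\<forall>t<m. reals s' ''R'' (2 * t + 1) = reals s' ''W'' t \<and>
      reals s' ''R'' (2 * t + 2) = (reals s' ''W'' t + reals s' ''W'' (t + 1)) / 2))) s"
    unfolding sort_values_def
    apply (simp only: wp_Seq wp_IAssign)
    apply (rule wp_For[where I = I and N = z and B = "z * 80 + 65"])
        apply simp
       apply (simp add: I_def selected_0)
      apply (simp add: sameD z)
     apply (simp only: wp_Seq wp_IAssign)
    subgoal for i s1
      apply (rule wp_For[where I = "J s1" and N = z and B = 40])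
          apply simp
         apply (simp add: J_def sameD z)
        apply (simp add: sameD z)
      subgoal for k s2
        apply (simp add: sameD z J_def ok_def Z_def[symmetric] less_Suc_eq)
        apply (auto simp: not_less)
        done
      subgoal premises prems for t s2
      proof -
        have m: "ints s2 ''m'' 0 = ints s1 ''m'' 0" "reals s2 ''W'' = reals s1 ''W''" "ints s2 ''ord'' = ints s1 ''ord''"
          "reals s2 ''Z'' = Z" "ints s2 ''z'' 0 = z" "ints s1 ''z'' 0 = z"
          using prems(6,2) by (simp_all add: sameD z Z_def)
        have S: "selected z Z i (ints s1 ''m'' 0) (reals s1 ''W'') (ints s1 ''ord'')" using prems(4) by (simp add: I_def)
        show ?thesis
        proof (cases "ints s2 ''b'' 0 < z")
          case True
          then have "ok s1 (ints s2 ''b'' 0)" "\<And>l. l < z \<Longrightarrow> ok s1 l \<Longrightarrow> Z (ints s2 ''b'' 0) \<le> Z l"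
            using prems(7) by (auto simp: J_def)
          then have "selected z Z (Suc i) (Suc (ints s1 ''m'' 0)) ((reals s1 ''W'')(ints s1 ''m'' 0 := Z (ints s2 ''b'' 0)))
              ((ints s1 ''ord'')(ints s1 ''m'' 0 := ints s2 ''b'' 0))"
            using True by (intro selected_add[OF S]) (auto simp: ok_def)
          then show ?thesis using True prems(5) by (simp add: m I_def)
        next
          case False
          then have "\<And>l. l < z \<Longrightarrow> \<not> ok s1 l" using prems(7) by (auto simp: J_def)
          then have "selected z Z (Suc i) (ints s1 ''m'' 0) (reals s1 ''W'') (ints s1 ''ord'')"
            by (intro selected_skip[OF S]) (auto simp: ok_def)
          then show ?thesis using False prems(5) by (simp add: m I_def)
        qed
      qed
      done
    apply (simp only: wp_Seq wp_IAssign wp_RAssign)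
    subgoal premises prems for t s1
    proof -
      define m where "m = ints s1 ''m'' 0"
      define W where "W = (reals s1 ''W'')(m := reals s1 ''W'' (m - 1) + 2)"
      have S: "selected z Z z m (reals s1 ''W'') (ints s1 ''ord'')" using prems(3) by (simp add: I_def m_def)
      have mz: "m \<le> z" using S by (simp add: selected_def)
      \<comment> \<open>The entry \<open>m\<close> lies just behind the selected values, so changing
        it preserves \<open>selected\<close>.\<close>
      have S2: "selected z Z z m W (ints s1 ''ord'')" using S unfolding selected_def W_def by auto
      have W2: "0 < m \<Longrightarrow> W m = W (m - 1) + 2" by (simp add: W_def)
      show ?thesis
        apply (rule wp_For[where I = "U W (ints s1 ''ord'') m" and N = m and B = 50])
            apply simp
           apply (simp add: U_def W_def m_def)
          apply (simp add: U_def)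
        subgoal for k s2
          by (auto simp: U_def less_Suc_eq mult_2)
        subgoal premises p for u s2
        proof -
          have "u \<le> m * 62 + 9" using p(1) by simp
          also have "\<dots> \<le> z * 62 + 9" using mz by simp
          finally have u: "u \<le> z * 62 + 9" .
          have "t \<le> z * (z * 80 + 77) + 9" using prems(1) by (simp add: algebra_simps)
          then have "t + u + 60 \<le> z * (z * 80 + 150) + 80" using u by (simp add: algebra_simps)
          moreover have "ints s2 ''m'' 0 = m" "reals s2 ''W'' = W" "ints s2 ''ord'' = ints s1 ''ord''"
            "0 < m \<longrightarrow> reals s2 ''R'' 0 = W 0 - 1" "\<forall>t<m. reals s2 ''R'' (2 * t + 1) = W t \<and>
              reals s2 ''R'' (2 * t + 2) = (W t + W (t + 1)) / 2" using p(3) by (simp_all add: U_def)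
          ultimately show ?thesis using S2 W2 by simp
        qed
        done
    qed
    done
  then show ?thesis
  proof (rule wp_same)
    fix t s' assume a: "t \<le> z * (z * 80 + 150) + 80 \<and> (\<exists>m. ints s' ''m'' 0 = m \<and>
      selected z Z z m (reals s' ''W'') (ints s' ''ord'') \<and>
      (0 < m \<longrightarrow> reals s' ''W'' m = reals s' ''W'' (m - 1) + 2) \<and> (0 < m \<longrightarrow> reals s' ''R'' 0 = reals s' ''W'' 0 - 1) \<and>
      (\<forall>t<m. reals s' ''R'' (2 * t + 1) = reals s' ''W'' t \<and>
      reals s' ''R'' (2 * t + 2) = (reals s' ''W'' t + reals s' ''W'' (t + 1)) / 2))" and sm: "same (writes sort_values) s s'"
    then obtain m where m: "ints s' ''m'' 0 = m" and S: "selected z Z z m (reals s' ''W'') (ints s' ''ord'')"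
      and W: "0 < m \<Longrightarrow> reals s' ''W'' m = reals s' ''W'' (m - 1) + 2"
      and R: "0 < m \<longrightarrow> reals s' ''R'' 0 = reals s' ''W'' 0 - 1"
        "\<forall>t<m. reals s' ''R'' (2 * t + 1) = reals s' ''W'' t \<and>
          reals s' ''R'' (2 * t + 2) = (reals s' ''W'' t + reals s' ''W'' (t + 1)) / 2" by (elim conjE exE) (rule that; simp)
    show "Q t s'"
    proof (rule Q[OF _ sm m])
      show inc: "reals s' ''W'' s < reals s' ''W'' t" if "s < t" "t < m" for s t using S that unfolding selected_def by blast
      show "pos (reals s' ''W'' ` {..<m}) (reals s' ''R'' j) = j" if j: "j \<le> 2 * m" for j
      proof (rule representatives_pos[OF inc W _ _ _ j])
        show "0 < m \<Longrightarrow> reals s' ''R'' 0 = reals s' ''W'' 0 - 1" using R(1) by blast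
        show "reals s' ''R'' (2 * t + 1) = reals s' ''W'' t"
          "reals s' ''R'' (2 * t + 2) = (reals s' ''W'' t + reals s' ''W'' (t + 1)) / 2" if "t < m" for t
          using R(2) that by blast+
      qed
      show "reals s' ''W'' ` {..<m} = reals s ''Z'' ` {..<z}" using selected_image[OF S] unfolding Z_def .
      show "t \<le> z * (z * 80 + 150) + 80" using a by (rule conjunct1)
      show "m \<le> z" using S unfolding selected_def by (rule conjunct1)
      show "ints s' ''ord'' t < z \<and> reals s ''Z'' (ints s' ''ord'' t) = reals s' ''W'' t" if "t < m" for t
        using S that unfolding selected_def Z_def by blast
    qed
  qed
qed

section \<open>Computing the columns\<close>

lemma writes_sort_values: "writes sort_values = {''m'', ''i'', ''b'', ''k'', ''W'', ''ord'', ''R''}"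
  by (auto simp: sort_values_def)

definition valE :: "iexp \<Rightarrow> rexp \<Rightarrow> rexp" where
  "valE k x = RAdd (RCell ''y'' k) (RMul (RCell ''sg'' k)
     (RSqrt (RSub (RMul (RV ''r'') (RV ''r'')) (RMul (RSub x (RCell ''x'' k)) (RSub x (RCell ''x'' k))))))"

definition presE :: "iexp \<Rightarrow> rexp \<Rightarrow> bexp" where
  "presE k x = BNot (RLess (RMul (RV ''r'') (RV ''r'')) (RMul (RSub x (RCell ''x'' k)) (RSub x (RCell ''x'' k))))"

definition onE :: "iexp \<Rightarrow> rexp \<Rightarrow> rexp \<Rightarrow> bexp" where
  "onE k x y =
     (let d = RAdd (RMul (RSub x (RCell ''x'' k)) (RSub x (RCell ''x'' k))) (RMul (RSub y (RCell ''y'' k)) (RSub y (RCell ''y'' k)));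
          q = RMul (RV ''r'') (RV ''r'')
      in BAnd (BNot (RLess d q)) (BNot (RLess q d)))"

text \<open>The sort runs again for each column and overwrites its result arrays, so the events are
  saved.\<close>

definition copy_columns :: com where
  "copy_columns = ''mx'' ::= V ''m'' ;;
    For ''i'' (V ''m'') (RAssign ''X'' (V ''i'') (RCell ''W'' (V ''i''))) ;;
    For ''i'' (IAdd (IAdd (V ''m'') (V ''m'')) (IConst 1)) (RAssign ''XR'' (V ''i'') (RCell ''R'' (V ''i'')))"

lemma wp_copy_columns:
  assumes m: "ints s ''m'' 0 = m"
    and Q: "\<And>t s'. t \<le> 100 * m + 100 \<Longrightarrow> same (writes copy_columns) s s' \<Longrightarrow> ints s' ''mx'' 0 = m \<Longrightarrow>
      (\<And>t. t < m \<Longrightarrow> reals s' ''X'' t = reals s ''W'' t) \<Longrightarrow>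
      (\<And>j. j \<le> 2 * m \<Longrightarrow> reals s' ''XR'' j = reals s ''R'' j) \<Longrightarrow> Q t s'"
  shows "wp copy_columns Q s"
proof -
  have "wp copy_columns (\<lambda>t s'. t \<le> 100 * m + 100 \<and> ints s' ''mx'' 0 = m \<and> (\<forall>t<m. reals s' ''X'' t = reals s ''W'' t) \<and>
      (\<forall>j<2 * m + 1. reals s' ''XR'' j = reals s ''R'' j)) s"
    unfolding copy_columns_def
    apply (simp only: wp_Seq wp_IAssign)
    apply (rule wp_For[where I = "\<lambda>k s'. \<forall>t<k. reals s' ''X'' t = reals s ''W'' t" and N = m and B = 10])
        apply simp
       apply simp
      apply (simp add: sameD m)
     apply (simp add: sameD m less_Suc_eq)
    subgoal for t s1
      apply (rule wp_For[where I = "\<lambda>k s'. \<forall>j<k. reals s' ''XR'' j = reals s ''R'' j" and N = "2 * m + 1" and B = 10])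
          apply simp
         apply simp
        apply (simp add: sameD m)
       apply (simp add: sameD m less_Suc_eq)
      apply (simp add: sameD m)
      done
    done
  then show ?thesis
    by (rule wp_same) (rule Q, simp_all)
qed

definition collect_arcs :: com where
  "collect_arcs = ''z'' ::= IConst 0 ;;
    For ''k'' (V ''nn'') (Cond (presE (V ''k'') (RV ''xi''))
      (RAssign ''Z'' (V ''z'') (valE (V ''k'') (RV ''xi'')) ;; IAssign ''id'' (V ''z'') (V ''k'') ;; incr ''z'') Skip)"

definition store_order :: com where
  "store_order = IAssign ''K'' (V ''c'') (V ''m'') ;;
    For ''i'' (V ''m'') (IAssign ''A'' (IAdd (V ''bs'') (V ''i'')) (ICell ''id'' (ICell ''ord'' (V ''i''))))"

definition store_cells :: com where
  "store_cells = For ''i'' (IAdd (IAdd (V ''m'') (V ''m'')) (IConst 1))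
     (RAssign ''YR'' (IAdd (V ''bs'') (V ''i'')) (RCell ''R'' (V ''i'')) ;;
      ''cnt'' ::= IConst 0 ;;
      For ''k'' (V ''nn'') (Cond (onE (V ''k'') (RV ''xi'') (RCell ''R'' (V ''i''))) (incr ''cnt'') Skip) ;;
      IAssign ''CNT'' (IAdd (V ''bs'') (V ''i'')) (V ''cnt''))"

text \<open>All columns get blocks of the same length \<open>2 * nn + 1\<close>, enough for a column
  with \<open>nn\<close> values. The machine cannot multiply natural numbers, so the start of a
  block is accumulated in \<open>bs\<close> and recorded in \<open>base\<close>.\<close>

definition column :: com where
  "column = ''xi'' ::=r RCell ''XR'' (V ''c'') ;; IAssign ''base'' (V ''c'') (V ''bs'') ;;
     collect_arcs ;; sort_values ;; store_order ;; store_cells ;;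
     ''bs'' ::= IAdd (V ''bs'') (IAdd (IAdd (V ''nn'') (V ''nn'')) (IConst 1))"

definition columns :: com where
  "columns = ''bs'' ::= IConst 0 ;; For ''c'' (IAdd (IAdd (V ''mx'') (V ''mx'')) (IConst 1)) column"

lemma wp_store_order:
  assumes m: "ints s ''m'' 0 = m"
    and Q: "\<And>t s'. t \<le> 40 * m + 30 \<Longrightarrow> same (writes store_order) s s' \<Longrightarrow>
      ints s' ''K'' = (ints s ''K'')(ints s ''c'' 0 := m) \<Longrightarrow>
      (\<And>t. t < m \<Longrightarrow> ints s' ''A'' (ints s ''bs'' 0 + t) = ints s ''id'' (ints s ''ord'' t)) \<Longrightarrow>
      (\<And>t. t < ints s ''bs'' 0 \<Longrightarrow> ints s' ''A'' t = ints s ''A'' t) \<Longrightarrow> Q t s'"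
  shows "wp store_order Q s"
proof -
  let ?b = "ints s ''bs'' 0"
  have "wp store_order (\<lambda>t s'. t \<le> 40 * m + 30 \<and> ints s' ''K'' = (ints s ''K'')(ints s ''c'' 0 := m) \<and>
      (\<forall>t<m. ints s' ''A'' (?b + t) = ints s ''id'' (ints s ''ord'' t)) \<and> (\<forall>t<?b. ints s' ''A'' t = ints s ''A'' t)) s"
    unfolding store_order_def
    apply (simp only: wp_Seq wp_IAssign)
    apply (rule wp_For[where I = "\<lambda>k s'. (\<forall>t<k. ints s' ''A'' (?b + t) = ints s ''id'' (ints s ''ord'' t)) \<and> (\<forall>t<?b. ints s' ''A'' t = ints s ''A'' t)" and N = m and B = 20])
        apply simp
       apply simp
      apply (simp add: sameD m)
     apply (simp add: sameD m less_Suc_eq)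
    apply (simp add: sameD m)
    done
  then show ?thesis
    by (rule wp_same) (rule Q, simp_all)
qed

context arcs
begin

definition arcmem :: "state \<Rightarrow> bool" where
  "arcmem s \<longleftrightarrow> ints s ''nn'' 0 = N \<and> reals s ''r'' 0 = r \<and>
     (\<forall>k<N. reals s ''x'' k = ax k \<and> reals s ''y'' k = ay k \<and> reals s ''sg'' k = sg k)"

lemma arcmem_same: "same U s s' \<Longrightarrow> {''nn'', ''r'', ''x'', ''y'', ''sg''} \<inter> U = {} \<Longrightarrow> arcmem s \<Longrightarrow> arcmem s'"
  by (simp add: arcmem_def sameD)

lemma arcmem_nn: "arcmem s \<Longrightarrow> ints s ''nn'' 0 = N"
  by (simp add: arcmem_def)

lemma rval_valE: "arcmem s \<Longrightarrow> ival k s < N \<Longrightarrow> rval (valE k x) s = val (ival k s) (rval x s)"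
  by (simp add: valE_def arcmem_def val_def)

lemma bval_presE: "arcmem s \<Longrightarrow> ival k s < N \<Longrightarrow> bval (presE k x) s = pres (ival k s) (rval x s)"
  by (simp add: presE_def arcmem_def pres_def not_less)

lemma bval_onE: "arcmem s \<Longrightarrow> ival k s < N \<Longrightarrow> bval (onE k x y) s = on (ival k s) (rval x s, rval y s)"
  by (auto simp: onE_def arcmem_def on_def Let_def)

lemma wp_collect_arcs:
  assumes a: "arcmem s"
    and Q: "\<And>t s' z. t \<le> 100 * N + 20 \<Longrightarrow> same (writes collect_arcs) s s' \<Longrightarrow> ints s' ''z'' 0 = z \<Longrightarrow> z \<le> N \<Longrightarrow>
      reals s' ''Z'' ` {..<z} = Vals (reals s ''xi'' 0) \<Longrightarrow>
      (\<And>l. l < z \<Longrightarrow> ints s' ''id'' l < N \<and> pres (ints s' ''id'' l) (reals s ''xi'' 0) \<and>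
         val (ints s' ''id'' l) (reals s ''xi'' 0) = reals s' ''Z'' l) \<Longrightarrow> Q t s'"
  shows "wp collect_arcs Q s"
proof -
  let ?x = "reals s ''xi'' 0"
  define I where "I = (\<lambda>k (s'::state). ints s' ''z'' 0 \<le> k \<and>
    (\<forall>l<ints s' ''z'' 0. ints s' ''id'' l < N \<and> pres (ints s' ''id'' l) ?x \<and> val (ints s' ''id'' l) ?x = reals s' ''Z'' l) \<and>
    (\<forall>j<k. pres j ?x \<longrightarrow> (\<exists>l<ints s' ''z'' 0. reals s' ''Z'' l = val j ?x)))"
  have nn: "ints s ''nn'' 0 = N" using a by (rule arcmem_nn)
  have "wp collect_arcs (\<lambda>t s'. t \<le> 100 * N + 20 \<and> I N s') s"
    unfolding collect_arcs_def
    apply (simp only: wp_Seq wp_IAssign)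
    apply (rule wp_For[where I = I and N = N and B = 80])
        apply simp
       apply (simp add: I_def)
      apply (simp add: sameD nn)
    subgoal premises prems for k s1
    proof -
      have a1: "arcmem s1" using prems(2) by (rule arcmem_same) (use a in \<open>simp_all add: arcmem_def\<close>)
      have x: "reals s1 ''xi'' 0 = ?x" using prems(2) by (simp add: sameD)
      have p: "bval (presE (V ''k'') (RV ''xi'')) s1 = pres k ?x"
        using bval_presE[OF a1, of "V ''k''"] prems(1,3) x by simp
      have v: "rval (valE (V ''k'') (RV ''xi'')) s1 = val k ?x"
        using rval_valE[OF a1, of "V ''k''"] prems(1,3) x by simp
      have I: "I k s1" using prems(4) .
      show ?thesis
      proof (cases "pres k ?x")
        case True
        define s2 where "s2 = istore ''k'' 0 (Suc k) (istore ''z'' 0 (ints s1 ''z'' 0 + 1) (istore ''id'' (ints s1 ''z'' 0) k (rstore ''Z'' (ints s1 ''z'' 0) (val k ?x) s1)))"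
        have s2: "ints s2 ''z'' 0 = Suc (ints s1 ''z'' 0)" "ints s2 ''id'' = (ints s1 ''id'')(ints s1 ''z'' 0 := k)"
          "reals s2 ''Z'' = (reals s1 ''Z'')(ints s1 ''z'' 0 := val k ?x)" by (simp_all add: s2_def)
        have "I (Suc k) s2"
          unfolding I_def
        proof (intro conjI allI impI)
          fix j assume j: "j < Suc k" "pres j ?x"
          show "\<exists>l<ints s2 ''z'' 0. reals s2 ''Z'' l = val j ?x"
          proof (cases "j = k")
            case True
            then show ?thesis by (intro exI[of _ "ints s1 ''z'' 0"]) (simp add: s2)
          next
            case False
            then have "\<exists>l<ints s1 ''z'' 0. reals s1 ''Z'' l = val j ?x" using I j unfolding I_def by (simp add: less_Suc_eq)
            then obtain l where "l < ints s1 ''z'' 0" "reals s1 ''Z'' l = val j ?x" by blast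
            then show ?thesis by (intro exI[of _ l]) (simp add: s2)
          qed
        qed (use I prems(1) True in \<open>auto simp: I_def s2 less_Suc_eq\<close>)
        then show ?thesis using True p v prems(3) by (simp add: s2_def presE_def valE_def)
      next
        case False
        have "I (Suc k) (istore ''k'' 0 (Suc k) s1)"
          using I False unfolding I_def by (auto simp: less_Suc_eq)
        then show ?thesis using False p by (simp add: presE_def)
      qed
    qed
    apply (simp add: I_def)
    done
  then show ?thesis
  proof (rule wp_same)
    fix t s' assume a: "t \<le> 100 * N + 20 \<and> I N s'" and sm: "same (writes collect_arcs) s s'"
    then have I: "I N s'" by blast
    show "Q t s'"
    proof (rule Q[OF _ sm refl])
      show "reals s' ''Z'' ` {..<ints s' ''z'' 0} = Vals ?x"
      proof (intro equalityI subsetI)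
        fix v assume "v \<in> reals s' ''Z'' ` {..<ints s' ''z'' 0}"
        then obtain l where "l < ints s' ''z'' 0" "v = reals s' ''Z'' l" by auto
        then show "v \<in> Vals ?x" using I unfolding I_def Vals_def by (intro image_eqI[of _ _ "ints s' ''id'' l"]) auto
      next
        fix v assume "v \<in> Vals ?x"
        then obtain k where k: "k < N" "pres k ?x" "v = val k ?x" by (auto simp: Vals_def)
        then obtain l where "l < ints s' ''z'' 0" "reals s' ''Z'' l = val k ?x" using I unfolding I_def by blast
        then show "v \<in> reals s' ''Z'' ` {..<ints s' ''z'' 0}" using k by (intro image_eqI[of _ _ l]) auto
      qed
      show "t \<le> 100 * N + 20" using a by blast
      show "ints s' ''z'' 0 \<le> N" using I by (simp add: I_def)
      show "\<And>l. l < ints s' ''z'' 0 \<Longrightarrow> ints s' ''id'' l < N \<and> pres (ints s' ''id'' l) ?x \<and> val (ints s' ''id'' l) ?x = reals s' ''Z'' l"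
        using I unfolding I_def by blast
    qed
  qed
qed

lemma wp_store_cells:
  assumes a: "arcmem s" and m: "ints s ''m'' 0 = m"
    and Q: "\<And>t s'. t \<le> (2 * m + 1) * (N * 100 + 60) + 40 \<Longrightarrow> same (writes store_cells) s s' \<Longrightarrow>
      (\<And>j. j \<le> 2 * m \<Longrightarrow> reals s' ''YR'' (ints s ''bs'' 0 + j) = reals s ''R'' j \<and>
         ints s' ''CNT'' (ints s ''bs'' 0 + j) = card (Sg (reals s ''xi'' 0, reals s ''R'' j))) \<Longrightarrow>
      (\<And>j. j < ints s ''bs'' 0 \<Longrightarrow> reals s' ''YR'' j = reals s ''YR'' j \<and> ints s' ''CNT'' j = ints s ''CNT'' j) \<Longrightarrow> Q t s'"
  shows "wp store_cells Q s"
proof -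
  let ?b = "ints s ''bs'' 0"
  define P where "P = (\<lambda>j. (reals s ''xi'' 0, reals s ''R'' j))"
  define I where "I = (\<lambda>k (s'::state). (\<forall>j<k. reals s' ''YR'' (?b + j) = reals s ''R'' j \<and>
         ints s' ''CNT'' (?b + j) = card (Sg (P j))) \<and>
         (\<forall>j<?b. reals s' ''YR'' j = reals s ''YR'' j \<and> ints s' ''CNT'' j = ints s ''CNT'' j))"
  have nn: "ints s ''nn'' 0 = N" using a by (rule arcmem_nn)
  have "wp store_cells (\<lambda>t s'. t \<le> (2 * m + 1) * (N * 100 + 60) + 40 \<and> I (2 * m + 1) s') s"
    unfolding store_cells_def
    apply (rule wp_For[where I = I and N = "2 * m + 1" and B = "N * 100 + 37"])
        apply simp
       apply (simp add: I_def)
      apply (simp add: sameD m)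
    subgoal for i s1
      apply (simp only: wp_Seq wp_IAssign wp_RAssign)
      apply (rule wp_For[where I = "\<lambda>k s'. ints s' ''cnt'' 0 = card {l. l < k \<and> on l (P i)}" and N = N and B = 85])
          apply simp
         apply simp
        apply (simp add: sameD nn)
      subgoal premises prems for k s2
      proof -
        have s12: "same (writes store_cells) s s2"
          using prems(2) prems(6) by (auto simp: same_def store_cells_def)
        then have a2: "arcmem s2" by (rule arcmem_same) (use a in \<open>simp_all add: store_cells_def\<close>)
        have "reals s2 ''xi'' 0 = reals s ''xi'' 0" "reals s2 ''R'' = reals s ''R''" "ints s2 ''i'' 0 = i"
          using s12 prems(3,6) by (simp_all add: sameD store_cells_def)
        then have o: "bval (onE (V ''k'') (RV ''xi'') (RCell ''R'' (V ''i''))) s2 = on k (P i)"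
          using bval_onE[OF a2, of "V ''k''"] prems(5,7) by (simp add: P_def)
        have "{l. l < Suc k \<and> on l (P i)} = (if on k (P i) then insert k {l. l < k \<and> on l (P i)} else {l. l < k \<and> on l (P i)})"
          by (auto simp: less_Suc_eq)
        then show ?thesis using o prems(8) by (simp add: onE_def Let_def)
      qed
      subgoal premises prems for t s2
      proof -
        have R: "reals s1 ''R'' = reals s ''R''" "ints s1 ''bs'' = ints s ''bs''"
          using prems(2) by (simp_all add: sameD)
        have s2: "reals s2 ''YR'' = (reals s1 ''YR'')(?b + i := reals s ''R'' i)" "ints s2 ''CNT'' = ints s1 ''CNT''" "ints s2 ''i'' 0 = i"
          "ints s2 ''bs'' = ints s ''bs''"
          using prems(6,3) R by (simp_all add: sameD)
        have "ints s2 ''cnt'' 0 = card (Sg (P i))" using prems(7) by (simp add: Sg_def)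
        then show ?thesis using prems(4,5) s2 by (simp add: I_def less_Suc_eq algebra_simps)
      qed
      done
    subgoal for t s1 by (simp add: algebra_simps)
    done
  then show ?thesis
    by (rule wp_same) (rule Q, simp_all add: I_def P_def)
qed

text \<open>Everything is claimed at the single representative abscissa of the column, where the
  program has computed it.\<close>

definition colOK :: "state \<Rightarrow> nat \<Rightarrow> bool" where
  "colOK s c \<longleftrightarrow> (let b = c * (2 * N + 1); K = ints s ''K'' c; x = reals s ''XR'' c; A = (\<lambda>t. ints s ''A'' (b + t)) in
     ints s ''base'' c = b \<and> K \<le> N \<and> (\<forall>t<K. A t < N \<and> pres (A t) x) \<and>
     (\<forall>s t. s < t \<longrightarrow> t < K \<longrightarrow> val (A s) x < val (A t) x) \<and> (\<lambda>t. val (A t) x) ` {..<K} = Vals x \<and>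
     (\<forall>j\<le>2 * K. pos (Vals x) (reals s ''YR'' (b + j)) = j \<and> ints s ''CNT'' (b + j) = card (Sg (x, reals s ''YR'' (b + j)))))"

lemma wp_column:
  assumes a: "arcmem s" and c: "ints s ''c'' 0 = c" and bs: "ints s ''bs'' 0 = c * (2 * N + 1)"
    and ok: "\<And>d. d < c \<Longrightarrow> colOK s d"
    and Q: "\<And>t s'. t \<le> N * N * 280 + N * 750 + 400 \<Longrightarrow> same (writes column) s s' \<Longrightarrow> ints s' ''bs'' 0 = Suc c * (2 * N + 1) \<Longrightarrow>
      (\<And>d. d < Suc c \<Longrightarrow> colOK s' d) \<Longrightarrow> Q t s'"
  shows "wp column Q s"
  unfolding column_def
  apply (simp only: wp_Seq wp_IAssign wp_RAssign)
  apply (rule wp_collect_arcs)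
   apply (rule arcmem_same[OF _ _ a, of "{''xi'', ''base''}"])
    apply (simp add: same_def)
   apply simp
  subgoal for t1 s1 z
    apply (rule wp_sort_values[of _ z])
     apply assumption
    subgoal for t2 s2 m
      apply (rule wp_store_order[of _ m])
       apply assumption
      subgoal for t3 s3
        apply (rule wp_store_cells[of _ m])
        subgoal premises prems
          by (rule arcmem_same[OF prems(16) _ arcmem_same[OF prems(8) _ arcmem_same[OF prems(2) _
               arcmem_same[OF _ _ a, of "{''xi'', ''base''}"]]]]) (simp_all add: same_def collect_arcs_def writes_sort_values store_order_def)
         apply (simp add: sameD store_order_def)
        subgoal premises prems for t4 s4
        proof -
          let ?x = "reals s ''XR'' c"
          define b0 where "b0 = c * (2 * N + 1)"
          note bs0 = bs[folded b0_def]
          note sm1 = sameD[OF prems(2)] and sm2 = sameD[OF prems(8)] and sm3 = sameD[OF prems(16)] and sm4 = sameD[OF prems(21)]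
          note wr = collect_arcs_def writes_sort_values store_order_def store_cells_def
          let ?U = "writes column"
          have "same ?U s s1" by (rule same_trans[OF _ same_mono[OF prems(2)]]) (auto simp: column_def same_def)
          then have "same ?U s s2" by (rule same_trans[OF _ same_mono[OF prems(8)]]) (auto simp: column_def)
          then have "same ?U s s3" by (rule same_trans[OF _ same_mono[OF prems(16)]]) (auto simp: column_def)
          then have w: "same ?U s s4" by (rule same_trans[OF _ same_mono[OF prems(21)]]) (auto simp: column_def)
          have xi: "reals s1 ''xi'' 0 = ?x" "reals s2 ''xi'' 0 = ?x" "reals s3 ''xi'' 0 = ?x"
            by (simp_all add: sm1 sm2 sm3 wr c)
          have b: "ints s2 ''bs'' 0 = b0" "ints s3 ''bs'' 0 = b0" "ints s4 ''bs'' 0 = b0" "ints s2 ''c'' 0 = c"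
            by (simp_all add: sm1 sm2 sm3 sm4 wr c bs0)
          have XR: "reals s4 ''XR'' = reals s ''XR''" by (simp add: sm1 sm2 sm3 sm4 wr)
          have base: "ints s4 ''base'' = (ints s ''base'')(c := b0)" by (simp add: sm1 sm2 sm3 sm4 wr c bs0)
          have K: "ints s4 ''K'' = (ints s ''K'')(c := m)" using prems(17) b by (simp add: sm1 sm2 sm4 wr)
          have A4: "ints s4 ''A'' = ints s3 ''A''" "ints s2 ''A'' = ints s ''A''" by (simp_all add: sm1 sm2 sm4 wr)
          have A: "ints s4 ''A'' (b0 + t) = ints s1 ''id'' (ints s2 ''ord'' t)" if "t < m" for t
            using prems(18)[OF that] b by (simp add: A4 sm2 wr)
          have Aold: "ints s4 ''A'' j = ints s ''A'' j" if "j < b0" for j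
            using prems(19)[of j] b A4 that by simp
          have R: "reals s3 ''R'' = reals s2 ''R''" by (simp add: sm3 wr)
          have YR: "reals s4 ''YR'' (b0 + j) = reals s2 ''R'' j" "ints s4 ''CNT'' (b0 + j) = card (Sg (?x, reals s2 ''R'' j))" if "j \<le> 2 * m" for j
            using prems(22)[OF that] b xi R by simp_all
          have "reals s3 ''YR'' = reals s ''YR''" "ints s3 ''CNT'' = ints s ''CNT''" by (simp_all add: sm1 sm2 sm3 wr)
          then have YRold: "reals s4 ''YR'' j = reals s ''YR'' j" "ints s4 ''CNT'' j = ints s ''CNT'' j" if "j < b0" for j
            using prems(23)[of j] b that by simp_all
          have z: "z \<le> N" "m \<le> z" using prems(4,10) by auto
          have old: "colOK s4 d" if d: "d < c" for d
          proof -
            \<comment> \<open>The block of an earlier column ends before \<open>b0\<close>, and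
              \<open>''A''\<close>, \<open>''YR''\<close> and \<open>''CNT''\<close> are unchanged
              below \<open>b0\<close>.\<close>
            define e where "e = d * (2 * N + 1)"
            have "e + j < b0" if "j \<le> 2 * N" for j
            proof -
              have "Suc d * (2 * N + 1) \<le> c * (2 * N + 1)" using d by (intro mult_le_mono1) simp
              then show ?thesis using that by (simp add: b0_def e_def)
            qed
            then have i: "ints s4 ''A'' (e + j) = ints s ''A'' (e + j)"
              "reals s4 ''YR'' (e + j) = reals s ''YR'' (e + j)"
              "ints s4 ''CNT'' (e + j) = ints s ''CNT'' (e + j)" if "j \<le> 2 * N" for j
              using Aold YRold that by blast+
            have K4: "ints s4 ''K'' d = ints s ''K'' d" "ints s4 ''base'' d = ints s ''base'' d" using d by (simp_all add: K base)
            have o: "colOK s d" using ok[OF d] .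
            then have KN: "ints s ''K'' d \<le> N" by (simp add: colOK_def Let_def)
            have At: "ints s4 ''A'' (e + t) = ints s ''A'' (e + t)" if "t < ints s ''K'' d" for t
              using i(1)[of t] that KN by simp
            have Im: "(\<lambda>t. val (ints s4 ''A'' (e + t)) (reals s ''XR'' d)) ` {..<ints s ''K'' d} =
               (\<lambda>t. val (ints s ''A'' (e + t)) (reals s ''XR'' d)) ` {..<ints s ''K'' d}"
              by (rule image_cong) (simp_all add: At)
            have Yt: "reals s4 ''YR'' (e + j) = reals s ''YR'' (e + j)"
              "ints s4 ''CNT'' (e + j) = ints s ''CNT'' (e + j)" if "j \<le> 2 * ints s ''K'' d" for j
              using i(2,3)[of j] that KN by simp_all
            show ?thesis
              using o unfolding colOK_def Let_def e_def[symmetric] K4 XR Im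
              by (intro conjI) (simp_all add: At Yt)
          qed
          have srt: "reals s2 ''W'' u = val (ints s4 ''A'' (b0 + u)) ?x" "ints s4 ''A'' (b0 + u) < N" "pres (ints s4 ''A'' (b0 + u)) ?x" if "u < m" for u
          proof -
            have o: "ints s2 ''ord'' u < z" "reals s1 ''Z'' (ints s2 ''ord'' u) = reals s2 ''W'' u" using prems(13)[OF that] by auto
            have "ints s1 ''id'' (ints s2 ''ord'' u) < N \<and> pres (ints s1 ''id'' (ints s2 ''ord'' u)) ?x \<and>
              val (ints s1 ''id'' (ints s2 ''ord'' u)) ?x = reals s1 ''Z'' (ints s2 ''ord'' u)"
              using prems(6)[OF o(1)] by (simp add: c)
            then show "reals s2 ''W'' u = val (ints s4 ''A'' (b0 + u)) ?x" "ints s4 ''A'' (b0 + u) < N" "pres (ints s4 ''A'' (b0 + u)) ?x"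
              using o(2) A[OF that] by auto
          qed
          have im: "(\<lambda>u. val (ints s4 ''A'' (b0 + u)) ?x) ` {..<m} = reals s2 ''W'' ` {..<m}"
            by (rule image_cong) (simp_all add: srt(1))
          have V: "reals s2 ''W'' ` {..<m} = Vals ?x" using prems(12,5) by (simp add: c)
          have new: "colOK s4 c"
            unfolding colOK_def Let_def XR b0_def[symmetric]
          proof (intro conjI allI impI)
            show "ints s4 ''base'' c = b0" by (simp add: base)
            show "ints s4 ''K'' c \<le> N" using z by (simp add: K)
            show "ints s4 ''A'' (b0 + u) < N" "pres (ints s4 ''A'' (b0 + u)) ?x" if "u < ints s4 ''K'' c" for u
              using srt(2,3)[of u] that by (simp_all add: K)
            show "val (ints s4 ''A'' (b0 + v)) ?x < val (ints s4 ''A'' (b0 + u)) ?x" if "v < u" "u < ints s4 ''K'' c" for u v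
            proof -
              have "u < m" "v < m" using that by (simp_all add: K)
              then show ?thesis using prems(11)[OF that(1)] srt(1)[of u] srt(1)[of v] by simp
            qed
            show "(\<lambda>t. val (ints s4 ''A'' (b0 + t)) ?x) ` {..<ints s4 ''K'' c} = Vals ?x" using im V by (simp add: K)
            fix j assume "j \<le> 2 * ints s4 ''K'' c"
            then have j: "j \<le> 2 * m" by (simp add: K)
            show "pos (Vals ?x) (reals s4 ''YR'' (b0 + j)) = j" using prems(14)[OF j] V by (simp add: YR(1)[OF j])
            show "ints s4 ''CNT'' (b0 + j) = card (Sg (?x, reals s4 ''YR'' (b0 + j)))" by (simp add: YR[OF j])
          qed
          let ?s5 = "istore ''bs'' 0 (b0 + (N + N + 1)) s4"
          have nn: "ints s4 ''nn'' 0 = N" using a by (simp add: arcmem_def sm1 sm2 sm3 sm4 wr)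
          have ok5: "colOK ?s5 d" if "d < Suc c" for d
          proof -
            have "colOK s4 d" using old new that by (cases "d = c") auto
            then show ?thesis by (simp add: colOK_def Let_def)
          qed
          have zz: "z * z \<le> N * N" using z by (intro mult_le_mono)
          have mN: "m \<le> N" using z by simp
          have t2: "t2 \<le> 80 * (N * N) + 150 * N + 80" using prems(7) zz z by (simp add: algebra_simps)
          have t3: "t3 \<le> 40 * N + 30" using prems(15) mN by simp
          have "(2 * m + 1) * (N * 100 + 60) \<le> (2 * N + 1) * (N * 100 + 60)" using mN by (intro mult_le_mono1) simp
          then have t4: "t4 \<le> 200 * (N * N) + 220 * N + 100" using prems(20) by (simp add: algebra_simps)
          have s5: "same ?U s ?s5" using w by (rule same_trans) (simp add: same_def column_def)
          have st: "istore ''bs'' (ival (IConst 0) s4) (ival (IAdd (V ''bs'') (IAdd (IAdd (V ''nn'') (V ''nn'')) (IConst 1))) s4) s4 = ?s5"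
            by (simp add: b nn)
          show ?thesis
            unfolding st
          proof (rule Q[OF _ s5])
            show "ints ?s5 ''bs'' 0 = Suc c * (2 * N + 1)" by (simp add: b0_def)
            show "colOK ?s5 d" if "d < Suc c" for d using ok5[OF that] .
          qed (use prems(1) t2 t3 t4 in \<open>simp add: algebra_simps\<close>)
        qed
        done
      done
    done
  done

lemma wp_columns:
  assumes a: "arcmem s" and m: "ints s ''mx'' 0 = m"
    and Q: "\<And>t s'. t \<le> (2 * m + 1) * (N * N * 280 + N * 750 + 420) + 30 \<Longrightarrow> same (writes columns) s s' \<Longrightarrow>
      (\<And>d. d \<le> 2 * m \<Longrightarrow> colOK s' d) \<Longrightarrow> Q t s'"
  shows "wp columns Q s"
proof -
  define I where "I = (\<lambda>c s'. ints s' ''bs'' 0 = c * (2 * N + 1) \<and> (\<forall>d<c. colOK s' d))"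
  have cc: "colOK (istore ''c'' 0 j s') d = colOK s' d" for j s' d by (simp add: colOK_def Let_def)
  have "wp columns (\<lambda>t s'. t \<le> (2 * m + 1) * (N * N * 280 + N * 750 + 420) + 30 \<and> (\<forall>d<2 * m + 1. colOK s' d)) s"
    unfolding columns_def
    apply (simp only: wp_Seq wp_IAssign)
    apply (rule wp_For[where I = I and N = "2 * m + 1" and B = "N * N * 280 + N * 750 + 400"])
        apply (simp add: column_def collect_arcs_def writes_sort_values store_order_def store_cells_def)
       apply (simp add: I_def)
      apply (simp add: sameD m column_def collect_arcs_def writes_sort_values store_order_def store_cells_def)
    subgoal for c s1
      apply (rule wp_column[of s1 c])
          apply (rule arcmem_same[OF _ _ a, of "insert ''c'' (writes columns)"])
           apply (auto simp: same_def columns_def)[1]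
          apply (simp add: columns_def column_def collect_arcs_def writes_sort_values store_order_def store_cells_def)
         apply assumption
        apply (simp add: I_def)
       apply (simp add: I_def)
      apply (simp add: I_def cc)
      done
    subgoal for t s1 by (simp add: I_def algebra_simps)
    done
  then show ?thesis
    by (rule wp_same) (rule Q, simp_all)
qed

end

section \<open>Uniting the cells\<close>

text \<open>\<open>par c\<close> is the parent plus one, so that the initial memory content \<open>0\<close> marks a root.\<close>

definition union_find :: "nat \<Rightarrow> (nat \<Rightarrow> nat) \<Rightarrow> (nat \<Rightarrow> nat) \<Rightarrow> (nat \<Rightarrow> nat) \<Rightarrow> bool" where
  "union_find C par rk rep \<longleftrightarrow> (\<forall>c<C. rep c < C \<and> par (rep c) = 0 \<and> (par c = 0 \<longrightarrow> rep c = c) \<and>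
     (0 < par c \<longrightarrow> par c - 1 < C \<and> rep (par c - 1) = rep c \<and> rk c < rk (par c - 1)) \<and>
     rk c \<le> rk (rep c) \<and> 2 ^ rk (rep c) \<le> card {d. d < C \<and> rep d = rep c})"

lemma union_findD:
  assumes "union_find C par rk rep" "c < C"
  shows "rep c < C" "par (rep c) = 0" "par c = 0 \<Longrightarrow> rep c = c"
    "0 < par c \<Longrightarrow> par c - 1 < C" "0 < par c \<Longrightarrow> rep (par c - 1) = rep c" "0 < par c \<Longrightarrow> rk c < rk (par c - 1)"
    "rk c \<le> rk (rep c)" "2 ^ rk (rep c) \<le> card {d. d < C \<and> rep d = rep c}"
  using assms unfolding union_find_def by blast+

lemma union_find_init: "union_find C (\<lambda>_. 0) (\<lambda>_. 0) (\<lambda>c. c)"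
proof -
  have "{d. d < C \<and> d = c} = {c}" if "c < C" for c using that by auto
  then show ?thesis by (simp add: union_find_def)
qed

text \<open>A root of rank \<open>k\<close> has a class of at least \<open>2 ^ k\<close> elements.
  The rank grows only when the ranks are equal, and then the union contains two classes of size at
  least \<open>2 ^ rk u\<close>.\<close>

lemma union_find_link:
  assumes U: "union_find C par rk rep" and uv: "u < C" "v < C" "rep u = u" "rep v = v" "u \<noteq> v"
    and r: "rk v < rk u \<and> rk' = rk \<or> rk v = rk u \<and> rk' = rk(u := Suc (rk u))"
  shows "union_find C (par(v := Suc u)) rk' (\<lambda>c. if rep c = v then u else rep c)"
  unfolding union_find_def
proof (intro allI impI conjI)
  fix c assume c: "c < C"
  note D = union_findD[OF U]
  let ?p = "par(v := Suc u)" and ?r = "\<lambda>c. if rep c = v then u else rep c"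
  have rk: "rk d \<le> rk' d" for d using r by auto
  have rkn: "rk' d = rk d" if "d \<noteq> u" for d using r that by auto
  have pu: "par u = 0" "par v = 0" using D(2)[OF uv(1)] D(2)[OF uv(2)] uv by auto
  show "?r c < C" using D(1)[OF c] uv by simp
  show "?p (?r c) = 0" using D(2)[OF c] pu uv by simp
  show "?r c = c" if "?p c = 0"
  proof -
    have "c \<noteq> v" "rep c = c" using that D(3)[OF c] by (auto split: if_splits)
    then show ?thesis by simp
  qed
  show "?p c - 1 < C" if "0 < ?p c" using that D(4)[OF c] uv by (cases "c = v") auto
  show "?r (?p c - 1) = ?r c" if "0 < ?p c" using that D(5)[OF c] uv by (cases "c = v") auto
  show "rk' c < rk' (?p c - 1)" if p: "0 < ?p c"
  proof (cases "c = v")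
    case True
    then show ?thesis using r uv by auto
  next
    case False
    then have "rk c < rk (par c - 1)" "c \<noteq> u" using p D(6)[OF c] pu by auto
    then show ?thesis using False rkn[of c] rk[of "par c - 1"] by simp
  qed
  show "rk' c \<le> rk' (?r c)"
  proof (cases "c = u")
    case True
    then show ?thesis using uv by simp
  next
    case False
    then have "rk' c \<le> rk (rep c)" using rkn D(7)[OF c] by simp
    then show ?thesis using r rk[of u] rk[of "rep c"] by (cases "rep c = v") auto
  qed
  show "2 ^ rk' (?r c) \<le> card {d. d < C \<and> ?r d = ?r c}"
  proof (cases "rep c = u \<or> rep c = v")
    case True
    have "{d. d < C \<and> ?r d = u} = {d. d < C \<and> rep d = u} \<union> {d. d < C \<and> rep d = v}" using uv by auto
    moreover have "card ({d. d < C \<and> rep d = u} \<union> {d. d < C \<and> rep d = v}) = card {d. d < C \<and> rep d = u} + card {d. d < C \<and> rep d = v}"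
      using uv by (intro card_Un_disjoint) auto
    moreover have "2 ^ rk u \<le> card {d. d < C \<and> rep d = u}" "2 ^ rk v \<le> card {d. d < C \<and> rep d = v}"
      using D(8)[OF uv(1)] D(8)[OF uv(2)] uv by simp_all
    ultimately have sum: "2 ^ rk u + 2 ^ rk v \<le> card {d. d < C \<and> ?r d = u}" by simp
    have "2 ^ rk' u \<le> (2 ^ rk u + 2 ^ rk v :: nat)" using r
    proof (elim disjE conjE)
      assume "rk v = rk u" "rk' = rk(u := Suc (rk u))"
      then show ?thesis by simp
    qed simp
    then have "2 ^ rk' u \<le> card {d. d < C \<and> ?r d = u}" using sum by (rule le_trans)
    moreover have "?r c = u" using True by auto
    ultimately show ?thesis by simp
  next
    case False
    then have "{d. d < C \<and> ?r d = ?r c} = {d. d < C \<and> rep d = rep c}" "rk' (?r c) = rk (rep c)" using rkn by auto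
    then show ?thesis using D(8)[OF c] by simp
  qed
qed

section \<open>Climbing and linking on the machine\<close>

lemma istore_istore: "istore a i v (istore a i w s) = istore a i v s"
  by (simp add: istore_def)

lemma istore_id: "ints s a i = v \<Longrightarrow> istore a i v s = s"
  by (simp add: istore_def fun_upd_idem)

definition go_to_root :: "string \<Rightarrow> com" where
  "go_to_root v = While (ILess (IConst 0) (ICell ''par'' (V v))) (v ::= ISub (ICell ''par'' (V v)) (IConst 1))"

text \<open>Ranks increase along the path, and a root of rank \<open>k\<close> needs
  \<open>2 ^ k\<close> elements, so at most \<open>L\<close> steps are made. A step costs 13 and the
  failing test at the root 6.\<close>

lemma wp_go_to_root:
  assumes U: "union_find C (ints s ''par'') (ints s ''rk'') rep" and c: "ints s v 0 < C"
    and v: "v \<noteq> ''par''" "v \<noteq> ''rk''" and L: "\<And>k. 2 ^ k \<le> C \<Longrightarrow> k \<le> L"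
    and Q: "\<And>t. t \<le> 13 * L + 6 \<Longrightarrow> Q t (istore v 0 (rep (ints s v 0)) s)"
  shows "wp (go_to_root v) Q s"
proof -
  \<comment> \<open>\<open>l\<close> bounds the difference between the rank of the root and the
    present rank, which every step lowers.\<close>
  have loop: "wp (go_to_root v) (\<lambda>t s''. t \<le> 13 * l + 6 \<and> s'' = istore v 0 (rep (ints s' v 0)) s') s'"
    if "union_find C (ints s' ''par'') (ints s' ''rk'') rep" "ints s' v 0 < C"
      "ints s' ''rk'' (rep (ints s' v 0)) \<le> ints s' ''rk'' (ints s' v 0) + l" for l s'
    using that
  proof (induction l arbitrary: s')
    case (0 s')
    note D = union_findD[OF 0(1,2)]
    have p: "ints s' ''par'' (ints s' v 0) = 0"
    proof (rule ccontr)
      assume "ints s' ''par'' (ints s' v 0) \<noteq> 0"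
      then have g: "0 < ints s' ''par'' (ints s' v 0)" by simp
      show False using union_findD(7)[OF 0(1) D(4)[OF g]] D(5)[OF g] D(6)[OF g] 0(3) by simp
    qed
    then show ?case using D(3) unfolding go_to_root_def by (subst wp_While) (simp add: istore_id)
  next
    case (Suc l s')
    note D = union_findD[OF Suc.prems(1,2)]
    show ?case
    proof (cases "ints s' ''par'' (ints s' v 0) = 0")
      case True
      then show ?thesis using D(3) unfolding go_to_root_def by (subst wp_While) (simp add: istore_id)
    next
      case False
      then have g: "0 < ints s' ''par'' (ints s' v 0)" by simp
      define c' where "c' = ints s' ''par'' (ints s' v 0) - 1"
      let ?s = "istore v 0 c' s'"
      have "wp (go_to_root v) (\<lambda>t s''. t \<le> 13 * l + 6 \<and> s'' = istore v 0 (rep (ints ?s v 0)) ?s) ?s"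
      proof (rule Suc.IH)
        show "union_find C (ints ?s ''par'') (ints ?s ''rk'') rep" using Suc.prems(1) v by simp
        show "ints ?s v 0 < C" using D(4)[OF g] by (simp add: c'_def)
        show "ints ?s ''rk'' (rep (ints ?s v 0)) \<le> ints ?s ''rk'' (ints ?s v 0) + l"
          using D(5,6)[OF g] Suc.prems(3) v by (simp add: c'_def)
      qed
      then have "wp (go_to_root v) (\<lambda>t s''. 13 + t \<le> 13 * Suc l + 6 \<and> s'' = istore v 0 (rep (ints s' v 0)) s') ?s"
        by (rule wp_mono) (use D(5)[OF g] in \<open>auto simp: istore_istore c'_def\<close>)
      then show ?thesis using g unfolding go_to_root_def
        by (subst wp_While) (simp add: c'_def)
    qed
  qed
  have "2 ^ ints s ''rk'' (rep (ints s v 0)) \<le> card {d. d < C \<and> rep d = rep (ints s v 0)}" using union_findD(8)[OF U c] .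
  also have "\<dots> \<le> card {..<C}" by (intro card_mono) auto
  finally have "2 ^ ints s ''rk'' (rep (ints s v 0)) \<le> C" by simp
  then have "ints s ''rk'' (rep (ints s v 0)) \<le> L" by (rule L)
  then have "wp (go_to_root v) (\<lambda>t s''. t \<le> 13 * L + 6 \<and> s'' = istore v 0 (rep (ints s v 0)) s) s"
    by (intro loop U c) simp
  then show ?thesis by (rule wp_mono) (use Q in auto)
qed

definition unite :: com where
  "unite = ''u'' ::= V ''u0'' ;; go_to_root ''u'' ;; ''v'' ::= V ''v0'' ;; go_to_root ''v'' ;;
     Cond (BAnd (BNot (ILess (V ''u'') (V ''v''))) (BNot (ILess (V ''v'') (V ''u'')))) Skip
      (Cond (ILess (ICell ''rk'' (V ''u'')) (ICell ''rk'' (V ''v'')))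
        (IAssign ''par'' (V ''u'') (IAdd (V ''v'') (IConst 1)))
        (IAssign ''par'' (V ''v'') (IAdd (V ''u'') (IConst 1)) ;;
         Cond (ILess (ICell ''rk'' (V ''v'')) (ICell ''rk'' (V ''u''))) Skip
           (IAssign ''rk'' (V ''u'') (IAdd (ICell ''rk'' (V ''u'')) (IConst 1)))))"

lemma writes_unite: "writes unite = {''u'', ''v'', ''par'', ''rk''}"
  by (auto simp: unite_def go_to_root_def)

text \<open>Soundness is stated for a fixed equivalence \<open>F\<close>, so that the equivalence closure of the edges processed so far is
  not needed.\<close>

definition joined :: "nat \<Rightarrow> (nat \<Rightarrow> nat \<Rightarrow> bool) \<Rightarrow> (nat \<Rightarrow> nat \<Rightarrow> bool) \<Rightarrow> (nat \<times> nat) set \<Rightarrow> state \<Rightarrow> bool" where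
  "joined C F adj D s \<longleftrightarrow> (\<exists>rep. union_find C (ints s ''par'') (ints s ''rk'') rep \<and>
     (\<forall>c<C. \<forall>d<C. rep c = rep d \<longrightarrow> F c d) \<and> (\<forall>(c, d)\<in>D. c < C \<longrightarrow> d < C \<longrightarrow> adj c d \<longrightarrow> rep c = rep d))"

lemma joined_cong: "ints s ''par'' = ints s' ''par'' \<Longrightarrow> ints s ''rk'' = ints s' ''rk'' \<Longrightarrow> joined C F adj D s \<longleftrightarrow> joined C F adj D s'"
  by (simp add: joined_def)

text \<open>Merging two classes stays within \<open>F\<close>, because the two given elements are
  related and \<open>F\<close> is an equivalence. The two climbs account for
  \<open>26 * L\<close>.\<close>

lemma wp_unite:
  assumes J: "joined C F adj D s" and uv: "ints s ''u0'' 0 < C" "ints s ''v0'' 0 < C"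
    and L: "\<And>k. 2 ^ k \<le> C \<Longrightarrow> k \<le> L"
    and F: "equivp F" "F (ints s ''u0'' 0) (ints s ''v0'' 0)"
    and Q: "\<And>t s'. t \<le> 26 * L + 100 \<Longrightarrow> same (writes unite) s s' \<Longrightarrow>
      joined C F adj (insert (ints s ''u0'' 0, ints s ''v0'' 0) D) s' \<Longrightarrow> Q t s'"
  shows "wp unite Q s"
proof -
  obtain rep where U: "union_find C (ints s ''par'') (ints s ''rk'') rep"
    and S: "\<And>c d. c < C \<Longrightarrow> d < C \<Longrightarrow> rep c = rep d \<Longrightarrow> F c d"
    and A: "\<And>c d. (c, d) \<in> D \<Longrightarrow> c < C \<Longrightarrow> d < C \<Longrightarrow> adj c d \<Longrightarrow> rep c = rep d"
    using J unfolding joined_def by blast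
  define u0 v0 where "u0 = ints s ''u0'' 0" and "v0 = ints s ''v0'' 0"
  define u v where "u = rep u0" and "v = rep v0"
  note D = union_findD[OF U]
  have u: "u < C" "rep u = u" "u0 < C" using D(1)[OF uv(1)] D(2)[OF uv(1)] D(3) uv by (auto simp: u_def u0_def)
  have v: "v < C" "rep v = v" "v0 < C" using D(1)[OF uv(2)] D(2)[OF uv(2)] D(3) uv by (auto simp: v_def v0_def)
  have Fs: "F c d \<Longrightarrow> F d c" and Ft: "F c d \<Longrightarrow> F d e \<Longrightarrow> F c e" for c d e
    using F(1) by (auto elim: equivpE dest: sympD transpD)
  have Fuv: "F u v"
  proof -
    have "F u u0" "F v0 v" using S u v by (auto simp: u_def v_def)
    then show ?thesis using F(2) Ft unfolding u0_def v0_def by blast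
  qed
  \<comment> \<open>\<open>a\<close> is the remaining root and \<open>b\<close> the one attached to
    it; which of \<open>u\<close> and \<open>v\<close> is which depends on the ranks.\<close>
  have link: "joined C F adj (insert (u0, v0) D) s'"
    if U': "union_find C (ints s' ''par'') (ints s' ''rk'') (\<lambda>c. if rep c = b then a else rep c)"
      and ab: "a = u \<and> b = v \<or> a = v \<and> b = u" for s' a b
  proof -
    have Fab: "F a b" "F b a" using ab Fuv Fs by auto
    have abC: "a < C" "b < C" "rep a = a" "rep b = b" using ab u v by auto
    let ?r = "\<lambda>c. if rep c = b then a else rep c"
    have "F c d" if cd: "c < C" "d < C" "?r c = ?r d" for c d
    proof -
      have ca: "F c (?r c)" if c: "c < C" for c
      proof (cases "rep c = b")
        case True
        then have "F c b" using S[OF c abC(2)] abC by simp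
        then have "F c a" by (rule Ft[OF _ Fab(2)])
        then show ?thesis using True by simp
      next
        case False
        have "rep (rep c) = rep c" using D(1)[OF c] D(2)[OF c] D(3) by blast
        then show ?thesis using S[OF c D(1)[OF c]] False by simp
      qed
      have "F c (?r d)" by (rule subst[OF cd(3), of "F c"]) (rule ca[OF cd(1)])
      then show ?thesis by (rule Ft[OF _ Fs[OF ca[OF cd(2)]]])
    qed
    moreover have "?r u0 = ?r v0" using ab by (auto simp: u_def v_def)
    moreover have "?r c = ?r d" if "(c, d) \<in> insert (u0, v0) D" "c < C" "d < C" "adj c d" for c d
      using that(1)
    proof (rule insertE)
      assume "(c, d) = (u0, v0)"
      then have "c = u0" "d = v0" by simp_all
      then show ?thesis using \<open>?r u0 = ?r v0\<close> by (simp only:)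
    next
      assume "(c, d) \<in> D"
      from A[OF this that(2-4)] show ?thesis by simp
    qed
    ultimately show ?thesis unfolding joined_def using U' by blast
  qed
  have "wp unite (\<lambda>t s'. t \<le> 26 * L + 100 \<and> joined C F adj (insert (u0, v0) D) s') s"
    unfolding unite_def
    apply (simp only: wp_Seq wp_IAssign)
    apply (rule wp_go_to_root[OF _ _ _ _ L, of C _ rep])
         apply (simp add: U)
        apply (simp add: uv)
       apply simp
      apply simp
     apply assumption
    apply (rule wp_go_to_root[OF _ _ _ _ L, of C _ rep])
         apply (simp add: U)
        apply (simp add: uv)
       apply simp
      apply simp
     apply assumption
    subgoal premises prems for t1 t2
    proof -
      define s2 where "s2 = istore ''v'' 0 v (istore ''u'' 0 u s)"
      have s2: "ints s2 ''u'' 0 = u" "ints s2 ''v'' 0 = v" "ints s2 ''par'' = ints s ''par''" "ints s2 ''rk'' = ints s ''rk''"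
        by (simp_all add: s2_def)
      consider "u = v" | "u \<noteq> v" "ints s ''rk'' u < ints s ''rk'' v" | "u \<noteq> v" "ints s ''rk'' v < ints s ''rk'' u" | "u \<noteq> v" "ints s ''rk'' v = ints s ''rk'' u"
        by linarith
      then show ?thesis
      proof cases
        case 1
        then have "joined C F adj (insert (u0, v0) D) s2"
          unfolding joined_def s2 using U S A by (intro exI[of _ rep]) (auto simp: u_def v_def)
        then show ?thesis using 1 prems
          by (auto simp: s2_def istore_istore u_def[symmetric] v_def[symmetric] u0_def[symmetric] v0_def[symmetric])
      next
        case 2
        then have "union_find C ((ints s ''par'')(u := Suc v)) (ints s ''rk'') (\<lambda>c. if rep c = u then v else rep c)"
          by (intro union_find_link[OF U]) (use u v in auto)
        then have "joined C F adj (insert (u0, v0) D) (istore ''par'' u (Suc v) s2)"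
          by (intro link[of _ u v]) (simp_all add: s2)
        moreover have "(\<not> u < v \<and> \<not> v < u) = False" using 2(1) by auto
        ultimately show ?thesis using 2 prems
          by (auto simp: s2_def istore_istore u_def[symmetric] v_def[symmetric] u0_def[symmetric] v0_def[symmetric])
      next
        case 3
        then have "union_find C ((ints s ''par'')(v := Suc u)) (ints s ''rk'') (\<lambda>c. if rep c = v then u else rep c)"
          by (intro union_find_link[OF U]) (use u v in auto)
        then have "joined C F adj (insert (u0, v0) D) (istore ''par'' v (Suc u) s2)"
          by (intro link[of _ v u]) (simp_all add: s2)
        moreover have "(\<not> u < v \<and> \<not> v < u) = False" using 3(1) by auto
        ultimately show ?thesis using 3 prems
          by (auto simp: s2_def istore_istore u_def[symmetric] v_def[symmetric] u0_def[symmetric] v0_def[symmetric])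
      next
        case 4
        then have "union_find C ((ints s ''par'')(v := Suc u)) ((ints s ''rk'')(u := Suc (ints s ''rk'' u))) (\<lambda>c. if rep c = v then u else rep c)"
          by (intro union_find_link[OF U]) (use u v in auto)
        then have "joined C F adj (insert (u0, v0) D) (istore ''rk'' u (Suc (ints s ''rk'' u)) (istore ''par'' v (Suc u) s2))"
          by (intro link[of _ v u]) (simp_all add: s2)
        moreover have "(\<not> u < v \<and> \<not> v < u) = False" using 4(1) by auto
        ultimately show ?thesis using 4 prems
          by (auto simp: s2_def istore_istore u_def[symmetric] v_def[symmetric] u0_def[symmetric] v0_def[symmetric])
      qed
    qed
    done
  then show ?thesis
    by (rule wp_same) (rule Q, simp_all add: u0_def v0_def)
qed

text \<open>\<open>a\<close> and \<open>b\<close> are the two counts of \<open>sides_iff\<close>,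
  obtained by evaluating the arcs of the slab at the abscissa of the line.\<close>

definition join_cell :: com where
  "join_cell = ''yy'' ::=r RCell ''YR'' (V ''u0'') ;; ''a'' ::= IConst 0 ;; ''b'' ::= IConst 0 ;;
     For ''k'' (ICell ''K'' (V ''cs''))
      (''vv'' ::=r valE (ICell ''A'' (IAdd (V ''bs'') (V ''k''))) (RV ''xi'') ;;
       Cond (RLess (RV ''vv'') (RV ''yy'')) (incr ''a'') Skip ;;
       Cond (RLess (RV ''yy'') (RV ''vv'')) Skip (incr ''b'')) ;;
     For ''j'' (IAdd (IAdd (ICell ''K'' (V ''cs'')) (ICell ''K'' (V ''cs''))) (IConst 1))
      (''v0'' ::= IAdd (V ''bs'') (V ''j'') ;;
       Cond (BAnd (BAnd (BNot (ILess (V ''j'') (IAdd (V ''a'') (V ''a'')))) (BNot (ILess (IAdd (V ''b'') (V ''b'')) (V ''j''))))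
            (BAnd (BNot (ILess (ICell ''CNT'' (V ''u0'')) (ICell ''CNT'' (V ''v0'')))) (BNot (ILess (ICell ''CNT'' (V ''v0'')) (ICell ''CNT'' (V ''u0''))))))
         unite Skip)"

lemma writes_join_cell: "writes join_cell = {''yy'', ''a'', ''b'', ''k'', ''vv'', ''j'', ''v0'', ''u'', ''v'', ''par'', ''rk''}"
  by (auto simp: join_cell_def writes_unite)

text \<open>Lines are the odd columns, and by \<open>closure_colset_iff\<close> line
  \<open>p\<close> borders exactly the columns \<open>2 * p\<close> and
  \<open>2 * p + 2\<close>.\<close>

definition build_graph :: com where
  "build_graph = For ''p'' (V ''mx'')
    (''cl'' ::= IAdd (IAdd (V ''p'') (V ''p'')) (IConst 1) ;; ''bl'' ::= ICell ''base'' (V ''cl'') ;;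
     ''xi'' ::=r RCell ''X'' (V ''p'') ;;
     For ''side'' (IConst 2)
      (''cs'' ::= IAdd (IAdd (V ''p'') (V ''p'')) (IAdd (V ''side'') (V ''side'')) ;; ''bs'' ::= ICell ''base'' (V ''cs'') ;;
       For ''i'' (IAdd (IAdd (ICell ''K'' (V ''cl'')) (ICell ''K'' (V ''cl''))) (IConst 1))
        (''u0'' ::= IAdd (V ''bl'') (V ''i'') ;; join_cell)))"

lemma rcost_valE: "rcost (valE k x) = 4 * icost k + 2 * rcost x + 16"
  by (simp add: valE_def)

lemma card_less_Suc: "card {t. t < Suc k \<and> P t} = card {t. t < k \<and> P t} + (if P k then 1 else 0)"
proof -
  have "{t. t < Suc k \<and> P t} = (if P k then insert k {t. t < k \<and> P t} else {t. t < k \<and> P t})"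
    by (auto simp: less_Suc_eq)
  then show ?thesis by simp
qed

context arcs
begin

lemma wp_join_cell:
  assumes a: "arcmem s" and u0: "ints s ''u0'' 0 = u0" "u0 < C" and bs: "ints s ''bs'' 0 = b"
    and K: "ints s ''K'' (ints s ''cs'' 0) = K" "K \<le> N"
    and A: "\<And>t. t < K \<Longrightarrow> ints s ''A'' (b + t) < N"
    and bC: "\<And>j. j \<le> 2 * K \<Longrightarrow> b + j < C"
    and adj: "\<And>j. j \<le> 2 * K \<Longrightarrow> adj u0 (b + j) \<longleftrightarrow>
      2 * card {t. t < K \<and> val (ints s ''A'' (b + t)) (reals s ''xi'' 0) < reals s ''YR'' u0} \<le> j \<and>
      j \<le> 2 * card {t. t < K \<and> val (ints s ''A'' (b + t)) (reals s ''xi'' 0) \<le> reals s ''YR'' u0} \<and>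
      ints s ''CNT'' u0 = ints s ''CNT'' (b + j)"
    and F: "equivp F" "\<And>c d. adj c d \<Longrightarrow> F c d"
    and L: "\<And>k. 2 ^ k \<le> C \<Longrightarrow> k \<le> L"
    and J: "joined C F adj D s"
    and Q: "\<And>t s'. t \<le> N * 100 + (2 * N + 1) * (26 * L + 200) + 60 \<Longrightarrow> same (writes join_cell) s s' \<Longrightarrow>
      joined C F adj (D \<union> {u0} \<times> (\<lambda>j. b + j) ` {..<2 * K + 1}) s' \<Longrightarrow> Q t s'"
  shows "wp join_cell Q s"
proof -
  let ?x = "reals s ''xi'' 0" and ?y = "reals s ''YR'' u0"
  define v where "v = (\<lambda>t. val (ints s ''A'' (b + t)) ?x)"
  define I where "I = (\<lambda>k (s'::state). ints s' ''a'' 0 = card {t. t < k \<and> v t < ?y} \<and> ints s' ''b'' 0 = card {t. t < k \<and> v t \<le> ?y})"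
  have "wp join_cell (\<lambda>t s'. t \<le> N * 100 + (2 * N + 1) * (26 * L + 200) + 60 \<and>
      joined C F adj (D \<union> {u0} \<times> (\<lambda>j. b + j) ` {..<2 * K + 1}) s') s"
    unfolding join_cell_def
    apply (simp only: wp_Seq wp_IAssign wp_RAssign)
    apply (rule wp_For[where I = I and N = K and B = 75])
        apply simp
       apply (simp add: I_def)
      apply (simp add: sameD K)
    subgoal premises prems for k s1
    proof -
      have sm: "same (writes join_cell) s s1"
        by (rule same_trans[OF _ same_mono[OF prems(2)]]) (auto simp: same_def writes_join_cell)
      have a1: "arcmem s1" by (rule arcmem_same[OF sm _ a]) (simp add: writes_join_cell)
      have s1: "reals s1 ''xi'' 0 = ?x" "ints s1 ''A'' = ints s ''A''" "ints s1 ''bs'' 0 = b" "reals s1 ''yy'' 0 = ?y"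
        using prems(2) sm by (simp_all add: sameD writes_join_cell bs u0)
      have v: "rval (valE (ICell ''A'' (IAdd (V ''bs'') (V ''k''))) (RV ''xi'')) s1 = v k"
        using rval_valE[OF a1, of "ICell ''A'' (IAdd (V ''bs'') (V ''k''))"] A[OF prems(1)] prems(3) s1 by (simp add: v_def)
      show ?thesis
        using prems(3,4) s1(4) by (cases rule: linorder_cases[of "v k" ?y]) (simp_all add: v I_def card_less_Suc rcost_valE)
    qed
    subgoal premises prems for t s1
    proof -
      define A where "A = card {t. t < K \<and> v t < ?y}"
      define B where "B = card {t. t < K \<and> v t \<le> ?y}"
      have ab: "ints s1 ''a'' 0 = A" "ints s1 ''b'' 0 = B" using prems(3) by (simp_all add: I_def A_def B_def)
      have adj': "adj u0 (b + j) \<longleftrightarrow> 2 * A \<le> j \<and> j \<le> 2 * B \<and> ints s ''CNT'' u0 = ints s ''CNT'' (b + j)" if "j \<le> 2 * K" for j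
        using adj[OF that] by (simp add: A_def B_def v_def)
      have sm: "same (writes join_cell) s s1"
        by (rule same_trans[OF _ same_mono[OF prems(2)]]) (auto simp: same_def writes_join_cell)
      have J1: "joined C F adj D s1"
        using J by (rule iffD1[OF joined_cong, rotated 2]) (use prems(2) in \<open>simp_all add: sameD\<close>)
      have jc: "joined C F adj E (istore w 0 i s') \<longleftrightarrow> joined C F adj E s'" if "w \<noteq> ''par''" "w \<noteq> ''rk''" for E i s' w
        using that by (intro joined_cong) simp_all
      show ?thesis
        apply (rule wp_For[where I = "\<lambda>k. joined C F adj (D \<union> {u0} \<times> (\<lambda>j. b + j) ` {..<k})" and N = "2 * K + 1" and B = "26 * L + 170"])
            apply (simp add: writes_unite)
           apply (simp add: jc J1)
        subgoal premises p for k s2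
        proof -
          have "ints s2 ''K'' = ints s ''K''" "ints s2 ''cs'' = ints s ''cs''"
            using same_trans[OF sm same_mono[OF p(2)]] by (simp_all add: sameD writes_unite writes_join_cell)
          then show ?thesis by (simp add: K)
        qed
        subgoal premises p for k s2
        proof -
          have sm2: "same (writes join_cell) s s2"
            by (rule same_trans[OF sm same_mono[OF p(2)]]) (auto simp: writes_unite writes_join_cell)
          have s2: "ints s2 ''bs'' 0 = b" "ints s2 ''u0'' 0 = u0" "ints s2 ''CNT'' = ints s ''CNT''"
            using sm2 by (simp_all add: sameD writes_join_cell bs u0)
          have s2': "ints s2 ''a'' 0 = A" "ints s2 ''b'' 0 = B"
            using p(2) ab by (simp_all add: sameD writes_unite)
          note s2 = s2 s2'
          have k: "k \<le> 2 * K" using p(1) by simp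
          have ins: "D \<union> {u0} \<times> (\<lambda>j. b + j) ` {..<Suc k} = insert (u0, b + k) (D \<union> {u0} \<times> (\<lambda>j. b + j) ` {..<k})"
            by (auto simp: lessThan_Suc)
          let ?s = "istore ''v0'' 0 (b + k) s2"
          show ?thesis
          proof (cases "adj u0 (b + k)")
            case True
            then have c: "2 * A \<le> k" "k \<le> 2 * B" "ints s ''CNT'' u0 = ints s ''CNT'' (b + k)" using adj'[OF k] by auto
            have "wp unite (\<lambda>t s'. t \<le> 26 * L + 100 \<and> joined C F adj (D \<union> {u0} \<times> (\<lambda>j. b + j) ` {..<Suc k}) s') ?s"
              by (rule wp_unite[of C F adj "D \<union> {u0} \<times> (\<lambda>j. b + j) ` {..<k}" ?s L])
                (use p(4) s2 u0 bC[OF k] L F True in \<open>auto simp: jc ins\<close>)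
            then have "wp unite (\<lambda>t s'. 45 + t \<le> 26 * L + 170 \<and> joined C F adj (D \<union> {u0} \<times> (\<lambda>j. b + j) ` {..<Suc k}) (istore ''j'' 0 (Suc k) s')) ?s"
              by (rule wp_mono) (simp add: jc)
            then show ?thesis using c p(3) s2 by simp
          next
            case False
            have "joined C F adj (D \<union> {u0} \<times> (\<lambda>j. b + j) ` {..<Suc k}) s2"
              using p(4) False unfolding ins joined_def by auto
            moreover have "\<not> (2 * A \<le> k \<and> k \<le> 2 * B \<and> ints s ''CNT'' u0 = ints s ''CNT'' (b + k))" using False adj'[OF k] by blast
            ultimately show ?thesis using p(3) s2 by (auto simp: jc)
          qed
        qed
        subgoal premises p for u s2
        proof -
          define P where "P = (2 * K + 1) * (26 * L + 200)"
          define P' where "P' = (2 * N + 1) * (26 * L + 200)"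
          have "P \<le> P'" unfolding P_def P'_def using K(2) by (intro mult_le_mono1) simp
          moreover have "u \<le> P + 5" using p(1) by (simp add: P_def algebra_simps)
          moreover have "t \<le> N * 100 + 20" using prems(1) K(2) by simp
          ultimately show ?thesis using p(3) unfolding P'_def[symmetric] by simp
        qed
        done
    qed
    done
  then show ?thesis
    by (rule wp_same) (rule Q, simp_all)
qed

definition cells_of :: "state \<Rightarrow> nat \<Rightarrow> nat set" where
  "cells_of s c = (\<lambda>i. c * (2 * N + 1) + i) ` {..<2 * ints s ''K'' c + 1}"

text \<open>This is the dominant cost: \<open>m\<close> lines, two sides, up to
  \<open>2 * N + 1\<close> cells on the line, as many in the slab, and a union with its
  \<open>26 * L\<close> for each pair.\<close>

lemma wp_build_graph:
  fixes m :: nat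
  defines "C \<equiv> (2 * m + 1) * (2 * N + 1)"
  assumes a: "arcmem s" and m: "ints s ''mx'' 0 = m" and X: "\<And>p. p < m \<Longrightarrow> reals s ''X'' p = X p"
    and base: "\<And>c. c \<le> 2 * m \<Longrightarrow> ints s ''base'' c = c * (2 * N + 1)"
    and K: "\<And>c. c \<le> 2 * m \<Longrightarrow> ints s ''K'' c \<le> N"
    and A: "\<And>c t. c \<le> 2 * m \<Longrightarrow> t < ints s ''K'' c \<Longrightarrow> ints s ''A'' (c * (2 * N + 1) + t) < N"
    and adj: "\<And>p c i j. p < m \<Longrightarrow> c = 2 * p \<or> c = 2 * p + 2 \<Longrightarrow> i \<le> 2 * ints s ''K'' (2 * p + 1) \<Longrightarrow> j \<le> 2 * ints s ''K'' c \<Longrightarrow>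
      adj ((2 * p + 1) * (2 * N + 1) + i) (c * (2 * N + 1) + j) \<longleftrightarrow>
      2 * card {t. t < ints s ''K'' c \<and> val (ints s ''A'' (c * (2 * N + 1) + t)) (X p) < reals s ''YR'' ((2 * p + 1) * (2 * N + 1) + i)} \<le> j \<and>
      j \<le> 2 * card {t. t < ints s ''K'' c \<and> val (ints s ''A'' (c * (2 * N + 1) + t)) (X p) \<le> reals s ''YR'' ((2 * p + 1) * (2 * N + 1) + i)} \<and>
      ints s ''CNT'' ((2 * p + 1) * (2 * N + 1) + i) = ints s ''CNT'' (c * (2 * N + 1) + j)"
    and F: "equivp F" "\<And>c d. adj c d \<Longrightarrow> F c d"
    and L: "\<And>k. 2 ^ k \<le> C \<Longrightarrow> k \<le> L"
    and J: "joined C F adj {} s"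
    and Q: "\<And>t s'. t \<le> m * (2 * ((2 * N + 1) * (N * 100 + (2 * N + 1) * (26 * L + 200) + 100) + 70) + 80) + 10 \<Longrightarrow> same (writes build_graph) s s' \<Longrightarrow>
      joined C F adj (\<Union>p<m. \<Union>d<2. cells_of s (2 * p + 1) \<times> cells_of s (2 * p + 2 * d)) s' \<Longrightarrow> Q t s'"
  shows "wp build_graph Q s"
proof -
  define JC where "JC = N * 100 + (2 * N + 1) * (26 * L + 200) + 60"
  define S where "S = (\<lambda>p d. cells_of s (2 * p + 1) \<times> cells_of s (2 * p + 2 * d))"
  define U where "U = {''p'', ''cl'', ''bl'', ''xi'', ''side'', ''cs'', ''bs'', ''i'', ''u0'', ''yy'', ''a'', ''b'', ''k'', ''vv'', ''j'', ''v0'', ''u'', ''v'', ''par'', ''rk''}"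
  have jc: "joined C F adj E (istore w 0 i s') \<longleftrightarrow> joined C F adj E s'" if "w \<noteq> ''par''" "w \<noteq> ''rk''" for E i s' w
    using that by (intro joined_cong) simp_all
  have jr: "joined C F adj E (rstore w 0 i s') \<longleftrightarrow> joined C F adj E s'" for E i s' w
    by (intro joined_cong) simp_all
  have C: "c * (2 * N + 1) + i < C" if "c \<le> 2 * m" "i \<le> 2 * N" for c i
  proof -
    have "Suc c * (2 * N + 1) \<le> C" unfolding C_def using that by (intro mult_le_mono1) simp
    then show ?thesis using that by simp
  qed
  have "wp build_graph (\<lambda>t s'. t \<le> m * (2 * ((2 * N + 1) * (JC + 40) + 70) + 80) + 10 \<and>
      joined C F adj (\<Union>p<m. \<Union>d<2. S p d) s') s"
    unfolding build_graph_def
    apply (rule wp_For[where I = "\<lambda>p. joined C F adj (\<Union>p<p. \<Union>d<2. S p d)" and N = m and B = "2 * ((2 * N + 1) * (JC + 40) + 70) + 50"])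
        apply (simp add: writes_join_cell)
       apply (simp add: jc J)
      apply (simp add: sameD m writes_join_cell)
    subgoal premises p1 for p s1
      apply (simp only: wp_Seq wp_IAssign wp_RAssign)
      apply (rule wp_For[where I = "\<lambda>d. joined C F adj ((\<Union>p<p. \<Union>d<2. S p d) \<union> (\<Union>d<d. S p d))" and N = 2 and B = "(2 * N + 1) * (JC + 40) + 55"])
          apply (simp add: writes_join_cell)
      using p1(4) apply (simp add: jc jr)
        apply (simp add: sameD)
      subgoal premises p2 for d s2
        apply (simp only: wp_Seq wp_IAssign wp_RAssign)
        apply (rule wp_For[where I = "\<lambda>i. joined C F adj ((\<Union>p<p. \<Union>d<2. S p d) \<union> (\<Union>d<d. S p d) \<union>
            ((\<lambda>i. (2 * p + 1) * (2 * N + 1) + i) ` {..<i}) \<times> cells_of s (2 * p + 2 * d))"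
            and N = "2 * ints s ''K'' (2 * p + 1) + 1" and B = "JC + 9"])
            apply (simp add: writes_join_cell)
        using p2(4) apply (simp add: jc)
        subgoal premises p3 for i s3
        proof -
          have "ints s3 ''cl'' 0 = 2 * p + 1" "ints s3 ''K'' = ints s ''K''"
            using p1(2,3) p2(2) p3(2) by (simp_all add: sameD writes_join_cell)
          then show ?thesis by simp
        qed
        subgoal premises p3 for i s3
        proof -
          let ?c = "2 * p + 2 * d" and ?s = "istore ''u0'' 0 ((2 * p + 1) * (2 * N + 1) + i) s3"
          have sU: "same U s s1" by (rule same_mono[OF p1(2)]) (auto simp: U_def writes_join_cell)
          have sU2: "same U s s2" by (rule same_trans[OF same_trans[OF sU] same_mono[OF p2(2)]]) (auto simp: U_def writes_join_cell same_def)
          have sU3: "same U s s3" by (rule same_trans[OF same_trans[OF sU2] same_mono[OF p3(2)]]) (auto simp: U_def writes_join_cell same_def)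
          have "same U s3 ?s" by (simp add: same_def U_def)
          with sU3 have sU4: "same U s ?s" by (rule same_trans)
          have pm: "p < m" "p \<le> m" using p1(1) by auto
          have c: "?c \<le> 2 * m" "?c = 2 * p \<or> ?c = 2 * p + 2" "2 * p + 1 \<le> 2 * m" using pm p2(1) by auto
          have arr: "ints ?s ''K'' = ints s ''K''" "ints ?s ''A'' = ints s ''A''" "ints ?s ''CNT'' = ints s ''CNT''" "reals ?s ''YR'' = reals s ''YR''"
            "ints s1 ''base'' = ints s ''base''" "ints s2 ''base'' = ints s ''base''" "reals s1 ''X'' = reals s ''X''"
            using sameD[OF sU4] sameD[OF sU] sameD[OF sU2] by (simp_all add: U_def)
          have "ints s2 ''bl'' 0 = ints s ''base'' (2 * p + 1)" "reals s2 ''xi'' 0 = reals s ''X'' p" "ints s2 ''p'' 0 = p"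
            using p2(2) p1(3) arr by (simp_all add: sameD writes_join_cell mult_2)
          then have s2: "ints s2 ''bl'' 0 = (2 * p + 1) * (2 * N + 1)" "reals s2 ''xi'' 0 = X p" "ints s2 ''p'' 0 = p"
            using base[OF c(3)] X[OF pm(1)] by simp_all
          have "ints s3 ''bl'' 0 = ints s2 ''bl'' 0" "ints s3 ''cs'' 0 = ?c" "ints s3 ''bs'' 0 = ints s ''base'' ?c" "reals s3 ''xi'' 0 = reals s2 ''xi'' 0"
            using p3(2) p2(3) s2(3) arr by (simp_all add: sameD writes_join_cell mult_2)
          then have s3: "ints s3 ''bl'' 0 = (2 * p + 1) * (2 * N + 1)" "ints s3 ''cs'' 0 = ?c" "ints s3 ''bs'' 0 = ?c * (2 * N + 1)" "reals s3 ''xi'' 0 = X p"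
            using s2 base[OF c(1)] by simp_all
          define b u0 where "b = ?c * (2 * N + 1)" and "u0 = (2 * p + 1) * (2 * N + 1) + i"
          define K' where "K' = ints s ''K'' ?c"
          have i: "i \<le> 2 * ints s ''K'' (2 * p + 1)" using p3(1) by simp
          define E where "E = (\<Union>p<p. \<Union>d<2. S p d) \<union> (\<Union>d<d. S p d) \<union>
            ((\<lambda>i. (2 * p + 1) * (2 * N + 1) + i) ` {..<i}) \<times> cells_of s ?c"
          have E: "E \<union> {u0} \<times> (\<lambda>j. b + j) ` {..<2 * K' + 1} = (\<Union>p<p. \<Union>d<2. S p d) \<union> (\<Union>d<d. S p d) \<union>
            ((\<lambda>i. (2 * p + 1) * (2 * N + 1) + i) ` {..<Suc i}) \<times> cells_of s ?c"
            unfolding E_def u0_def b_def K'_def cells_of_def lessThan_Suc by blast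
          have "wp join_cell (\<lambda>t s'. t \<le> JC \<and> joined C F adj (E \<union> {u0} \<times> (\<lambda>j. b + j) ` {..<2 * K' + 1}) s') ?s"
          proof (rule wp_join_cell[where F = F and adj = adj and b = b and ?u0.0 = u0 and K = K' and C = C and L = L and D = E])
            show "arcmem ?s" by (rule arcmem_same[OF sU4 _ a]) (simp add: U_def)
            show "ints ?s ''u0'' 0 = u0" by (simp add: u0_def)
            show "u0 < C" unfolding u0_def by (rule C[OF c(3)]) (use i K[OF c(3)] in simp)
            show "ints ?s ''bs'' 0 = b" using s3 by (simp add: b_def)
            show "ints ?s ''K'' (ints ?s ''cs'' 0) = K'" using s3 arr by (simp add: K'_def)
            show "K' \<le> N" unfolding K'_def by (rule K[OF c(1)])
            show "ints ?s ''A'' (b + t) < N" if "t < K'" for t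
              unfolding arr b_def by (rule A[OF c(1)]) (use that K'_def in simp)
            show "b + j < C" if "j \<le> 2 * K'" for j unfolding b_def by (rule C[OF c(1)]) (use that K[OF c(1)] K'_def in simp)
            have xi: "reals ?s ''xi'' 0 = X p" using s3 by simp
            show "adj u0 (b + j) \<longleftrightarrow>
                2 * card {t. t < K' \<and> val (ints ?s ''A'' (b + t)) (reals ?s ''xi'' 0) < reals ?s ''YR'' u0} \<le> j \<and>
                j \<le> 2 * card {t. t < K' \<and> val (ints ?s ''A'' (b + t)) (reals ?s ''xi'' 0) \<le> reals ?s ''YR'' u0} \<and>
                ints ?s ''CNT'' u0 = ints ?s ''CNT'' (b + j)" if "j \<le> 2 * K'" for j
              unfolding arr xi u0_def b_def K'_def by (rule adj[OF pm(1) c(2) i]) (use that K'_def in simp)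
            show "joined C F adj E ?s" using p3(4) by (simp add: jc E_def)
          qed (use F L in \<open>auto simp: JC_def\<close>)
          then have "wp join_cell (\<lambda>t s'. 7 + t \<le> JC + 9 \<and> joined C F adj ((\<Union>p<p. \<Union>d<2. S p d) \<union> (\<Union>d<d. S p d) \<union>
            ((\<lambda>i. (2 * p + 1) * (2 * N + 1) + i) ` {..<Suc i}) \<times> cells_of s ?c) (istore ''i'' 0 (Suc i) s')) ?s"
            unfolding E by (rule wp_mono) (simp add: jc)
          then show ?thesis using p3(3) s3(1) by simp
        qed
        subgoal premises p3 for t s3
        proof -
          have pm: "2 * p + 1 \<le> 2 * m" using p1(1) by auto
          define P where "P = (2 * ints s ''K'' (2 * p + 1) + 1) * (JC + 40)"
          define P' where "P' = (2 * N + 1) * (JC + 40)"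
          have "P \<le> P'" unfolding P_def P'_def using K[OF pm] by (intro mult_le_mono1) simp
          moreover have "t \<le> P + 20" using p3(1) by (simp add: P_def algebra_simps)
          moreover have "(\<Union>p<p. \<Union>d<2. S p d) \<union> (\<Union>d<d. S p d) \<union>
            ((\<lambda>i. (2 * p + 1) * (2 * N + 1) + i) ` {..<2 * ints s ''K'' (2 * p + 1) + 1}) \<times> cells_of s (2 * p + 2 * d) =
            (\<Union>p<p. \<Union>d<2. S p d) \<union> (\<Union>d<Suc d. S p d)"
            unfolding S_def cells_of_def lessThan_Suc by blast
          ultimately show ?thesis using p3(3) unfolding P'_def[symmetric] by (simp add: jc)
        qed
        done
      subgoal premises p2 for t s2
      proof -
        define P' where "P' = (2 * N + 1) * (JC + 40)"
        have "t \<le> 2 * P' + 170" using p2(1) unfolding P'_def[symmetric] by simp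
        moreover have "(\<Union>p<p. \<Union>d<2. S p d) \<union> (\<Union>d<2. S p d) = (\<Union>p<Suc p. \<Union>d<2. S p d)"
          unfolding lessThan_Suc by blast
        ultimately show ?thesis using p2(3) unfolding P'_def[symmetric] by (simp add: jc)
      qed
      done
    subgoal for t s1
      by (simp add: algebra_simps)
    done
  then show ?thesis
    by (rule wp_same) (rule Q, simp_all add: JC_def S_def)
qed

end

section \<open>Correctness of the labels\<close>

context arcs
begin

definition layout :: "state \<Rightarrow> nat \<Rightarrow> bool" where
  "layout s m \<longleftrightarrow> arcmem s \<and> ints s ''mx'' 0 = m \<and> (\<forall>a b. a < b \<longrightarrow> b < m \<longrightarrow> reals s ''X'' a < reals s ''X'' b) \<and>
     reals s ''X'' ` {..<m} = E \<and> (\<forall>j\<le>2 * m. pos E (reals s ''XR'' j) = j) \<and> (\<forall>c\<le>2 * m. colOK s c)"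

text \<open>Decodes a cell number into a representative point. The division occurs only in the
  specification; the machine finds the block of a column through \<open>base\<close>.\<close>

definition pt :: "state \<Rightarrow> nat \<Rightarrow> real \<times> real" where
  "pt s u = (reals s ''XR'' (u div (2 * N + 1)), reals s ''YR'' u)"

definition cid :: "real \<times> real \<Rightarrow> nat" where
  "cid p = fst (cell p) * (2 * N + 1) + snd (cell p)"

lemma layoutD:
  assumes "layout s m"
  shows "arcmem s" "ints s ''mx'' 0 = m" "a < b \<Longrightarrow> b < m \<Longrightarrow> reals s ''X'' a < reals s ''X'' b"
    "reals s ''X'' ` {..<m} = E" "j \<le> 2 * m \<Longrightarrow> pos E (reals s ''XR'' j) = j" "c \<le> 2 * m \<Longrightarrow> colOK s c"
  using assms unfolding layout_def by blast+

lemma layout_card: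
  assumes "layout s m" shows "card E = m"
proof -
  have "inj_on (reals s ''X'') {..<m}"
    by (rule inj_onI) (metis layoutD(3)[OF assms] lessThan_iff less_irrefl linorder_neqE_nat)
  then show ?thesis unfolding layoutD(4)[OF assms, symmetric] by (simp add: card_image)
qed

lemma layout_line:
  assumes "layout s m" "p < m"
  shows "reals s ''XR'' (2 * p + 1) = reals s ''X'' p" "reals s ''X'' p \<in> E"
proof -
  have "pos (reals s ''X'' ` {..<m}) (reals s ''X'' p) = 2 * p + 1"
    by (rule pos_sorted) (use layoutD(3)[OF assms(1)] assms(2) in auto)
  then have "pos E (reals s ''X'' p) = 2 * p + 1" by (simp only: layoutD(4)[OF assms(1)])
  moreover have "pos E (reals s ''XR'' (2 * p + 1)) = 2 * p + 1" by (rule layoutD(5)[OF assms(1)]) (use assms(2) in simp)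
  moreover show "reals s ''X'' p \<in> E" using layoutD(4)[OF assms(1)] assms(2) by blast
  ultimately show "reals s ''XR'' (2 * p + 1) = reals s ''X'' p" using pos_eq_iff[OF finE] by metis
qed

lemma colOKD:
  assumes "colOK s c"
  shows "ints s ''base'' c = c * (2 * N + 1)" "ints s ''K'' c \<le> N"
    "t < ints s ''K'' c \<Longrightarrow> ints s ''A'' (c * (2 * N + 1) + t) < N"
    "j \<le> 2 * ints s ''K'' c \<Longrightarrow> pos (Vals (reals s ''XR'' c)) (reals s ''YR'' (c * (2 * N + 1) + j)) = j"
    "j \<le> 2 * ints s ''K'' c \<Longrightarrow> ints s ''CNT'' (c * (2 * N + 1) + j) = card (Sg (reals s ''XR'' c, reals s ''YR'' (c * (2 * N + 1) + j)))"
  using assms unfolding colOK_def Let_def by blast+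

lemma layout_order:
  assumes "layout s m" "c \<le> 2 * m"
  shows "order (\<lambda>t. ints s ''A'' (c * (2 * N + 1) + t)) (ints s ''K'' c) c"
proof -
  have "colOK s c" by (rule layoutD(6)[OF assms])
  then have "order (\<lambda>t. ints s ''A'' (c * (2 * N + 1) + t)) (ints s ''K'' c) (col (reals s ''XR'' c))"
    unfolding colOK_def Let_def by (intro orderI) blast+
  then show ?thesis by (simp only: layoutD(5)[OF assms])
qed

lemma pt_eq: "j \<le> 2 * N \<Longrightarrow> pt s (c * (2 * N + 1) + j) = (reals s ''XR'' c, reals s ''YR'' (c * (2 * N + 1) + j))"
proof -
  assume "j \<le> 2 * N"
  then have "(c * (2 * N + 1) + j) div (2 * N + 1) = c"
    using div_mult_self3[of "2 * N + 1" c j] by (simp del: div_mult_self1 div_mult_self2 div_mult_self3 div_mult_self4 mult_Suc_right)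
  then show ?thesis by (simp only: pt_def)
qed

lemma layout_cell_pt:
  assumes "layout s m" "c \<le> 2 * m" "j \<le> 2 * ints s ''K'' c"
  shows "cell (pt s (c * (2 * N + 1) + j)) = (c, j)"
proof -
  note o = colOKD[OF layoutD(6)[OF assms(1,2)]]
  have "j \<le> 2 * N" using assms(3) o(2) by simp
  then show ?thesis using o(4)[OF assms(3)] layoutD(5)[OF assms(1,2)] by (simp only: pt_eq cell_def fst_conv snd_conv)
qed

lemma layout_cell_bounds:
  assumes "layout s m"
  shows "fst (cell p) \<le> 2 * m" "snd (cell p) \<le> 2 * ints s ''K'' (fst (cell p))"
proof -
  show c: "fst (cell p) \<le> 2 * m" using cell_le(1) layout_card[OF assms] by simp
  have "order (\<lambda>t. ints s ''A'' (fst (cell p) * (2 * N + 1) + t)) (ints s ''K'' (fst (cell p))) (fst (cell p))"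
    by (rule layout_order[OF assms c])
  then have "(\<lambda>t. val (ints s ''A'' (fst (cell p) * (2 * N + 1) + t)) (fst p)) ` {..<ints s ''K'' (fst (cell p))} = Vals (fst p)"
    unfolding order_def by (simp add: cell_def)
  then have "card (Vals (fst p)) \<le> ints s ''K'' (fst (cell p))" by (metis card_image_le card_lessThan finite_lessThan)
  then show "snd (cell p) \<le> 2 * ints s ''K'' (fst (cell p))"
    using pos_le[OF finite_Vals, of "fst p" "snd p"] by (simp add: cell_def)
qed

lemma layout_cell_cid:
  assumes "layout s m" shows "cell (pt s (cid p)) = cell p"
  unfolding cid_def using layout_cell_pt[OF assms layout_cell_bounds[OF assms]] by simp

lemma cid_less:
  assumes "layout s m" shows "cid p < (2 * m + 1) * (2 * N + 1)"
proof -
  have "Suc (fst (cell p)) * (2 * N + 1) \<le> (2 * m + 1) * (2 * N + 1)"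
    using layout_cell_bounds(1)[OF assms, of p] by (intro mult_le_mono1) simp
  then show ?thesis using cell_le(2)[of p] by (simp add: cid_def)
qed

text \<open>Cardinalities are what the program stores; on the closure they decide equality of the
  sets, as in \<open>sameface_closure\<close>.\<close>

definition adjacent :: "state \<Rightarrow> nat \<Rightarrow> nat \<Rightarrow> bool" where
  "adjacent s u v \<longleftrightarrow> pt s u \<in> closure (cset (pt s v)) \<and> card (Sg (pt s u)) = card (Sg (pt s v))"

lemma adjacent_iff:
  assumes l: "layout s m" and p: "p < m" and c: "c = 2 * p \<or> c = 2 * p + 2"
    and i: "i \<le> 2 * ints s ''K'' (2 * p + 1)" and j: "j \<le> 2 * ints s ''K'' c"
  shows "adjacent s ((2 * p + 1) * (2 * N + 1) + i) (c * (2 * N + 1) + j) \<longleftrightarrow>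
      2 * card {t. t < ints s ''K'' c \<and> val (ints s ''A'' (c * (2 * N + 1) + t)) (reals s ''X'' p) < reals s ''YR'' ((2 * p + 1) * (2 * N + 1) + i)} \<le> j \<and>
      j \<le> 2 * card {t. t < ints s ''K'' c \<and> val (ints s ''A'' (c * (2 * N + 1) + t)) (reals s ''X'' p) \<le> reals s ''YR'' ((2 * p + 1) * (2 * N + 1) + i)} \<and>
      ints s ''CNT'' ((2 * p + 1) * (2 * N + 1) + i) = ints s ''CNT'' (c * (2 * N + 1) + j)"
proof -
  define u v where "u = (2 * p + 1) * (2 * N + 1) + i" and "v = c * (2 * N + 1) + j"
  have pm: "2 * p + 1 \<le> 2 * m" and cm: "c \<le> 2 * m" using p c by auto
  note ou = colOKD[OF layoutD(6)[OF l pm]] and ov = colOKD[OF layoutD(6)[OF l cm]]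
  have iN: "i \<le> 2 * N" "j \<le> 2 * N" using i j ou(2) ov(2) by auto
  have ptu: "pt s u = (reals s ''X'' p, reals s ''YR'' u)" using pt_eq[OF iN(1)] layout_line(1)[OF l p] by (simp only: u_def)
  have ptv: "pt s v = (reals s ''XR'' c, reals s ''YR'' v)" using pt_eq[OF iN(2)] by (simp only: v_def)
  have cu: "ints s ''CNT'' u = card (Sg (pt s u))" "ints s ''CNT'' v = card (Sg (pt s v))"
    using ou(5)[OF i] ov(5)[OF j] ptv pt_eq[OF iN(1), of s "2 * p + 1"] by (simp_all only: u_def v_def)
  have cellu: "cell (pt s u) = (2 * p + 1, i)" unfolding u_def by (rule layout_cell_pt[OF l pm i])
  have cellv: "cell (pt s v) = (c, j)" unfolding v_def by (rule layout_cell_pt[OF l cm j])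
  have colu: "col (fst (pt s u)) = 2 * p + 1" and colv: "col (fst (pt s v)) = c" and jv: "snd (cell (pt s v)) = j"
    using cellu cellv by (auto simp: cell_def)
  have "fst (pt s v) \<notin> E" using odd_pos[of E "fst (pt s v)"] colv c by auto
  moreover have "fst (pt s u) \<in> E" using layout_line(2)[OF l p] by (simp add: ptu)
  ultimately have cl: "fst (pt s u) \<in> closure (colset (fst (pt s v)))"
    using closure_colset_iff[of "fst (pt s u)" "fst (pt s v)"] colu colv c by auto
  have "pt s u \<in> closure (cset (pt s v)) \<longleftrightarrow> sides (pt s u) (pt s v)"
    using closure_csetI[OF cl] closure_cset_imp(2) by blast
  moreover have "order (\<lambda>t. ints s ''A'' (c * (2 * N + 1) + t)) (ints s ''K'' c) (col (fst (pt s v)))"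
    unfolding colv by (rule layout_order[OF l cm])
  note sides_iff[OF this cl]
  ultimately show ?thesis unfolding adjacent_def u_def[symmetric] v_def[symmetric] cu jv by (simp add: ptu)
qed

text \<open>Two points of one cell of a line have the same abscissa and compare alike with every arc
  present there. The arcs of the slab are present on its boundary too, so membership in the closure
  is a property of the cell.\<close>

lemma closure_cell_left:
  assumes c: "cell p = cell p'" and E: "fst p \<in> E" and cl: "p \<in> closure (cset q)"
  shows "p' \<in> closure (cset q)"
proof -
  have x: "fst p' = fst p" using pos_eq_iff[OF finE disjI1[OF E]] cell_col[OF c] by metis
  note i = closure_cset_imp[OF cl]
  have "sides p' q"
    unfolding sides_def
  proof (intro allI impI)
    fix k assume k: "k < N" "pres k (fst q)"
    have "colset (fst q) \<subseteq> {x. pres k x}"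
    proof
      fix x assume "x \<in> colset (fst q)"
      then have "col x = col (fst q)" by (simp add: colset_def)
      then show "x \<in> {x. pres k x}" using col_pres[OF _ k(1)] k(2) by blast
    qed
    moreover have "closed {x. pres k x}" unfolding pres_def by (intro closed_Collect_le continuous_intros)
    ultimately have "pres k (fst p)" using closure_minimalD[OF i(1)] by blast
    note d = cell_eqD[OF c k(1) this]
    have s: "(val k (fst q) < snd q \<longrightarrow> val k (fst p) \<le> snd p) \<and>
      (snd q < val k (fst q) \<longrightarrow> snd p \<le> val k (fst p)) \<and> (val k (fst q) = snd q \<longrightarrow> val k (fst p) = snd p)"
      using i(2) k unfolding sides_def by blast
    have le: "val k (fst p) \<le> snd p \<longleftrightarrow> val k (fst p') \<le> snd p'" unfolding le_less using d by blast
    have ge: "snd p \<le> val k (fst p) \<longleftrightarrow> snd p' \<le> val k (fst p')" unfolding not_less[symmetric] using d(1) by blast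
    show "(val k (fst q) < snd q \<longrightarrow> val k (fst p') \<le> snd p') \<and>
      (snd q < val k (fst q) \<longrightarrow> snd p' \<le> val k (fst p')) \<and> (val k (fst q) = snd q \<longrightarrow> val k (fst p') = snd p')"
      using s unfolding le ge d(2) .
  qed
  then show ?thesis using i(1) by (intro closure_csetI) (simp_all only: x)
qed

text \<open>Every point is in a common face with the representative of its cell, so soundness
  transfers from representatives to points. Conversely the labels are constant along the edges of
  the cell graph, and \<open>labelling_complete\<close> applies.\<close>

lemma labels_iff_sameface:
  assumes l: "layout s m"
    and sound: "\<And>c d. c < (2 * m + 1) * (2 * N + 1) \<Longrightarrow> d < (2 * m + 1) * (2 * N + 1) \<Longrightarrow> rep c = rep d \<Longrightarrow> sameface (pt s c) (pt s d)"
    and complete: "\<And>c d. (c, d) \<in> (\<Union>p<m. \<Union>d<2. cells_of s (2 * p + 1) \<times> cells_of s (2 * p + 2 * d)) \<Longrightarrow>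
      c < (2 * m + 1) * (2 * N + 1) \<Longrightarrow> d < (2 * m + 1) * (2 * N + 1) \<Longrightarrow> adjacent s c d \<Longrightarrow> rep c = rep d"
  shows "rep (cid p) = rep (cid q) \<longleftrightarrow> sameface p q"
proof
  assume "rep (cid p) = rep (cid q)"
  then have "sameface (pt s (cid p)) (pt s (cid q))" by (rule sound[OF cid_less[OF l] cid_less[OF l]])
  moreover have "sameface p (pt s (cid p))" "sameface (pt s (cid q)) q"
    by (rule sameface_cell, simp only: layout_cell_cid[OF l])+
  ultimately show "sameface p q" using sameface_trans by blast
next
  assume sf: "sameface p q"
  define g where "g = (\<lambda>c. rep (fst c * (2 * N + 1) + snd c))"
  have g: "g (cell p) = rep (cid p)" for p by (simp add: g_def cid_def)
  have "g (cell p) = g (cell q)"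
  proof (rule labelling_complete[OF _ sf])
    fix p q assume pq: "fst p \<in> E" "fst q \<notin> E" "p \<in> closure (cset q)" "Sg p = Sg q"
    obtain a where a: "a < m" "fst p = reals s ''X'' a" using pq(1) layoutD(4)[OF l] by blast
    have colp: "col (fst p) = 2 * a + 1"
      using layoutD(5)[OF l, of "2 * a + 1"] layout_line(1)[OF l a(1)] a by simp
    have "col (fst q) = col (fst p) + 1 \<or> col (fst p) = col (fst q) + 1"
      using closure_colset_iff[OF pq(1,2)] closure_cset_imp(1)[OF pq(3)] by blast
    then have "col (fst q) = 2 * a + 2 \<or> col (fst q) = 2 * a" using colp by auto
    then obtain d where d: "d < 2" "col (fst q) = 2 * a + 2 * d" by (metis One_nat_def add_0_right lessI mult_0_right mult_1_right numeral_2_eq_2 zero_less_Suc)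
    have "cid p \<in> cells_of s (2 * a + 1)" "cid q \<in> cells_of s (2 * a + 2 * d)"
      using layout_cell_bounds(2)[OF l, of p] layout_cell_bounds(2)[OF l, of q] colp d(2)
      by (auto simp: cells_of_def cid_def cell_def)
    then have mem: "(cid p, cid q) \<in> (\<Union>p<m. \<Union>d<2. cells_of s (2 * p + 1) \<times> cells_of s (2 * p + 2 * d))"
      using a(1) d(1) by blast
    have cp: "cell p = cell (pt s (cid p))" and cq: "cell q = cell (pt s (cid q))" using layout_cell_cid[OF l] by simp_all
    have "cset (pt s (cid q)) = cset q" unfolding cset_def cq ..
    then have "pt s (cid p) \<in> closure (cset (pt s (cid q)))" using closure_cell_left[OF cp pq(1,3)] by (simp only:)
    moreover have "Sg (pt s (cid p)) = Sg (pt s (cid q))" using Sg_cell[OF cp] Sg_cell[OF cq] pq(4) by (simp only:)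
    ultimately have "adjacent s (cid p) (cid q)" by (simp only: adjacent_def)
    then have "rep (cid p) = rep (cid q)" by (rule complete[OF mem cid_less[OF l] cid_less[OF l]])
    then show "g (cell p) = g (cell q)" by (simp only: g)
  qed
  then show "rep (cid p) = rep (cid q)" by (simp only: g)
qed

lemma layout_same:
  assumes l: "layout s m" and sm: "same U s s'"
    and U: "{''nn'', ''r'', ''x'', ''y'', ''sg'', ''mx'', ''X'', ''XR'', ''base'', ''K'', ''A'', ''YR'', ''CNT''} \<inter> U = {}"
  shows "layout s' m" "pt s' = pt s" "cells_of s' = cells_of s"
proof -
  have n: "a \<notin> U" if "a \<in> {''nn'', ''r'', ''x'', ''y'', ''sg'', ''mx'', ''X'', ''XR'', ''base'', ''K'', ''A'', ''YR'', ''CNT''}" for a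
    using U that by blast
  have e: "ints s' ''mx'' = ints s ''mx''" "reals s' ''X'' = reals s ''X''" "reals s' ''XR'' = reals s ''XR''"
    "ints s' ''base'' = ints s ''base''" "ints s' ''K'' = ints s ''K''" "ints s' ''A'' = ints s ''A''"
    "reals s' ''YR'' = reals s ''YR''" "ints s' ''CNT'' = ints s ''CNT''"
    by (rule sameD[OF sm n], simp)+
  have "arcmem s'" by (rule arcmem_same[OF sm _ layoutD(1)[OF l]]) (use U in blast)
  moreover have "colOK s' c = colOK s c" for c by (simp only: colOK_def e)
  ultimately show "layout s' m" using l unfolding layout_def e by blast
  show "pt s' = pt s" "cells_of s' = cells_of s" by (intro ext, simp only: pt_def cells_of_def e)+
qed

text \<open>The set of curves through a point and its index set determine each other, although
  several arcs name the same circle; so both give the same level sets, hence the same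
  components.\<close>

lemma faces_sameface:
  assumes D: "boundary_circle ` D = (\<lambda>k. sphere (ax k, ay k) r) ` {..<N}"
    and F: "F \<in> faces D" "p \<in> F"
  shows "q \<in> F \<longleftrightarrow> sameface p q"
proof -
  define \<Gamma> where "\<Gamma> = boundary_circle ` D"
  define circ where "circ = (\<lambda>k. sphere (ax k, ay k) r)"
  have G: "\<Gamma> = circ ` {..<N}" using D by (simp only: \<Gamma>_def circ_def)
  have SgN: "k < N" if "k \<in> Sg t" for k t using that by (simp add: Sg_def)
  have sph: "t \<in> circ k \<longleftrightarrow> k \<in> Sg t" if "k < N" for t k
  proof -
    have r: "0 < r" using r_pos[OF that] .
    have "t \<in> circ k \<longleftrightarrow> (dist (ax k, ay k) t)\<^sup>2 = r\<^sup>2"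
      using r by (simp add: circ_def power2_eq_iff_nonneg)
    also have "(dist (ax k, ay k) t)\<^sup>2 = (fst t - ax k)\<^sup>2 + (snd t - ay k)\<^sup>2"
      by (cases t) (simp add: dist_prod_def dist_real_def power2_commute)
    also have "\<dots> = r\<^sup>2 \<longleftrightarrow> on k t"
      by (simp add: on_def power2_eq_square)
    finally show ?thesis using that by (simp add: Sg_def)
  qed
  have eq: "{\<gamma>\<in>\<Gamma>. t \<in> \<gamma>} = {\<gamma>\<in>\<Gamma>. u \<in> \<gamma>} \<longleftrightarrow> Sg t = Sg u" for t u
  proof -
    have c: "{\<gamma>\<in>\<Gamma>. t \<in> \<gamma>} = circ ` Sg t" for t
      unfolding G using sph SgN by blast
    have S: "Sg t = {k. k < N \<and> circ k \<in> {\<gamma>\<in>\<Gamma>. t \<in> \<gamma>}}" for t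
      unfolding G using sph SgN by blast
    show ?thesis
    proof
      assume e: "{\<gamma>\<in>\<Gamma>. t \<in> \<gamma>} = {\<gamma>\<in>\<Gamma>. u \<in> \<gamma>}"
      show "Sg t = Sg u" unfolding S[of t] S[of u] e ..
    qed (simp only: c)
  qed
  obtain \<Sigma> where S: "F \<in> components {p. {\<gamma>\<in>\<Gamma>. p \<in> \<gamma>} = \<Sigma>}"
    using F(1) unfolding faces_def curve_faces_def \<Gamma>_def[symmetric] by blast
  have "p \<in> {p. {\<gamma>\<in>\<Gamma>. p \<in> \<gamma>} = \<Sigma>}" using S F(2) in_components_subset by blast
  then have Sp: "{\<gamma>\<in>\<Gamma>. p \<in> \<gamma>} = \<Sigma>" by (rule CollectD)
  have A: "{t. {\<gamma>\<in>\<Gamma>. t \<in> \<gamma>} = \<Sigma>} = {t. Sg t = Sg p}" unfolding Sp[symmetric] eq ..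
  obtain w where w: "F = connected_component_set {t. Sg t = Sg p} w" using S unfolding A components_def by blast
  then have "F = connected_component_set {t. Sg t = Sg p} p" using F(2) connected_component_eq by blast
  then have "q \<in> F \<longleftrightarrow> (\<exists>T. connected T \<and> T \<subseteq> {t. Sg t = Sg p} \<and> p \<in> T \<and> q \<in> T)"
    unfolding connected_component_def by simp
  also have "\<dots> \<longleftrightarrow> sameface p q" unfolding sameface_def by blast
  finally show ?thesis .
qed

end

text \<open>The expression \<open>key\<close> reads the candidate index from \<open>md\<close>, so
  \<open>md\<close> is set to \<open>lo\<close> before the final test for equality. The result is a
  position in the sense of \<open>pos\<close>.\<close>

definition search :: "rexp \<Rightarrow> rexp \<Rightarrow> iexp \<Rightarrow> com" where
  "search key target bound = ''lo'' ::= IConst 0 ;; ''hi'' ::= bound ;;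
     While (ILess (V ''lo'') (V ''hi''))
      (''md'' ::= ICell ''half'' (IAdd (V ''lo'') (V ''hi'')) ;;
       Cond (RLess key target) (''lo'' ::= IAdd (V ''md'') (IConst 1)) (''hi'' ::= V ''md'')) ;;
     ''md'' ::= V ''lo'' ;; ''ps'' ::= IAdd (V ''lo'') (V ''lo'') ;;
     Cond (BAnd (ILess (V ''lo'') bound) (BAnd (BNot (RLess key target)) (BNot (RLess target key)))) (incr ''ps'') Skip"

abbreviation "search_vars \<equiv> {''lo'', ''hi'', ''md'', ''ps''}"

lemma writes_search: "writes (search key target bound) = search_vars"
  by (auto simp: search_def)

lemma pos_threshold:
  assumes inc: "\<And>a b. a < b \<Longrightarrow> b < n \<Longrightarrow> f a < f b" and l: "l \<le> n"
    and lt: "\<And>t. t < l \<Longrightarrow> f t < y" and ge: "\<And>t. l \<le> t \<Longrightarrow> t < n \<Longrightarrow> \<not> f t < y"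
  shows "pos (f ` {..<n}) y = 2 * l + (if l < n \<and> f l = y then 1 else 0)"
proof -
  have inj: "inj_on f {..<n}"
    by (rule inj_onI) (metis inc lessThan_iff less_irrefl linorder_neqE_nat)
  have "{v \<in> f ` {..<n}. v < y} = f ` {..<l}"
  proof (intro equalityI subsetI)
    fix v assume "v \<in> {v \<in> f ` {..<n}. v < y}"
    then obtain t where "t < n" "v = f t" "f t < y" by blast
    then show "v \<in> f ` {..<l}" using ge[of t] by (intro image_eqI[of _ _ t]) (auto simp: not_le[symmetric])
  qed (use lt l in auto)
  moreover have "card (f ` {..<l}) = l" using inj l by (subst card_image) (auto intro: inj_on_subset)
  moreover have "y \<in> f ` {..<n} \<longleftrightarrow> l < n \<and> f l = y"
  proof
    assume "y \<in> f ` {..<n}"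
    then obtain t where t: "t < n" "f t = y" by blast
    then have "l \<le> t" using lt[of t] not_le by force
    moreover have "\<not> l < t" using inc[of l t] ge[of l] t by auto
    ultimately show "l < n \<and> f l = y" using t by simp
  qed auto
  ultimately show ?thesis by (simp add: pos_def)
qed

lemma wp_search:
  assumes key: "\<And>s'. same search_vars s s' \<Longrightarrow> ints s' ''md'' 0 < n \<Longrightarrow> rval key s' = f (ints s' ''md'' 0)"
    and target: "\<And>s'. same search_vars s s' \<Longrightarrow> rval target s' = y"
    and bound: "\<And>s'. same search_vars s s' \<Longrightarrow> ival bound s' = n"
    and half: "\<And>h. h < 2 * n \<Longrightarrow> ints s ''half'' h = h div 2"
    and inc: "\<And>a b. a < b \<Longrightarrow> b < n \<Longrightarrow> f a < f b"
    and L: "n < 2 ^ L"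
    and Q: "\<And>t s'. t \<le> L * (rcost key + rcost target + 30) + 2 * (rcost key + rcost target + icost bound) + 60 \<Longrightarrow>
      same search_vars s s' \<Longrightarrow> ints s' ''ps'' 0 = pos (f ` {..<n}) y \<Longrightarrow> Q t s'"
  shows "wp (search key target bound) Q s"
proof -
  let ?B = "rcost key + rcost target + 30"
  define W where "W = While (ILess (V ''lo'') (V ''hi''))
      (''md'' ::= ICell ''half'' (IAdd (V ''lo'') (V ''hi'')) ;;
       Cond (RLess key target) (''lo'' ::= IAdd (V ''md'') (IConst 1)) (''hi'' ::= V ''md''))"
  define I where "I = (\<lambda>s'. same search_vars s s' \<and> ints s' ''lo'' 0 \<le> ints s' ''hi'' 0 \<and> ints s' ''hi'' 0 \<le> n \<and>
    (\<forall>t<ints s' ''lo'' 0. f t < y) \<and> (\<forall>t. ints s' ''hi'' 0 \<le> t \<longrightarrow> t < n \<longrightarrow> \<not> f t < y))"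
  \<comment> \<open>The interval left has length below \<open>2 ^ l\<close>, and one round halves
    it; the sum \<open>lo + hi\<close> that indexes the table stays below
    \<open>2 * n\<close>.\<close>
  have loop: "wp W (\<lambda>t s''. t \<le> l * ?B + 10 \<and> I s'' \<and> ints s'' ''lo'' 0 = ints s'' ''hi'' 0) s'"
    if "I s'" "ints s' ''hi'' 0 < ints s' ''lo'' 0 + 2 ^ l" for l s'
    using that
  proof (induction l arbitrary: s')
    case (0 s')
    then have "ints s' ''lo'' 0 = ints s' ''hi'' 0" by (simp add: I_def)
    then show ?case using 0(1) unfolding W_def by (subst wp_While) simp
  next
    case (Suc l s')
    show ?case
    proof (cases "ints s' ''lo'' 0 < ints s' ''hi'' 0")
      case False
      then have "ints s' ''lo'' 0 = ints s' ''hi'' 0" using Suc.prems(1) by (simp add: I_def)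
      then show ?thesis using Suc.prems(1) unfolding W_def by (subst wp_While) simp
    next
      case True
      define lo hi where "lo = ints s' ''lo'' 0" and "hi = ints s' ''hi'' 0"
      define md where "md = (lo + hi) div 2"
      define s1 where "s1 = istore ''md'' 0 md s'"
      have h: "lo < hi" "hi \<le> n" "hi < lo + 2 * 2 ^ l" using True Suc.prems by (simp_all add: lo_def hi_def I_def)
      have md: "lo \<le> md" "md < hi" "hi < md + 1 + 2 ^ l" "md < lo + 2 ^ l" using h by (auto simp: md_def)
      have sm: "same search_vars s s'" using Suc.prems(1) by (simp add: I_def)
      then have "ints s' ''half'' (lo + hi) = ints s ''half'' (lo + hi)" by (simp add: sameD)
      then have hf: "ints s' ''half'' (lo + hi) = md" using half[of "lo + hi"] h by (simp add: md_def)
      have sm1: "same search_vars s s1" using sm by (simp add: same_def s1_def)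
      have ev: "rval key s1 = f md" "rval target s1 = y"
        using key[OF sm1] target[OF sm1] md h by (simp_all add: s1_def)
      define s2 where "s2 = (if f md < y then istore ''lo'' 0 (md + 1) s1 else istore ''hi'' 0 md s1)"
      have "I s2"
        unfolding I_def
      proof (intro conjI allI impI)
        show "same search_vars s s2" using sm1 by (simp add: same_def s2_def)
        show "ints s2 ''lo'' 0 \<le> ints s2 ''hi'' 0" "ints s2 ''hi'' 0 \<le> n" using md h by (auto simp: s2_def s1_def lo_def hi_def)
        fix t
        have mono: "f t \<le> f md" if "t \<le> md" using inc[of t md] that md h by (cases "t = md") auto
        have mono': "f md \<le> f t" if "md \<le> t" "t < n" using inc[of md t] that by (cases "t = md") auto
        show "f t < y" if "t < ints s2 ''lo'' 0"
          using that mono Suc.prems(1) by (auto simp: s2_def s1_def I_def split: if_splits)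
        show "\<not> f t < y" if "ints s2 ''hi'' 0 \<le> t" "t < n"
          using that mono' Suc.prems(1) by (auto simp: s2_def s1_def I_def split: if_splits)
      qed
      moreover have "ints s2 ''hi'' 0 < ints s2 ''lo'' 0 + 2 ^ l" using md by (auto simp: s2_def s1_def lo_def hi_def)
      ultimately have "wp W (\<lambda>t s''. t \<le> l * ?B + 10 \<and> I s'' \<and> ints s'' ''lo'' 0 = ints s'' ''hi'' 0) s2" by (rule Suc.IH)
      then have w: "wp W (\<lambda>u s''. rcost key + rcost target + 29 + u \<le> Suc l * ?B + 10 \<and> I s'' \<and> ints s'' ''lo'' 0 = ints s'' ''hi'' 0) s2"
        by (rule wp_mono) simp
      have e: "istore ''md'' 0 (ints s' ''half'' (ints s' ''lo'' 0 + ints s' ''hi'' 0)) s' = s1"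
        using hf by (simp add: s1_def lo_def hi_def)
      show ?thesis
        unfolding W_def
        apply (subst wp_While)
        unfolding W_def[symmetric]
        using True w ev by (auto simp: e s2_def s1_def elim!: wp_mono)
    qed
  qed
  define R where "R = ''md'' ::= V ''lo'' ;; ''ps'' ::= IAdd (V ''lo'') (V ''lo'') ;;
     Cond (BAnd (ILess (V ''lo'') bound) (BAnd (BNot (RLess key target)) (BNot (RLess target key)))) (incr ''ps'') Skip"
  define s0 where "s0 = istore ''hi'' 0 n (istore ''lo'' 0 0 s)"
  have sm0: "same search_vars s (istore ''lo'' 0 0 s)" "same search_vars s s0" by (simp_all add: same_def s0_def)
  have "I s0" using sm0(2) by (simp add: I_def s0_def)
  then have "wp W (\<lambda>t s''. t \<le> L * ?B + 10 \<and> I s'' \<and> ints s'' ''lo'' 0 = ints s'' ''hi'' 0) s0"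
    by (rule loop) (use L in \<open>simp add: s0_def\<close>)
  moreover have "wp R (\<lambda>u. Q (icost (IConst 0) + icost (IConst 0) + 1 + (icost (IConst 0) + icost bound + 1 + (t + u)))) s1"
    if t: "t \<le> L * ?B + 10" and I: "I s1" and lh: "ints s1 ''lo'' 0 = ints s1 ''hi'' 0" for t s1
  proof -
    define l where "l = ints s1 ''lo'' 0"
    define s2 where "s2 = istore ''ps'' 0 (l + l) (istore ''md'' 0 l s1)"
    have sm: "same search_vars s s2" using I by (simp add: same_def s2_def I_def)
    have p: "pos (f ` {..<n}) y = 2 * l + (if l < n \<and> f l = y then 1 else 0)"
      by (rule pos_threshold[OF inc]) (use I lh in \<open>auto simp: I_def l_def\<close>)
    have b: "ival bound s2 = n" "rval target s2 = y" using bound[OF sm] target[OF sm] by auto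
    have k: "rval key s2 = f l" if "l < n" using key[OF sm] that by (simp add: s2_def)
    have st: "istore ''ps'' 0 (l + l) (istore ''md'' 0 l s1) = s2" by (simp add: s2_def)
    have l2: "ints s2 ''lo'' 0 = l" "ints s2 ''ps'' 0 = 2 * l" by (simp_all add: s2_def l_def)
    show ?thesis
    proof (cases "l < n \<and> f l = y")
      case True
      have "Q T (istore ''ps'' 0 (2 * l + 1) s2)" if "T \<le> L * ?B + 2 * (rcost key + rcost target + icost bound) + 60" for T
        by (rule Q[OF that]) (use sm p True in \<open>simp_all add: same_def\<close>)
      then show ?thesis using True b k l2 t by (simp add: R_def l_def[symmetric] st)
    next
      case False
      have "Q T s2" if "T \<le> L * ?B + 2 * (rcost key + rcost target + icost bound) + 60" for T
        by (rule Q[OF that sm]) (use p False l2 in simp)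
      then show ?thesis using False b k l2 t by (auto simp: R_def l_def[symmetric] st)
    qed
  qed
  ultimately have "wp W (\<lambda>t. wp R (\<lambda>u. Q (icost (IConst 0) + icost (IConst 0) + 1 + (icost (IConst 0) + icost bound + 1 + (t + u))))) s0"
    by (rule wp_mono) simp_all
  moreover have "istore ''hi'' (ival (IConst 0) (istore ''lo'' (ival (IConst 0) s) (ival (IConst 0) s) s))
      (ival bound (istore ''lo'' (ival (IConst 0) s) (ival (IConst 0) s) s)) (istore ''lo'' (ival (IConst 0) s) (ival (IConst 0) s) s) = s0"
    using bound[OF sm0(1)] by (simp add: s0_def)
  ultimately show ?thesis
    by (simp only: search_def W_def[symmetric] R_def[symmetric] wp_Seq wp_IAssign)
qed

section \<open>Queries and preprocessing\<close>

text \<open>The second search evaluates the arcs at the abscissa of the query itself; their order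
  there is the one computed at the representative of the column.\<close>

definition query :: com where
  "query = search (RCell ''X'' (V ''md'')) (RV ''qx'') (V ''mx'') ;;
     ''col'' ::= V ''ps'' ;; ''bs'' ::= ICell ''base'' (V ''col'') ;;
     search (valE (ICell ''A'' (IAdd (V ''bs'') (V ''md''))) (RV ''qx'')) (RV ''qy'') (ICell ''K'' (V ''col'')) ;;
     ''out'' ::= IAdd (V ''bs'') (V ''ps'') ;; go_to_root ''out''"

lemma writes_query: "writes query = {''lo'', ''hi'', ''md'', ''ps'', ''col'', ''bs'', ''out''}"
  by (auto simp: query_def writes_search go_to_root_def)

definition build_structure :: com where
  "build_structure = halve ;; ''z'' ::= V ''M'' ;; sort_values ;; copy_columns ;; columns ;; build_graph"

definition preprocess :: com where
  "preprocess = duplicate_arcs ;; list_events ;; build_structure"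

definition structure_time :: "nat \<Rightarrow> nat \<Rightarrow> nat \<Rightarrow> nat" where
  "structure_time N M L = 40 * M + (M * (M * 80 + 150)) + 100 * M + (2 * M + 1) * (N * N * 280 + N * 750 + 420) +
     M * (2 * ((2 * N + 1) * (N * 100 + (2 * N + 1) * (26 * L + 200) + 100) + 70) + 80) + 300"

context arcs
begin

text \<open>The factor 130 covers 35 and 76 per round of the two searches and 13 per step of the
  climb.\<close>

lemma wp_query:
  assumes l: "layout s m" and half: "\<And>h. h < 2 * H \<Longrightarrow> ints s ''half'' h = h div 2" and H: "m \<le> H" "N \<le> H"
    and U: "union_find ((2 * m + 1) * (2 * N + 1)) (ints s ''par'') (ints s ''rk'') rep"
    and L: "\<And>k. 2 ^ k \<le> (2 * m + 1) * (2 * N + 1) \<Longrightarrow> k \<le> L"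
    and Q: "\<And>t s'. t \<le> 130 * L + 500 \<Longrightarrow> same (writes query) s s' \<Longrightarrow>
      ints s' ''out'' 0 = rep (cid (reals s ''qx'' 0, reals s ''qy'' 0)) \<Longrightarrow> Q t s'"
  shows "wp query Q s"
proof -
  define x y where "x = reals s ''qx'' 0" and "y = reals s ''qy'' 0"
  define c where "c = pos E x"
  define b where "b = c * (2 * N + 1)"
  define K where "K = ints s ''K'' c"
  have c: "fst (cell (x, y)) = c" by (simp add: cell_def c_def)
  have cm: "c \<le> 2 * m" using layout_cell_bounds(1)[OF l, of "(x, y)"] by (simp only: c)
  note o = colOKD[OF layoutD(6)[OF l cm]]
  \<comment> \<open>\<open>L\<close> is at least every exponent whose power fits below the number of
    cells, so the next power exceeds that number.\<close>
  have lt: "d < 2 ^ Suc L" if "d \<le> (2 * m + 1) * (2 * N + 1)" for d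
  proof (rule ccontr)
    assume "\<not> d < 2 ^ Suc L"
    then have "2 ^ Suc L \<le> d" by simp
    from L[OF le_trans[OF this that]] show False by simp
  qed
  have mL: "m < 2 ^ Suc L" "N < 2 ^ Suc L" by (rule lt, simp)+
  have ord: "order (\<lambda>t. ints s ''A'' (b + t)) K c" unfolding b_def K_def by (rule layout_order[OF l cm])
  have KN: "K \<le> N" using o(2) by (simp add: K_def)
  have AN: "ints s ''A'' (b + t) < N" if "t < K" for t using o(3) that by (simp only: b_def K_def)
  have V: "(\<lambda>t. val (ints s ''A'' (b + t)) x) ` {..<K} = Vals x" using ord unfolding order_def c_def by blast
  have inc: "val (ints s ''A'' (b + u)) x < val (ints s ''A'' (b + t)) x" if "u < t" "t < K" for u t
    using ord that unfolding order_def c_def by blast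
  have cidxy: "cid (x, y) = b + pos (Vals x) y" by (simp add: cid_def cell_def b_def c_def)
  show ?thesis
    unfolding query_def
    apply (simp only: wp_Seq wp_IAssign)
    apply (rule wp_search[where f = "reals s ''X''" and y = x and n = m and L = "Suc L"])
          apply (simp add: sameD)
         apply (simp add: sameD x_def)
        apply (simp add: sameD layoutD(2)[OF l])
       apply (rule half, use H in simp)
      apply (rule layoutD(3)[OF l], assumption+)
     apply (rule mL)
    subgoal premises p1 for t1 s1
    proof -
      have ps: "ints s1 ''ps'' 0 = c" using p1(3) by (simp only: layoutD(4)[OF l] c_def)
      have base1: "ints s1 ''base'' c = b" using p1(2) o(1) by (simp add: sameD b_def)
      define s2 where "s2 = istore ''bs'' 0 b (istore ''col'' 0 c s1)"
      have st: "istore ''bs'' (ival (IConst 0) (istore ''col'' (ival (IConst 0) s1) (ival (V ''ps'') s1) s1))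
          (ival (ICell ''base'' (V ''col'')) (istore ''col'' (ival (IConst 0) s1) (ival (V ''ps'') s1) s1))
          (istore ''col'' (ival (IConst 0) s1) (ival (V ''ps'') s1) s1) = s2"
        by (simp add: s2_def ps base1)
      have "same (writes query) s s1" by (rule same_mono[OF p1(2)]) (simp add: writes_query)
      then have sm2: "same (writes query) s s2" by (rule same_trans) (simp add: same_def s2_def writes_query)
      have s2: "ints s2 ''bs'' 0 = b" "ints s2 ''col'' 0 = c" by (simp_all add: s2_def)
      have key: "same (writes query) s s'" "ints s' ''bs'' 0 = b" "ints s' ''col'' 0 = c" if "same search_vars s2 s'" for s'
      proof -
        show "same (writes query) s s'" by (rule same_trans[OF sm2 same_mono[OF that]]) (simp add: writes_query)
        show "ints s' ''bs'' 0 = b" "ints s' ''col'' 0 = c" using that s2 by (simp_all add: sameD)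
      qed
      show ?thesis
        unfolding st
      proof (rule wp_search[where f = "\<lambda>t. val (ints s ''A'' (b + t)) x" and y = y and n = K and L = "Suc L"])
        fix s' assume sm: "same search_vars s2 s'"
        note k = key[OF sm]
        have am: "arcmem s'" by (rule layoutD(1)[OF layout_same(1)[OF l k(1)]]) (simp add: writes_query)
        have e: "ints s' ''A'' = ints s ''A''" "ints s' ''K'' = ints s ''K''" "reals s' ''qx'' 0 = x" "reals s' ''qy'' 0 = y"
          using k(1) by (simp_all add: sameD writes_query x_def y_def)
        show "rval (RV ''qy'') s' = y" using e by simp
        show "ival (ICell ''K'' (V ''col'')) s' = K" using e k(3) by (simp add: K_def)
        show "rval (valE (ICell ''A'' (IAdd (V ''bs'') (V ''md''))) (RV ''qx'')) s' = val (ints s ''A'' (b + ints s' ''md'' 0)) x"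
          if "ints s' ''md'' 0 < K"
          using rval_valE[OF am, of "ICell ''A'' (IAdd (V ''bs'') (V ''md''))"] AN[OF that] k(2) e by simp
      next
        show "ints s2 ''half'' h = h div 2" if "h < 2 * K" for h
          using half[of h] that KN H sm2 by (simp add: sameD writes_query)
        show "K < 2 ^ Suc L" using KN mL(2) by simp
        fix t2 s3 assume t2: "t2 \<le> Suc L * (rcost (valE (ICell ''A'' (IAdd (V ''bs'') (V ''md''))) (RV ''qx'')) + rcost (RV ''qy'') + 30) +
             2 * (rcost (valE (ICell ''A'' (IAdd (V ''bs'') (V ''md''))) (RV ''qx'')) + rcost (RV ''qy'') + icost (ICell ''K'' (V ''col''))) + 60"
          and sm: "same search_vars s2 s3" and ps3: "ints s3 ''ps'' 0 = pos ((\<lambda>t. val (ints s ''A'' (b + t)) x) ` {..<K}) y"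
        note k = key[OF sm]
        define s4 where "s4 = istore ''out'' 0 (cid (x, y)) s3"
        have st4: "istore ''out'' (ival (IConst 0) s3) (ival (IAdd (V ''bs'') (V ''ps'')) s3) s3 = s4"
          using k(2) ps3 by (simp add: s4_def cidxy V)
        have sm4: "same (writes query) s s4" by (rule same_trans[OF k(1)]) (simp add: same_def s4_def writes_query)
        have out: "ints s4 ''out'' 0 = cid (x, y)" by (simp add: s4_def)
        show "(\<lambda>s. wp (go_to_root ''out'') (\<lambda>u. Q (t1 + (icost (IConst 0) + icost (V ''ps'') + 1 +
            (icost (IConst 0) + icost (ICell ''base'' (V ''col'')) + 1 + (t2 + (icost (IConst 0) + icost (IAdd (V ''bs'') (V ''ps'')) + 1 + u))))))
            (istore ''out'' (ival (IConst 0) s) (ival (IAdd (V ''bs'') (V ''ps'')) s) s)) s3"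
          unfolding st4
        proof (rule wp_go_to_root[OF _ _ _ _ L])
          show "union_find ((2 * m + 1) * (2 * N + 1)) (ints s4 ''par'') (ints s4 ''rk'') rep"
            using U sm4 by (simp add: sameD writes_query)
          show "ints s4 ''out'' 0 < (2 * m + 1) * (2 * N + 1)" unfolding out by (rule cid_less[OF l])
          fix t assume "t \<le> 13 * L + 6"
          then show "Q (t1 + (icost (IConst 0) + icost (V ''ps'') + 1 +
            (icost (IConst 0) + icost (ICell ''base'' (V ''col'')) + 1 + (t2 + (icost (IConst 0) + icost (IAdd (V ''bs'') (V ''ps'')) + 1 + t)))))
              (istore ''out'' 0 (rep (ints s4 ''out'' 0)) s4)"
            using p1(1) t2 sm4 by (intro Q) (simp_all add: rcost_valE out x_def y_def same_def writes_query)
        qed simp_all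
      qed (rule inc)
    qed
    done
qed

lemma wp_build_structure:
  assumes a: "arcmem s" and M: "ints s ''M'' 0 = M" and E: "E = reals s ''Z'' ` {..<M}"
    and uf: "ints s ''par'' = (\<lambda>_. 0)" "ints s ''rk'' = (\<lambda>_. 0)"
    and L: "\<And>k. 2 ^ k \<le> (2 * M + 1) * (2 * N + 1) \<Longrightarrow> k \<le> L"
    and Q: "\<And>t s' m rep. t \<le> structure_time N M L \<Longrightarrow> layout s' m \<Longrightarrow> m \<le> M \<Longrightarrow> (\<And>h. h < 2 * M \<Longrightarrow> ints s' ''half'' h = h div 2) \<Longrightarrow>
      union_find ((2 * m + 1) * (2 * N + 1)) (ints s' ''par'') (ints s' ''rk'') rep \<Longrightarrow>
      (\<And>p q. rep (cid p) = rep (cid q) \<longleftrightarrow> sameface p q) \<Longrightarrow> Q t s'"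
  shows "wp build_structure Q s"
  unfolding build_structure_def
  apply (simp only: wp_Seq wp_IAssign)
  apply (rule wp_halve[OF M])
  apply (rule wp_sort_values[of _ M])
   apply (simp add: sameD halve_def M)
  subgoal for t1 s1 t2 s2 m
    apply (rule wp_copy_columns[of _ m])
     apply assumption
    subgoal for t3 s3
      apply (rule wp_columns[of _ m])
      subgoal premises p
        by (rule arcmem_same[OF p(13) _ arcmem_same[OF p(5) _ arcmem_same[OF _ _ arcmem_same[OF p(2) _ a], of "{''z''}"]]])
          (simp_all add: same_def copy_columns_def writes_sort_values halve_def)
       apply assumption
      subgoal premises p for t4 s4
      proof -
        note wr = copy_columns_def writes_sort_values halve_def columns_def column_def collect_arcs_def store_order_def store_cells_def
        note sm = sameD[OF p(2)] sameD[OF p(5)] sameD[OF p(13)] sameD[OF p(18)]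
        have am: "arcmem s4"
          by (rule arcmem_same[OF p(18) _ arcmem_same[OF p(13) _ arcmem_same[OF p(5) _ arcmem_same[OF _ _ arcmem_same[OF p(2) _ a], of "{''z''}"]]]])
            (simp_all add: same_def wr)
        have mx: "ints s4 ''mx'' 0 = m" using p(14) by (simp add: sm(7) wr)
        have Z: "reals s1 ''Z'' = reals s ''Z''" using sm(2) by (simp add: wr)
        have W: "reals s2 ''W'' ` {..<m} = E" using p(9) Z by (simp add: E)
        have X: "reals s4 ''X'' t = reals s2 ''W'' t" if "t < m" for t using p(15)[OF that] by (simp add: sm(8) wr)
        have XR: "reals s4 ''XR'' j = reals s2 ''R'' j" if "j \<le> 2 * m" for j using p(16)[OF that] by (simp add: sm(8) wr)
        have l: "layout s4 m"
          unfolding layout_def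
        proof (intro conjI allI impI)
          show "reals s4 ''X'' u < reals s4 ''X'' v" if "u < v" "v < m" for u v using p(8)[OF that] X that by simp
          show "reals s4 ''X'' ` {..<m} = E" unfolding W[symmetric] by (rule image_cong) (simp_all add: X)
          show "pos E (reals s4 ''XR'' j) = j" if "j \<le> 2 * m" for j using p(11)[OF that] by (simp only: XR[OF that] W)
          show "colOK s4 c" if "c \<le> 2 * m" for c by (rule p(19)[OF that])
        qed (rule am, rule mx)
        define C where "C = (2 * m + 1) * (2 * N + 1)"
        have LC: "k \<le> L" if "2 ^ k \<le> C" for k
        proof (rule L)
          have "C \<le> (2 * M + 1) * (2 * N + 1)" unfolding C_def using p(7) by (intro mult_le_mono1) simp
          then show "2 ^ k \<le> (2 * M + 1) * (2 * N + 1)" using that by (rule le_trans[rotated])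
        qed
        \<comment> \<open>The fixed equivalence for soundness: representatives in a common
          face.\<close>
        define F where "F = (\<lambda>c d. sameface (pt s4 c) (pt s4 d))"
        have eqF: "equivp F"
          unfolding F_def by (rule equivpI)
            (auto simp: reflp_def symp_def transp_def intro: sameface_refl sameface_sym sameface_trans)
        have uf4: "ints s4 ''par'' = (\<lambda>_. 0)" "ints s4 ''rk'' = (\<lambda>_. 0)" using uf by (simp_all add: sm(1,3,5,7) wr)
        have J: "joined C F (adjacent s4) {} s4"
          unfolding joined_def uf4 by (intro exI[of _ "\<lambda>c. c"] conjI union_find_init) (simp_all add: F_def sameface_refl)
        have half4: "ints s4 ''half'' h = h div 2" if "h < 2 * M" for h using p(3)[OF that] by (simp add: sm(3,5,7) wr)
        show ?thesis
        proof (rule wp_build_graph[OF am mx, where F = F and adj = "adjacent s4" and L = L and X = "reals s4 ''X''"])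
          show "ints s4 ''base'' c = c * (2 * N + 1)" "ints s4 ''K'' c \<le> N" if "c \<le> 2 * m" for c
            using colOKD(1,2)[OF layoutD(6)[OF l that]] by auto
          show "ints s4 ''A'' (c * (2 * N + 1) + t) < N" if "c \<le> 2 * m" "t < ints s4 ''K'' c" for c t
            by (rule colOKD(3)[OF layoutD(6)[OF l that(1)] that(2)])
          show "joined ((2 * m + 1) * (2 * N + 1)) F (adjacent s4) {} s4" using J by (simp only: C_def)
          show "k \<le> L" if "2 ^ k \<le> (2 * m + 1) * (2 * N + 1)" for k using LC that by (simp only: C_def)
          show "F c d" if "adjacent s4 c d" for c d
            using that sameface_closure unfolding F_def adjacent_def by blast
          show "adjacent s4 ((2 * p + 1) * (2 * N + 1) + i) (c * (2 * N + 1) + j) \<longleftrightarrow>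
              2 * card {t. t < ints s4 ''K'' c \<and> val (ints s4 ''A'' (c * (2 * N + 1) + t)) (reals s4 ''X'' p) < reals s4 ''YR'' ((2 * p + 1) * (2 * N + 1) + i)} \<le> j \<and>
              j \<le> 2 * card {t. t < ints s4 ''K'' c \<and> val (ints s4 ''A'' (c * (2 * N + 1) + t)) (reals s4 ''X'' p) \<le> reals s4 ''YR'' ((2 * p + 1) * (2 * N + 1) + i)} \<and>
              ints s4 ''CNT'' ((2 * p + 1) * (2 * N + 1) + i) = ints s4 ''CNT'' (c * (2 * N + 1) + j)"
            if "p < m" "c = 2 * p \<or> c = 2 * p + 2" "i \<le> 2 * ints s4 ''K'' (2 * p + 1)" "j \<le> 2 * ints s4 ''K'' c" for p c i j
            by (rule adjacent_iff[OF l that])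
        next
          fix t5 s5
          assume t5: "t5 \<le> m * (2 * ((2 * N + 1) * (N * 100 + (2 * N + 1) * (26 * L + 200) + 100) + 70) + 80) + 10"
            and sm5: "same (writes build_graph) s4 s5"
            and J5: "joined ((2 * m + 1) * (2 * N + 1)) F (adjacent s4) (\<Union>p<m. \<Union>d<2. cells_of s4 (2 * p + 1) \<times> cells_of s4 (2 * p + 2 * d)) s5"
          obtain rep where U5: "union_find ((2 * m + 1) * (2 * N + 1)) (ints s5 ''par'') (ints s5 ''rk'') rep"
            and S: "\<forall>c<(2 * m + 1) * (2 * N + 1). \<forall>d<(2 * m + 1) * (2 * N + 1). rep c = rep d \<longrightarrow> F c d"
            and A: "\<forall>(c, d)\<in>(\<Union>p<m. \<Union>d<2. cells_of s4 (2 * p + 1) \<times> cells_of s4 (2 * p + 2 * d)).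
              c < (2 * m + 1) * (2 * N + 1) \<longrightarrow> d < (2 * m + 1) * (2 * N + 1) \<longrightarrow> adjacent s4 c d \<longrightarrow> rep c = rep d"
            using J5 unfolding joined_def by (elim exE conjE) (rule that)
          have S5: "F c d" if "c < (2 * m + 1) * (2 * N + 1)" "d < (2 * m + 1) * (2 * N + 1)" "rep c = rep d" for c d
            using S[rule_format, OF that] .
          have A5: "rep c = rep d" if "(c, d) \<in> (\<Union>p<m. \<Union>d<2. cells_of s4 (2 * p + 1) \<times> cells_of s4 (2 * p + 2 * d))"
              "c < (2 * m + 1) * (2 * N + 1)" "d < (2 * m + 1) * (2 * N + 1)" "adjacent s4 c d" for c d
            using bspec[OF A that(1)] that(2-4) by simp
          have disj: "{''nn'', ''r'', ''x'', ''y'', ''sg'', ''mx'', ''X'', ''XR'', ''base'', ''K'', ''A'', ''YR'', ''CNT''} \<inter> writes build_graph = {}"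
            by (simp add: build_graph_def writes_join_cell)
          have time: "t1 + (icost (IConst 0) + icost (V ''M'') + 1 + (t2 + (t3 + (t4 + t5)))) \<le> structure_time N M L"
          proof -
            define w1 w2 where "w1 = N * N * 280 + N * 750 + 420"
              and "w2 = 2 * ((2 * N + 1) * (N * 100 + (2 * N + 1) * (26 * L + 200) + 100) + 70) + 80"
            have "(2 * m + 1) * w1 \<le> (2 * M + 1) * w1" "m * w2 \<le> M * w2"
              using p(7) by (intro mult_le_mono1, simp)+
            moreover have "t4 \<le> (2 * m + 1) * w1 + 30" "t5 \<le> m * w2 + 10" using p(17) t5 by (simp_all only: w1_def w2_def)
            ultimately have "t4 \<le> (2 * M + 1) * w1 + 30" "t5 \<le> M * w2 + 10" by linarith+
            moreover have "t3 \<le> 100 * M + 100" using p(12,7) by linarith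
            moreover have "t1 \<le> 40 * M + 10" using p(1) .
            moreover have "t2 \<le> M * (M * 80 + 150) + 80" using p(4) .
            ultimately show ?thesis unfolding structure_time_def w1_def[symmetric] w2_def[symmetric]
              unfolding icost.simps by linarith
          qed
          show "Q (t1 + (icost (IConst 0) + icost (V ''M'') + 1 + (t2 + (t3 + (t4 + t5))))) s5"
          proof (rule Q[OF time])
            show "layout s5 m" by (rule layout_same(1)[OF l sm5 disj])
            show "m \<le> M" by (rule p(7))
            show "ints s5 ''half'' h = h div 2" if "h < 2 * M" for h
              using half4[OF that] sm5 by (simp add: sameD build_graph_def writes_join_cell)
            show "union_find ((2 * m + 1) * (2 * N + 1)) (ints s5 ''par'') (ints s5 ''rk'') rep" by (rule U5)
            show "rep (cid p) = rep (cid q) \<longleftrightarrow> sameface p q" for p q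
              by (rule labels_iff_sameface[OF l S5[unfolded F_def] A5])
          qed
        qed (rule eqF refl)+
      qed
      done
    done
  done

end

section \<open>Sequences of queries and the whole algorithm\<close>

context arcs
begin

text \<open>The invariant for the coinduction over query sequences. \<open>rep\<close> is a
  parameter because the names of the faces must not change from query to query.\<close>

definition usable :: "state \<Rightarrow> nat \<Rightarrow> (nat \<Rightarrow> nat) \<Rightarrow> bool" where
  "usable s M rep \<longleftrightarrow> (\<exists>m\<le>M. layout s m \<and> union_find ((2 * m + 1) * (2 * N + 1)) (ints s ''par'') (ints s ''rk'') rep) \<and>
     (\<forall>h<2 * M. ints s ''half'' h = h div 2) \<and> (\<forall>p q. rep (cid p) = rep (cid q) \<longleftrightarrow> sameface p q)"

lemma usable_same:
  assumes "usable s M rep" "same U s s'"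
    and U: "{''nn'', ''r'', ''x'', ''y'', ''sg'', ''mx'', ''X'', ''XR'', ''base'', ''K'', ''A'', ''YR'', ''CNT'', ''par'', ''rk'', ''half''} \<inter> U = {}"
  shows "usable s' M rep"
proof -
  have n: "''par'' \<notin> U" "''rk'' \<notin> U" "''half'' \<notin> U"
    and d: "{''nn'', ''r'', ''x'', ''y'', ''sg'', ''mx'', ''X'', ''XR'', ''base'', ''K'', ''A'', ''YR'', ''CNT''} \<inter> U = {}" using U by simp_all
  obtain m where m: "m \<le> M" "layout s m" "union_find ((2 * m + 1) * (2 * N + 1)) (ints s ''par'') (ints s ''rk'') rep"
    and h: "\<forall>h<2 * M. ints s ''half'' h = h div 2" "\<forall>p q. rep (cid p) = rep (cid q) \<longleftrightarrow> sameface p q"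
    using assms(1) unfolding usable_def by blast
  note e = sameD(1)[OF assms(2) n(1)] sameD(1)[OF assms(2) n(2)] sameD(1)[OF assms(2) n(3)]
  have "layout s' m" by (rule layout_same(1)[OF m(2) assms(2) d])
  then show ?thesis unfolding usable_def e using m(1,3) h by (intro conjI exI[of _ m]) assumption+
qed

lemma usable_answers:
  assumes us: "usable s M rep" and NM: "N \<le> M"
    and D: "boundary_circle ` D = (\<lambda>k. sphere (ax k, ay k) r) ` {..<N}"
    and L: "\<And>k. 2 ^ k \<le> (2 * M + 1) * (2 * N + 1) \<Longrightarrow> k \<le> L"
  shows "\<exists>lab. inj_on lab (faces D) \<and> answers_queries query (real (130 * L + 500)) lab D s"
proof -
  \<comment> \<open>Any point of the face will do, as \<open>rep\<close> depends only on the
    face.\<close>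
  define lab where "lab = (\<lambda>F. rep (cid (SOME p. p \<in> F)))"
  have rep: "rep (cid p) = rep (cid q) \<longleftrightarrow> sameface p q" for p q using us unfolding usable_def by blast
  have lab: "lab F = rep (cid p)" if F: "F \<in> faces D" "p \<in> F" for F p
  proof -
    have "(SOME p. p \<in> F) \<in> F" using F(2) by (rule someI)
    then have "sameface p (SOME p. p \<in> F)" using faces_sameface[OF D F] by blast
    then show ?thesis unfolding lab_def using rep by metis
  qed
  have "inj_on lab (faces D)"
  proof (rule inj_onI)
    fix F G assume F: "F \<in> faces D" and G: "G \<in> faces D" and e: "lab F = lab G"
    have "F \<noteq> {}" "G \<noteq> {}" using F G in_components_nonempty unfolding faces_def curve_faces_def by blast+
    then obtain p q where pq: "p \<in> F" "q \<in> G" by blast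
    have "rep (cid p) = rep (cid q)" using lab[OF F pq(1)] lab[OF G pq(2)] e by simp
    then have "q \<in> F" using faces_sameface[OF D F pq(1)] rep by blast
    then show "F = G" using faces_partition[of D q] F G pq(2) by blast
  qed
  moreover have "answers_queries query (real (130 * L + 500)) lab D s"
    using us
  proof (coinduction arbitrary: s rule: answers_queries.coinduct)
    case (answers_queries s)
    have step: "\<exists>t s' F. exec query (load_query q s) t s' \<and> real t \<le> real (130 * L + 500) \<and> F \<in> faces D \<and> q \<in> F \<and>
       query_result s' = lab F \<and> usable s' M rep" for q
    proof -
      let ?s = "load_query q s"
      have "same {''qx'', ''qy''} s ?s" by (simp add: same_def load_query_def)
      then have u: "usable ?s M rep" by (rule usable_same[OF answers_queries]) simp
      obtain m where m: "m \<le> M" "layout ?s m" "union_find ((2 * m + 1) * (2 * N + 1)) (ints ?s ''par'') (ints ?s ''rk'') rep"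
        and h: "\<And>h. h < 2 * M \<Longrightarrow> ints ?s ''half'' h = h div 2" using u unfolding usable_def by blast
      have "wp query (\<lambda>t s'. t \<le> 130 * L + 500 \<and> usable s' M rep \<and> ints s' ''out'' 0 = rep (cid q)) ?s"
      proof (rule wp_query[OF m(2) h m(1) NM m(3)])
        fix k assume "2 ^ k \<le> (2 * m + 1) * (2 * N + 1)"
        also have "\<dots> \<le> (2 * M + 1) * (2 * N + 1)" using m(1) by (intro mult_le_mono1) simp
        finally show "k \<le> L" by (rule L)
      next
        fix t s' assume t: "t \<le> 130 * L + 500" and sm: "same (writes query) ?s s'"
          and out: "ints s' ''out'' 0 = rep (cid (reals ?s ''qx'' 0, reals ?s ''qy'' 0))"
        have "usable s' M rep" by (rule usable_same[OF u sm]) (simp add: writes_query)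
        then show "t \<le> 130 * L + 500 \<and> usable s' M rep \<and> ints s' ''out'' 0 = rep (cid q)"
          using t out by (simp add: load_query_def)
      qed
      then obtain t s' where e: "exec query ?s t s'" "t \<le> 130 * L + 500" "usable s' M rep" "ints s' ''out'' 0 = rep (cid q)"
        unfolding wp_def by blast
      obtain F where F: "F \<in> faces D" "q \<in> F" using faces_partition by blast
      have "query_result s' = lab F" using e(4) lab[OF F] by (simp add: query_result_def)
      moreover have "real t \<le> real (130 * L + 500)" using e(2) by (simp only: of_nat_le_iff)
      ultimately show ?thesis using e F by blast
    qed
    show ?case
    proof (intro exI[of _ s] conjI refl allI)
      fix q
      obtain t s' F where "exec query (load_query q s) t s'" "real t \<le> real (130 * L + 500)" "F \<in> faces D" "q \<in> F"
        "query_result s' = lab F" "usable s' M rep" using step[of q] by blast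
      then show "\<exists>t s' F. exec query (load_query q s) t s' \<and> real t \<le> real (130 * L + 500) \<and> F \<in> faces D \<and> q \<in> F \<and>
         query_result s' = lab F \<and> ((\<exists>s. s' = s \<and> usable s M rep) \<or> answers_queries query (real (130 * L + 500)) lab D s')"
        by (intro exI conjI disjI1) (assumption | rule refl)+
    qed
  qed
  ultimately show ?thesis by blast
qed

end

definition preprocessing_time :: "nat \<Rightarrow> nat \<Rightarrow> nat" where
  "preprocessing_time n L = 60 * n + 20 + (2 * n * (2 * n * 150 + 30) + 20) + structure_time (2 * n) (2 * (2 * n * (2 * n))) L"

lemma wp_preprocess:
  fixes ds :: "disk list"
  defines "n \<equiv> length ds"
  assumes pos: "\<And>d. d \<in> set ds \<Longrightarrow> 0 < radius d" and cong: "congruent_disks (set ds)"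
    and L: "\<And>k. 2 ^ k \<le> (2 * (2 * (2 * n * (2 * n))) + 1) * (2 * (2 * n) + 1) \<Longrightarrow> k \<le> L"
  shows "wp preprocess (\<lambda>t s. t \<le> preprocessing_time n L \<and>
     (\<exists>lab. inj_on lab (faces (set ds)) \<and> answers_queries query (real (130 * L + 500)) lab (set ds) s)) (input_state ds)"
  unfolding preprocess_def wp_Seq
proof (rule wp_duplicate_arcs[of _ n])
  let ?s = "input_state ds"
  define N where "N = 2 * n"
  define M where "M = 2 * (N * N)"
  show "ints ?s ''n'' 0 = n" by (simp add: input_state_def n_def)
  fix t1 s1
  assume t1: "t1 \<le> 60 * n + 20" and sm1: "same (writes duplicate_arcs) ?s s1" and nn1: "ints s1 ''nn'' 0 = 2 * n"
    and dup: "\<And>k. k < n \<Longrightarrow> reals s1 ''x'' k = reals ?s ''x'' k \<and> reals s1 ''y'' k = reals ?s ''y'' k \<and> reals s1 ''sg'' k = -1 \<and>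
        reals s1 ''x'' (n + k) = reals ?s ''x'' k \<and> reals s1 ''y'' (n + k) = reals ?s ''y'' k \<and> reals s1 ''sg'' (n + k) = 1"
  define ax ay sg where "ax = reals s1 ''x''" and "ay = reals s1 ''y''" and "sg = reals s1 ''sg''"
  define r where "r = reals s1 ''r'' 0"
  \<comment> \<open>The program reads the radius of the first disk only; congruence makes it the
    radius of all.\<close>
  have r: "r = radius (ds ! k)" if "k < n" for k
  proof -
    have "0 < length ds" using that n_def by auto
    then have "reals ?s ''r'' 0 = radius (ds ! 0)" by (simp add: input_state_def)
    moreover have "reals s1 ''r'' = reals ?s ''r''" using sm1 by (simp add: sameD duplicate_arcs_def)
    moreover have "radius (ds ! 0) = radius (ds ! k)"
      using cong that \<open>0 < length ds\<close> unfolding congruent_disks_def n_def by (meson nth_mem)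
    ultimately show ?thesis by (simp add: r_def)
  qed
  have xy: "ax k = fst (center (ds ! k))" "ay k = snd (center (ds ! k))" "sg k = -1"
    "ax (n + k) = fst (center (ds ! k))" "ay (n + k) = snd (center (ds ! k))" "sg (n + k) = 1" if "k < n" for k
    using dup[OF that] that by (simp_all add: ax_def ay_def sg_def input_state_def n_def)
  have split: "(\<exists>j<n. k = j \<or> k = n + j)" if "k < N" for k
  proof (cases "k < n")
    case False
    then have "k - n < n" "k = n + (k - n)" using that by (auto simp: N_def)
    then show ?thesis by blast
  qed blast
  show "wp list_events (\<lambda>t. wp build_structure (\<lambda>u s. t1 + (t + u) \<le> preprocessing_time n L \<and>
     (\<exists>lab. inj_on lab (faces (set ds)) \<and> answers_queries query (real (130 * L + 500)) lab (set ds) s))) s1"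
  proof (rule wp_list_events[of _ N])
    show "ints s1 ''nn'' 0 = N" by (simp add: nn1 N_def)
    fix t2 s2
    assume t2: "t2 \<le> N * (N * 150 + 30) + 20" and sm2: "same (writes list_events) s1 s2" and M2: "ints s2 ''M'' 0 = 2 * (N * N)"
      and ex: "\<And>k. k < N \<Longrightarrow> reals s1 ''x'' k + reals s1 ''sg'' k * reals s1 ''r'' 0 \<in> reals s2 ''Z'' ` {..<2 * (N * N)}"
      and cr: "\<And>k l. k < N \<Longrightarrow> l < N \<Longrightarrow> rval (crossx (IConst k) (IConst l)) s1 \<in> reals s2 ''Z'' ` {..<2 * (N * N)}"
    define E where "E = reals s2 ''Z'' ` {..<M}"
    interpret arcs N ax ay sg r E
    proof
      fix k l assume k: "k < N"
      then obtain j where j: "j < n" "k = j \<or> k = n + j" using split by blast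
      show "0 < r" unfolding r[OF j(1)] using j(1) by (intro pos) (simp add: n_def)
      show "sg k = 1 \<or> sg k = -1" using j xy by auto
      show "\<exists>l<N. ax l = ax k \<and> ay l = ay k \<and> sg l = - sg k"
      proof (cases "k = j")
        case True
        then show ?thesis using j xy[OF j(1)] by (intro exI[of _ "n + j"]) (simp add: N_def)
      next
        case False
        then show ?thesis using j xy[OF j(1)] by (intro exI[of _ j]) (auto simp: N_def)
      qed
      show "ax k + sg k * r \<in> E" using ex[OF k] by (simp only: ax_def sg_def r_def E_def M_def)
      assume l: "l < N"
      show "(ax k + ax l) / 2 + (ay l - ay k) *
        sqrt (r * r / ((ax k - ax l) * (ax k - ax l) + (ay k - ay l) * (ay k - ay l)) - 1 / 4) \<in> E"
        using cr[OF k l] by (simp add: crossx_def ax_def ay_def r_def E_def M_def)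
    qed (simp add: E_def)
    have am: "arcmem s2"
      unfolding arcmem_def using sm2 nn1 by (simp add: sameD list_events_def N_def ax_def ay_def sg_def r_def)
    have D: "boundary_circle ` set ds = (\<lambda>k. sphere (ax k, ay k) r) ` {..<N}"
    proof -
      have c: "boundary_circle (ds ! j) = sphere (ax j, ay j) r" "boundary_circle (ds ! j) = sphere (ax (n + j), ay (n + j)) r" if "j < n" for j
        using xy[OF that] r[OF that] by (simp_all add: boundary_circle_def)
      show ?thesis
      proof (intro equalityI subsetI)
        fix \<gamma> assume "\<gamma> \<in> boundary_circle ` set ds"
        then obtain j where j: "j < n" "\<gamma> = boundary_circle (ds ! j)" by (auto simp: in_set_conv_nth n_def)
        then show "\<gamma> \<in> (\<lambda>k. sphere (ax k, ay k) r) ` {..<N}" using c(1)[OF j(1)] by (intro image_eqI[of _ _ j]) (auto simp: N_def)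
      next
        fix \<gamma> assume "\<gamma> \<in> (\<lambda>k. sphere (ax k, ay k) r) ` {..<N}"
        then obtain k where k: "k < N" "\<gamma> = sphere (ax k, ay k) r" by blast
        then obtain j where j: "j < n" "k = j \<or> k = n + j" using split by blast
        then have "\<gamma> = boundary_circle (ds ! j)" using c[OF j(1)] k by auto
        then show "\<gamma> \<in> boundary_circle ` set ds" using j(1) by (simp add: n_def)
      qed
    qed
    have NM: "N \<le> M" by (simp add: M_def)
    have LM: "k \<le> L" if "2 ^ k \<le> (2 * M + 1) * (2 * N + 1)" for k using L that by (simp only: M_def N_def)
    show "wp build_structure (\<lambda>u s. t1 + (t2 + u) \<le> preprocessing_time n L \<and>
     (\<exists>lab. inj_on lab (faces (set ds)) \<and> answers_queries query (real (130 * L + 500)) lab (set ds) s)) s2"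
    proof (rule wp_build_structure[OF am _ E_def _ _ LM])
      show "ints s2 ''M'' 0 = M" by (simp add: M2 M_def)
      show "ints s2 ''par'' = (\<lambda>_. 0)" "ints s2 ''rk'' = (\<lambda>_. 0)"
        using sm1 sm2 by (simp_all add: sameD list_events_def duplicate_arcs_def input_state_def)
      fix t3 s3 m rep
      assume t3: "t3 \<le> structure_time N M L" and l3: "layout s3 m" "m \<le> M" and half: "\<And>h. h < 2 * M \<Longrightarrow> ints s3 ''half'' h = h div 2"
        and U: "union_find ((2 * m + 1) * (2 * N + 1)) (ints s3 ''par'') (ints s3 ''rk'') rep"
        and rep: "\<And>p q. rep (cid p) = rep (cid q) \<longleftrightarrow> sameface p q"
      have us: "usable s3 M rep" unfolding usable_def using l3 half U rep by blast
      have "t1 + (t2 + t3) \<le> preprocessing_time n L"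
        using t1 t2 t3 unfolding preprocessing_time_def N_def[symmetric] M_def[symmetric] by linarith
      then show "t1 + (t2 + t3) \<le> preprocessing_time n L \<and>
         (\<exists>lab. inj_on lab (faces (set ds)) \<and> answers_queries query (real (130 * L + 500)) lab (set ds) s3)"
        using usable_answers[OF us NM D LM] by blast
    qed
  qed
qed

section \<open>Running times\<close>

text \<open>The binary logarithm of the bound \<open>(2 * M + 1) * (2 * N + 1)\<close> on the number
  of cells, with \<open>N = 2 * n\<close> arcs and \<open>M = 2 * (N * N)\<close> listed
  events.\<close>

definition log_cells :: "nat \<Rightarrow> nat" where
  "log_cells n = nat \<lfloor>log 2 (real ((2 * (2 * (2 * n * (2 * n))) + 1) * (2 * (2 * n) + 1)))\<rfloor>"

lemma log_cells_ge:
  assumes "2 ^ k \<le> (2 * (2 * (2 * n * (2 * n))) + 1) * (2 * (2 * n) + 1)"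
  shows "k \<le> log_cells n"
proof -
  let ?C = "(2 * (2 * (2 * n * (2 * n))) + 1) * (2 * (2 * n) + 1)"
  have "(2::real) ^ k \<le> real ?C" using assms by (metis of_nat_le_iff of_nat_numeral of_nat_power)
  then have "real k \<le> log 2 (real ?C)" by (rule le_log_of_power) simp
  then show ?thesis unfolding log_cells_def by (simp add: le_nat_floor)
qed

lemma log_cells_le: "real (log_cells n) \<le> log 2 ((16 * real n ^ 2 + 1) * (4 * real n + 1))"
proof -
  let ?C = "(2 * (2 * (2 * n * (2 * n))) + 1) * (2 * (2 * n) + 1)"
  have C: "real ?C = (16 * real n ^ 2 + 1) * (4 * real n + 1)" by (simp add: power2_eq_square algebra_simps)
  have "0 \<le> log 2 x" if "1 \<le> x" for x :: real using that by simp
  moreover have "1 \<le> real ?C" by simp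
  ultimately have "0 \<le> log 2 (real ?C)" by blast
  then have "real (log_cells n) \<le> log 2 (real ?C)" unfolding log_cells_def by (rule of_nat_floor)
  then show ?thesis by (simp only: C)
qed

lemma query_time_bigo: "(\<lambda>n. real (130 * log_cells n + 500)) \<in> O(\<lambda>n. ln (real n))"
proof -
  let ?f = "\<lambda>n. 130 * log 2 ((16 * real n ^ 2 + 1) * (4 * real n + 1)) + 500"
  have "(\<lambda>n. real (130 * log_cells n + 500)) \<in> O(?f)"
  proof (rule bigoI[of _ 1], intro always_eventually allI)
    fix n
    have "real (130 * log_cells n + 500) \<le> ?f n" using log_cells_le[of n] by simp
    then show "norm (real (130 * log_cells n + 500)) \<le> 1 * norm (?f n)" by simp
  qed
  \<comment> \<open>The argument of the logarithm is a cubic polynomial in \<open>n\<close>.\<close>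
  also have "?f \<in> O(\<lambda>n. ln (real n))" by real_asymp
  finally show ?thesis .
qed

text \<open>The time is affine in \<open>L\<close>; isolating the slope allows \<open>L\<close> to
  be replaced by a real logarithm.\<close>

lemma preprocessing_time_split:
  "preprocessing_time n L = preprocessing_time n 0 + 2 * (2 * n * (2 * n)) * (2 * ((2 * (2 * n) + 1) * ((2 * (2 * n) + 1) * 26))) * L"
  by (simp add: preprocessing_time_def structure_time_def algebra_simps)

lemma preprocessing_time_bigo: "(\<lambda>n. real (preprocessing_time n (log_cells n))) \<in> O(\<lambda>n. real n ^ 4 * ln (real n))"
proof -
  let ?l = "\<lambda>n. log 2 ((16 * real n ^ 2 + 1) * (4 * real n + 1))"
  let ?g = "\<lambda>n. real (2 * (2 * n * (2 * n)) * (2 * ((2 * (2 * n) + 1) * ((2 * (2 * n) + 1) * 26))))"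
  let ?f = "\<lambda>n. real (preprocessing_time n 0) + ?g n * ?l n"
  have "(\<lambda>n. real (preprocessing_time n (log_cells n))) \<in> O(?f)"
  proof (rule bigoI[of _ 1], intro always_eventually allI)
    fix n
    have "?g n * real (log_cells n) \<le> ?g n * ?l n" by (intro mult_left_mono log_cells_le) simp
    then have "real (preprocessing_time n (log_cells n)) \<le> ?f n"
      by (subst preprocessing_time_split) (simp only: of_nat_add of_nat_mult add_left_mono)
    then show "norm (real (preprocessing_time n (log_cells n))) \<le> 1 * norm (?f n)" by simp
  qed
  also have "?f \<in> O(\<lambda>n. real n ^ 4 * ln (real n))"
    unfolding preprocessing_time_def structure_time_def of_nat_add of_nat_mult of_nat_numeral of_nat_1 by real_asymp
  finally show ?thesis .
qed

theorem mainTheorem2: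
  "\<exists>(P :: com) (Q :: com) (Tp :: nat \<Rightarrow> real) (Tq :: nat \<Rightarrow> real).
     Tp \<in> O(\<lambda>n. real n ^ 4 * ln (real n)) \<and>
     Tq \<in> O(\<lambda>n. ln (real n)) \<and>
     (\<forall>n ds. length ds = n \<and> distinct ds \<and> (\<forall>d\<in>set ds. radius d > 0) \<and> congruent_disks (set ds) \<longrightarrow>
        preprocesses P Q (Tp n) (Tq n) ds)"
proof -
  have "preprocesses preprocess query (real (preprocessing_time n (log_cells n))) (real (130 * log_cells n + 500)) ds"
    if "length ds = n \<and> distinct ds \<and> (\<forall>d\<in>set ds. radius d > 0) \<and> congruent_disks (set ds)" for n ds
  proof -
    have n: "length ds = n" and pos: "\<And>d. d \<in> set ds \<Longrightarrow> 0 < radius d" and cong: "congruent_disks (set ds)"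
      using that by auto
    have "wp preprocess (\<lambda>t s. t \<le> preprocessing_time (length ds) (log_cells (length ds)) \<and>
       (\<exists>lab. inj_on lab (faces (set ds)) \<and> answers_queries query (real (130 * log_cells (length ds) + 500)) lab (set ds) s)) (input_state ds)"
      by (rule wp_preprocess[OF pos cong log_cells_ge])
    then show ?thesis
      unfolding wp_def preprocesses_def n by (metis of_nat_le_iff)
  qed
  then show ?thesis using preprocessing_time_bigo query_time_bigo by blast
qed

end
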